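(* There is a sufficiently large absolute constant $c_\beta$ and a sufficiently small absolute constant $\delta>0$ such that the following holds. Let $k$ be the number of sites and $0<\varepsilon<1$ with $c_\beta \le 1/\varepsilon^2 \le k/c_\beta$. Then any randomized protocol in the message-passing (coordinator) model that computes a $(1+\varepsilon)$-approximation to $F_0$ of the union of the $k$ sites' inputs with error probability $\delta$ has communication complexity $\Omega\left(\frac{k}{\varepsilon^2 \log(\varepsilon^2 k)}\right)$ bits.
   Context: Message-passing (coordinator) model: there are $k$ sites $S_1,\dots,S_k$ and a coordinator; each site $S_i$ holds an input (here a subset/multiset $A_i$ of a universe $[N]$), and communication takes place only between the coordinator and individual sites; the cost is the total number of bits exchanged. $F_0$ is the number of distinct elements in $A_1\cup\dots\cup A_k$. A value $\tilde W$ is a $(1+\varepsilon)$-approximation of $W$ if $W\le \tilde W\le (1+\varepsilon)W$. A randomized protocol has error probability $\delta$ if on every input its output fails to be a $(1+\varepsilon)$-approximation with probability at most $\delta$.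
   Formalization: The universe [N] is required to have size N at least an absolute constant times 1/ε²; without such a condition the bound fails (for N = 1, k bits suffice to compute F_0 exactly). *)

theory Defs
  imports "HOL-Probability.Probability"
begin

text \<open>
  The coordinator has no input, so its part of a deterministic protocol is a decision tree over the
  bits it has received: it stops with an output, sends one bit to a site, or waits for one bit from
  a site.
\<close>

datatype (contacted: 'i) coordinator =
    Output real
  | Send 'i bool "'i coordinator"
  | Receive 'i "bool \<Rightarrow> 'i coordinator"

datatype event = To_Site bool | From_Site bool

text \<open>
  A site determines its next bit from its own input and from the bits exchanged so far on its own
  channel (oldest first). It sees no traffic between the coordinator and the other sites; this is
  what separates the message-passing model from the blackboard model.
\<close>

type_synonym site = "nat set \<Rightarrow> event list \<Rightarrow> bool"

datatype protocol = Protocol (coord: "nat coordinator") (site: "nat \<Rightarrow> site")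

text \<open>In \<open>result s A p h\<close> and \<open>cost s A p h\<close>, \<open>h i\<close> is the history of the channel of site \<open>i\<close>.\<close>

primrec result :: "(nat \<Rightarrow> site) \<Rightarrow> (nat \<Rightarrow> nat set) \<Rightarrow> nat coordinator \<Rightarrow> (nat \<Rightarrow> event list) \<Rightarrow> real" where
  "result s A (Output v) h = v"
| "result s A (Send i b p) h = result s A p (h(i := h i @ [To_Site b]))"
| "result s A (Receive i q) h =
    (let b = s i (A i) (h i) in result s A (q b) (h(i := h i @ [From_Site b])))"

primrec cost :: "(nat \<Rightarrow> site) \<Rightarrow> (nat \<Rightarrow> nat set) \<Rightarrow> nat coordinator \<Rightarrow> (nat \<Rightarrow> event list) \<Rightarrow> nat" where
  "cost s A (Output v) h = 0"
| "cost s A (Send i b p) h = Suc (cost s A p (h(i := h i @ [To_Site b])))"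
| "cost s A (Receive i q) h =
    (let b = s i (A i) (h i) in Suc (cost s A (q b) (h(i := h i @ [From_Site b]))))"

definition protocol_output :: "protocol \<Rightarrow> (nat \<Rightarrow> nat set) \<Rightarrow> real" where
  "protocol_output \<pi> A = result (site \<pi>) A (coord \<pi>) (\<lambda>_. [])"

definition bits_exchanged :: "protocol \<Rightarrow> (nat \<Rightarrow> nat set) \<Rightarrow> nat" where
  "bits_exchanged \<pi> A = cost (site \<pi>) A (coord \<pi>) (\<lambda>_. [])"

definition inputs :: "nat \<Rightarrow> nat \<Rightarrow> (nat \<Rightarrow> nat set) set" where
  "inputs k N = {..<k} \<rightarrow>\<^sub>E Pow {1..N}"

definition F0 :: "nat \<Rightarrow> (nat \<Rightarrow> nat set) \<Rightarrow> nat" where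
  "F0 k A = card (\<Union>i<k. A i)"

definition is_approx :: "real \<Rightarrow> real \<Rightarrow> real \<Rightarrow> bool" where
  "is_approx \<epsilon> W W' \<longleftrightarrow> W \<le> W' \<and> W' \<le> (1 + \<epsilon>) * W"

text \<open>
  A randomized protocol is a probability distribution over deterministic ones, i.e. all parties may
  use shared coins. Private coins are the special case where the coordinator and the sites are drawn
  independently.
\<close>

definition randomized_protocol :: "nat \<Rightarrow> protocol pmf \<Rightarrow> bool" where
  "randomized_protocol k P \<longleftrightarrow> (\<forall>\<pi>\<in>set_pmf P. contacted (coord \<pi>) \<subseteq> {..<k})"

definition approximates_F0 :: "nat \<Rightarrow> nat \<Rightarrow> real \<Rightarrow> real \<Rightarrow> protocol pmf \<Rightarrow> bool" where
  "approximates_F0 k N \<epsilon> \<delta> P \<longleftrightarrow>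
    (\<forall>A\<in>inputs k N. measure_pmf.prob P {\<pi>. \<not> is_approx \<epsilon> (real (F0 k A)) (protocol_output \<pi> A)} \<le> \<delta>)"

text \<open>Worst case over inputs and coins; the value is \<open>\<infinity>\<close> if the cost is unbounded.\<close>

definition communication_complexity :: "nat \<Rightarrow> nat \<Rightarrow> protocol pmf \<Rightarrow> enat" where
  "communication_complexity k N P =
    (SUP \<pi>\<in>set_pmf P. SUP A\<in>inputs k N. enat (bits_exchanged \<pi> A))"

end

theory Submission
  imports Defs
begin

text \<open>
  The bound is proved without the logarithmic loss. Take a universe \<open>U\<close> of size \<open>m\<close>, a small constant
  times \<open>1 / \<epsilon>\<^sup>2\<close>. One site holds \<open>U - y\<close> for a random \<open>y\<close>. Every other site holds a random set
  disjoint from \<open>y\<close> and, with a probability \<open>\<beta>\<close> of order \<open>m / k\<close>, in addition one uniformly random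
  element of \<open>U\<close>. Hence \<open>F\<^sub>0\<close> is \<open>m - card y\<close> plus the number \<open>D\<close> of elements of \<open>y\<close> that have been hit,
  and the protocol has to find \<open>D\<close> up to a small multiple of \<open>sqrt m\<close>.

  Given \<open>y\<close>, the assigned elements and the transcript, the sites are independent, and the posterior
  probability that a site made a hit depends only on the history of its own channel. If a channel
  carries less than a small multiple of \<open>m\<close> bits, it cannot tell a hit from a miss: this is
  two-party set disjointness, treated as usual with Hellinger distances. So \<open>D\<close> still has a variance
  of order \<open>m\<close> given the transcript, and a sum of independent Bernoulli variables of that variance
  leaves every window of length a small multiple of \<open>sqrt m\<close> with constant probability.
\<close>

subsection \<open>Averages over subsets and two-party protocols\<close>

text \<open>Conditioning on the assignment \<open>J\<close> of elements to sites is what makes the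
  variance explicit: given \<open>J\<close>, \<open>y\<close> and the transcript, \<open>D\<close>
  is a sum over \<open>l \<in> y\<close> of independent indicators that some site assigned
  \<open>l\<close> made a hit. Posteriors below the prior \<open>\<beta>\<close> are the first-order
  danger for this variance. Posteriors far above it are rare, since they average to
  \<open>\<beta>\<close>, and they enter with a further factor \<open>\<beta>\<close>. Hence only
  the positive part of miss minus hit has to be bounded.

  The obstacle is that a hit in \<open>y\<close> gives an intersecting pair of sets, while
  \<open>(x, y)\<close> is always disjoint and expected lengths are taken over disjoint pairs. The
  cut-and-paste identity carries indistinguishability over to the intersecting case.

  About \<open>\<beta> * K\<close> hits are needed for a variance of order \<open>m\<close>, so
  \<open>\<beta>\<close> is a multiple of \<open>m / K\<close>. Sites sharing an element cost about
  \<open>\<beta>\<^sup>2 * K\<^sup>2 / m\<close>, quadratic in that multiple, so a small multiple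
  keeps the gain ahead.\<close>

definition subset_avg :: "'a set \<Rightarrow> ('a set \<Rightarrow> real) \<Rightarrow> real" where
  "subset_avg S \<phi> = (\<Sum>x\<in>Pow S. \<phi> x) / 2 ^ card S"

lemma sum_Pow_insert:
  fixes \<phi> :: "'a set \<Rightarrow> 'b :: comm_monoid_add"
  assumes "finite S" "l \<notin> S"
  shows "(\<Sum>x\<in>Pow (insert l S). \<phi> x) = (\<Sum>x\<in>Pow S. \<phi> x) + (\<Sum>x\<in>Pow S. \<phi> (insert l x))"
proof -
  have inj: "inj_on (insert l) (Pow S)"
    using assms(2) by (auto simp: inj_on_def)
  have "(\<Sum>x\<in>Pow (insert l S). \<phi> x) = (\<Sum>x\<in>Pow S. \<phi> x) + (\<Sum>x\<in>insert l ` Pow S. \<phi> x)"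
    unfolding Pow_insert using assms by (intro sum.union_disjoint) auto
  then show ?thesis
    by (simp add: sum.reindex[OF inj] o_def)
qed

lemma subset_avg_insert:
  assumes "finite S" "l \<notin> S"
  shows "subset_avg (insert l S) \<phi> = (subset_avg S \<phi> + subset_avg S (\<lambda>x. \<phi> (insert l x))) / 2"
  using assms by (simp add: subset_avg_def sum_Pow_insert field_simps)

lemma subset_avg_remove:
  assumes "finite S" "l \<in> S"
  shows "subset_avg S \<phi> = (subset_avg (S - {l}) \<phi> + subset_avg (S - {l}) (\<lambda>x. \<phi> (insert l x))) / 2"
  using subset_avg_insert[of "S - {l}" l \<phi>] assms by (simp add: insert_absorb)

lemma subset_avg_nonneg: "(\<And>x. x \<subseteq> S \<Longrightarrow> 0 \<le> \<phi> x) \<Longrightarrow> 0 \<le> subset_avg S \<phi>"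
  unfolding subset_avg_def by (intro divide_nonneg_nonneg sum_nonneg) auto

lemma subset_avg_const [simp]: "finite S \<Longrightarrow> subset_avg S (\<lambda>_. c) = c"
  by (simp add: subset_avg_def card_Pow)

lemma subset_avg_mono: "(\<And>x. x \<subseteq> S \<Longrightarrow> \<phi> x \<le> \<psi> x) \<Longrightarrow> subset_avg S \<phi> \<le> subset_avg S \<psi>"
  unfolding subset_avg_def by (intro divide_right_mono sum_mono) auto

lemma subset_avg_le_1: "finite S \<Longrightarrow> (\<And>x. x \<subseteq> S \<Longrightarrow> \<phi> x \<le> 1) \<Longrightarrow> subset_avg S \<phi> \<le> 1"
  using subset_avg_mono[of S \<phi> "\<lambda>_. 1"] by simp

section \<open>Fourier weight of bounded functions on the cube\<close>

text \<open>The exponential moment of a fair sign. Hoeffding's logarithmic inequality at probability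
  \<open>1 / 2\<close> and width \<open>2 * a\<close> gives it for \<open>0 \<le> a\<close>; both
  sides are even in \<open>a\<close>.\<close>

lemma cosh_le_exp_half_square: "(exp a + exp (- a)) / 2 \<le> exp (a\<^sup>2 / 2)" for a :: real
proof -
  have *: "(exp a + exp (- a)) / 2 \<le> exp (a\<^sup>2 / 2)" if "0 \<le> a" for a :: real
  proof -
    have "- (2 * a) * (1 / 2) + ln (1 + 1 / 2 * (exp (2 * a) - 1)) \<le> (2 * a)\<^sup>2 / 8"
      using that by (intro Hoeffdings_lemma_aux) auto
    hence "ln ((1 + exp (2 * a)) / 2) \<le> a\<^sup>2 / 2 + a"
      by (simp add: field_simps power2_eq_square)
    hence "(1 + exp (2 * a)) / 2 \<le> exp (a\<^sup>2 / 2 + a)"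
      by (metis add_pos_pos exp_gt_zero exp_le_cancel_iff exp_ln half_gt_zero zero_less_one)
    hence "exp (- a) * ((1 + exp (2 * a)) / 2) \<le> exp (- a) * exp (a\<^sup>2 / 2 + a)"
      by simp
    moreover have "exp (- a) * exp (a\<^sup>2 / 2 + a) = exp (a\<^sup>2 / 2)" "exp (- a) * exp (2 * a) = exp a"
      by (simp_all flip: exp_add)
    ultimately show ?thesis
      by (simp add: field_simps)
  qed
  show ?thesis
    using *[of a] *[of "- a"] by (cases "0 \<le> a") (auto simp: add.commute)
qed

text \<open>The level-one inequality of Fourier analysis on the cube, by an exponential-moment argument:
  a density \<open>\<phi> / F\<close> bounded by \<open>1 / F\<close> can bias the linear form with coefficients \<open>\<alpha>\<close> only as
  far as its subgaussian tails allow.\<close>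

lemma level_one:
  fixes \<phi> :: "'a set \<Rightarrow> real"
  assumes fin: "finite S" and \<phi>: "\<And>x. x \<subseteq> S \<Longrightarrow> 0 \<le> \<phi> x" "\<And>x. x \<subseteq> S \<Longrightarrow> \<phi> x \<le> 1"
    and F: "F = subset_avg S \<phi>" "0 < F"
  shows "(\<Sum>l\<in>S. ((subset_avg (S - {l}) \<phi> - subset_avg (S - {l}) (\<lambda>x. \<phi> (insert l x))) / (2 * F))\<^sup>2)
    \<le> 2 * ln (1 / F)"
proof -
  define \<alpha> where "\<alpha> l = (subset_avg (S - {l}) \<phi> - subset_avg (S - {l}) (\<lambda>x. \<phi> (insert l x))) / (2 * F)" for l
  define w where "w l x = (if l \<in> x then - 1 else 1 :: real)" for l and x :: "'a set"
  define L where "L x = (\<Sum>l\<in>S. \<alpha> l * w l x)" for x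
  define T where "T = (\<Sum>l\<in>S. (\<alpha> l)\<^sup>2)"
  have avg_chi: "subset_avg S (\<lambda>x. \<phi> x * w l x) = F * \<alpha> l" if "l \<in> S" for l
  proof -
    have "subset_avg (S - {l}) (\<lambda>x. \<phi> x * w l x) = subset_avg (S - {l}) \<phi>"
      unfolding subset_avg_def by (intro arg_cong2[where f = "(/)"] sum.cong) (auto simp: w_def)
    moreover have "subset_avg (S - {l}) (\<lambda>x. \<phi> (insert l x) * w l (insert l x))
        = - subset_avg (S - {l}) (\<lambda>x. \<phi> (insert l x))"
      by (simp add: subset_avg_def w_def sum_negf)
    ultimately show ?thesis
      using F by (subst subset_avg_remove[OF fin that]) (simp add: \<alpha>_def)
  qed
  have "subset_avg S (\<lambda>x. \<phi> x * L x) = (\<Sum>l\<in>S. \<alpha> l * subset_avg S (\<lambda>x. \<phi> x * w l x))"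
    unfolding subset_avg_def L_def sum_distrib_left sum_divide_distrib
    by (subst sum.swap) (simp add: mult_ac)
  also have "\<dots> = F * T"
    by (simp add: avg_chi T_def sum_distrib_left power2_eq_square mult_ac)
  finally have avgL: "subset_avg S (\<lambda>x. \<phi> x * L x) = F * T" .
  \<comment> \<open>\<open>T\<close> is the mean of \<open>L\<close> under the density
    \<open>\<phi> / F\<close>, and \<open>exp T * (1 + L x - T)\<close> is the tangent of
    \<open>exp\<close> at \<open>T\<close>, evaluated at \<open>L x\<close>. Averaging it against
    \<open>\<phi>\<close> is Jensen's inequality for that density.\<close>
  have "exp T * F = subset_avg S (\<lambda>x. \<phi> x * (exp T * (1 + L x - T)))"
  proof -
    have "subset_avg S (\<lambda>x. \<phi> x * (exp T * (1 + L x - T)))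
        = exp T * ((1 - T) * subset_avg S \<phi> + subset_avg S (\<lambda>x. \<phi> x * L x))"
      by (simp add: subset_avg_def sum_distrib_left sum.distrib sum_subtractf algebra_simps
          sum_divide_distrib add_divide_distrib diff_divide_distrib)
    then show ?thesis
      using F avgL by (simp add: algebra_simps)
  qed
  also have "\<dots> \<le> subset_avg S (\<lambda>x. exp (L x))"
  proof (rule subset_avg_mono)
    fix x assume x: "x \<subseteq> S"
    have "exp T * (1 + L x - T) \<le> exp T * exp (L x - T)"
      using exp_ge_add_one_self[of "L x - T"] by (intro mult_left_mono) (simp_all only: add_diff_eq exp_ge_zero)
    also have "\<dots> = exp (L x)"
      by (simp flip: exp_add)
    finally have "\<phi> x * (exp T * (1 + L x - T)) \<le> \<phi> x * exp (L x)"
      using \<phi>(1)[OF x] by (rule mult_left_mono)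
    also have "\<dots> \<le> exp (L x)"
      using \<phi>[OF x] by (simp add: mult_left_le_one_le)
    finally show "\<phi> x * (exp T * (1 + L x - T)) \<le> exp (L x)" .
  qed
  \<comment> \<open>The signs \<open>w l\<close> of a uniform subset are independent, so the
    exponential moment factors over the coordinates.\<close>
  also have "subset_avg S (\<lambda>x. exp (L x)) = (\<Prod>l\<in>S. (exp (\<alpha> l) + exp (- \<alpha> l)) / 2)"
  proof -
    have "(\<Prod>l\<in>S. exp (- \<alpha> l) + exp (\<alpha> l)) = (\<Sum>x\<in>Pow S. exp (L x))"
      unfolding prod_add[OF fin]
    proof (rule sum.cong[OF refl])
      fix x assume x: "x \<in> Pow S"
      have "exp (L x) = (\<Prod>l\<in>S. exp (\<alpha> l * w l x))"
        by (simp add: L_def exp_sum fin)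
      also have "\<dots> = (\<Prod>l\<in>S - x. exp (\<alpha> l * w l x)) * (\<Prod>l\<in>x. exp (\<alpha> l * w l x))"
        using x fin by (intro prod.subset_diff) auto
      also have "\<dots> = (\<Prod>l\<in>S - x. exp (\<alpha> l)) * (\<Prod>l\<in>x. exp (- \<alpha> l))"
        by (intro arg_cong2[where f = "(*)"] prod.cong) (auto simp: w_def)
      finally show "(\<Prod>l\<in>x. exp (- \<alpha> l)) * (\<Prod>l\<in>S - x. exp (\<alpha> l)) = exp (L x)"
        by (simp add: mult.commute)
    qed
    then show ?thesis
      by (simp add: subset_avg_def prod_dividef add.commute)
  qed
  also have "\<dots> \<le> (\<Prod>l\<in>S. exp ((\<alpha> l)\<^sup>2 / 2))"
    by (intro prod_mono conjI cosh_le_exp_half_square) (auto intro: add_nonneg_nonneg)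
  also have "\<dots> = exp (T / 2)"
    by (simp add: T_def exp_sum fin sum_divide_distrib)
  finally have "exp T * F \<le> exp (T / 2)" .
  hence "exp (- (T / 2)) * (exp T * F) \<le> exp (- (T / 2)) * exp (T / 2)"
    by simp
  hence "exp (T / 2) * F \<le> 1"
    by (simp add: mult.assoc[symmetric] flip: exp_add)
  hence "exp (T / 2) \<le> 1 / F"
    using F by (simp add: field_simps)
  hence "T / 2 \<le> ln (1 / F)"
    using F(2) by (subst ln_ge_iff) auto
  then show ?thesis
    by (simp add: T_def \<alpha>_def)
qed

section \<open>Entropy of channel histories\<close>

lemma finite_event: "finite (UNIV :: event set)" and card_event: "CARD(event) = 4"
proof -
  have *: "(UNIV :: event set) = {To_Site True, To_Site False, From_Site True, From_Site False}"
    by (auto, metis (full_types) event.exhaust)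
  show "finite (UNIV :: event set)" "CARD(event) = 4"
    by (simp_all add: *)
qed

text \<open>Histories are not assumed to form a prefix code, so all lists count. There are
  \<open>4 ^ n\<close> lists of length \<open>n\<close>; the base \<open>8\<close> instead of
  \<open>4\<close> leaves a convergent geometric series over the lengths.\<close>

lemma kraft_event_lists:
  fixes T :: "event list set"
  assumes "finite T"
  shows "(\<Sum>t\<in>T. (1 / 8) ^ Suc (length t)) \<le> (1 :: real)"
proof -
  obtain n where n: "\<And>t. t \<in> T \<Longrightarrow> length t < n"
    using assms by (meson finite_imageI finite_nat_set_iff_bounded imageI)
  have "(\<Sum>t\<in>T. (1 / 8) ^ Suc (length t)) = (\<Sum>L\<in>{..<n}. \<Sum>t\<in>{t \<in> T. length t = L}. (1 / 8 :: real) ^ Suc (length t))"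
    using n assms by (intro sum.group[symmetric]) auto
  also have "\<dots> \<le> (\<Sum>L<n. (1 / 2) ^ Suc L)"
  proof (rule sum_mono)
    fix L
    have fin: "finite {t :: event list. set t \<subseteq> UNIV \<and> length t = L}"
      by (rule finite_lists_length_eq[OF finite_event])
    have "card {t \<in> T. length t = L} \<le> card {t :: event list. set t \<subseteq> UNIV \<and> length t = L}"
      by (intro card_mono[OF fin]) auto
    also have "\<dots> = 4 ^ L"
      by (simp only: card_lists_length_eq[OF finite_event] card_event)
    finally have "real (card {t \<in> T. length t = L}) \<le> 4 ^ L"
      by (metis of_nat_le_iff of_nat_numeral of_nat_power)
    also have "\<dots> \<le> 4 ^ Suc L"
      by simp
    finally have "real (card {t \<in> T. length t = L}) * (1 / 8) ^ Suc L \<le> 4 ^ Suc L * (1 / 8) ^ Suc L"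
      by (intro mult_right_mono) auto
    also have "\<dots> = (1 / 2) ^ Suc L"
      by (simp flip: power_mult_distrib)
    finally show "(\<Sum>t\<in>{t \<in> T. length t = L}. (1 / 8 :: real) ^ Suc (length t)) \<le> (1 / 2) ^ Suc L"
      by simp
  qed
  also have "(\<Sum>L<n. (1 / 2 :: real) ^ Suc L) = 1 - (1 / 2) ^ n"
    by (induction n) auto
  finally show ?thesis
    by (smt (verit) zero_le_power divide_nonneg_nonneg)
qed

text \<open>Gibbs' inequality against the weights of \<open>kraft_event_lists\<close>. The factor
  \<open>21 / 10\<close> bounds \<open>ln 8\<close>, the price of one event; the added 1 comes from
  \<open>Suc (length t)\<close> in those weights.\<close>

lemma entropy_event_lists:
  fixes p :: "event list \<Rightarrow> real"
  assumes fin: "finite T" and p: "\<And>t. t \<in> T \<Longrightarrow> 0 \<le> p t" "(\<Sum>t\<in>T. p t) = 1"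
  shows "(\<Sum>t\<in>T. p t * ln (1 / p t)) \<le> 21 / 10 * ((\<Sum>t\<in>T. p t * real (length t)) + 1)"
proof -
  define q :: "event list \<Rightarrow> real" where "q t = (1 / 8) ^ Suc (length t)" for t
  have ln8: "ln 8 \<le> (21 / 10 :: real)"
  proof -
    have "ln 8 = 3 * ln (2 :: real)"
      using ln_realpow[of 2 3] by simp
    then show ?thesis
      using ln2_le_25_over_36 by simp
  qed
  have "p t * ln (1 / p t) \<le> 21 / 10 * (p t * real (length t) + p t) + (q t - p t)" if "t \<in> T" for t
  proof (cases "p t = 0")
    case True
    then show ?thesis by (simp add: q_def)
  next
    case False
    hence pos: "0 < p t" "0 < q t"
      using p(1)[OF that] by (auto simp: q_def)
    have "ln (q t / p t) \<le> q t / p t - 1"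
      using pos by (intro ln_le_minus_one) auto
    hence "p t * ln (q t / p t) \<le> p t * (q t / p t - 1)"
      using pos by (intro mult_left_mono) auto
    also have "\<dots> = q t - p t"
      using pos by (simp add: field_simps)
    finally have "p t * ln (q t / p t) \<le> q t - p t" .
    moreover have "p t * ln (1 / p t) = p t * (ln (q t / p t) + real (Suc (length t)) * ln 8)"
    proof -
      have "ln (q t) = - (real (Suc (length t)) * ln 8)"
        unfolding q_def by (subst ln_realpow) (auto simp: ln_div)
      then show ?thesis
        using pos by (simp add: ln_div)
    qed
    moreover have "p t * (real (Suc (length t)) * ln 8) \<le> p t * (real (Suc (length t)) * (21 / 10))"
      using pos ln8 by (intro mult_left_mono) auto
    moreover have "p t * (real (Suc (length t)) * (21 / 10)) = 21 / 10 * (p t * real (length t) + p t)"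
      by (simp add: algebra_simps)
    ultimately show ?thesis
      unfolding distrib_left by linarith
  qed
  hence "(\<Sum>t\<in>T. p t * ln (1 / p t))
      \<le> (\<Sum>t\<in>T. 21 / 10 * (p t * real (length t) + p t) + (q t - p t))"
    by (rule sum_mono)
  also have "\<dots> = 21 / 10 * ((\<Sum>t\<in>T. p t * real (length t)) + 1) + ((\<Sum>t\<in>T. q t) - 1)"
    by (simp only: sum.distrib sum_subtractf sum_distrib_left[symmetric] p)
  finally show ?thesis
    using kraft_event_lists[OF fin] unfolding q_def by linarith
qed

section \<open>Hellinger distance and cut-and-paste\<close>

text \<open>Compares a Hellinger summand with one of triangular discrimination, which is quadratic
  in the difference \<open>a - b\<close> and therefore fits the squared biases of
  \<open>level_one\<close>.\<close>

lemma square_diff_sqrt_le: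
  assumes "0 \<le> a" "0 \<le> b"
  shows "(sqrt a - sqrt b)\<^sup>2 \<le> (a - b)\<^sup>2 / (a + b)"
proof (cases "a + b = 0")
  case False
  hence pos: "0 < a + b" using assms by auto
  have "a - b = (sqrt a - sqrt b) * (sqrt a + sqrt b)"
    using assms by (simp add: algebra_simps)
  hence "(a - b)\<^sup>2 = (sqrt a - sqrt b)\<^sup>2 * (sqrt a + sqrt b)\<^sup>2"
    by (simp add: power_mult_distrib)
  moreover have "a + b \<le> (sqrt a + sqrt b)\<^sup>2"
    using assms by (simp add: power2_sum)
  ultimately have "(sqrt a - sqrt b)\<^sup>2 * (a + b) \<le> (a - b)\<^sup>2"
    by (simp add: mult_left_mono)
  then show ?thesis
    using pos by (simp add: field_simps)
qed (use assms in \<open>auto simp: add_nonneg_eq_0_iff\<close>)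

text \<open>The cut-and-paste property of two-party protocols: the Hellinger distance is the same for the
  input pairs \<open>(0, 0), (1, 1)\<close> as for \<open>(0, 1), (1, 0)\<close>.\<close>

lemma cut_and_paste:
  fixes F0 F1 G0 G1 :: "'a \<Rightarrow> real"
  assumes nonneg: "\<And>t. t \<in> T \<Longrightarrow> 0 \<le> F0 t" "\<And>t. t \<in> T \<Longrightarrow> 0 \<le> F1 t"
      "\<And>t. t \<in> T \<Longrightarrow> 0 \<le> G0 t" "\<And>t. t \<in> T \<Longrightarrow> 0 \<le> G1 t"
    and mass: "(\<Sum>t\<in>T. F0 t * G0 t) = 1" "(\<Sum>t\<in>T. F0 t * G1 t) = 1"
      "(\<Sum>t\<in>T. F1 t * G0 t) = 1" "(\<Sum>t\<in>T. F1 t * G1 t) = 1"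
    and \<theta>: "0 < \<theta>"
  shows "(\<Sum>t\<in>T. G1 t * \<bar>F0 t - F1 t\<bar>) \<le> \<theta> +
    (6 * (\<Sum>t\<in>T. F0 t * ((G0 t - G1 t)\<^sup>2 / (G0 t + G1 t))) +
     4 * (\<Sum>t\<in>T. G0 t * ((F0 t - F1 t)\<^sup>2 / (F0 t + F1 t)))) / \<theta>"
proof -
  define h where "h P Q = (\<Sum>t\<in>T. (sqrt (P t) - sqrt (Q t))\<^sup>2)" for P Q :: "'a \<Rightarrow> real"
  let ?P00 = "\<lambda>t. F0 t * G0 t" and ?P01 = "\<lambda>t. F0 t * G1 t"
    and ?P10 = "\<lambda>t. F1 t * G0 t" and ?P11 = "\<lambda>t. F1 t * G1 t"
  have triangle: "h P R \<le> 2 * h P Q + 2 * h Q R" for P Q R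
  proof -
    have *: "(x - z)\<^sup>2 \<le> 2 * (x - y)\<^sup>2 + 2 * (y - z)\<^sup>2" for x y z :: real
      using zero_le_power2[of "(x - y) - (y - z)"] by (simp add: power2_eq_square algebra_simps)
    show ?thesis
      unfolding h_def sum_distrib_left sum.distrib[symmetric] by (intro sum_mono *)
  qed
  have sym: "h P Q = h Q P" for P Q
    by (simp add: h_def power2_commute)
  have expand: "h P Q = (\<Sum>t\<in>T. P t) + (\<Sum>t\<in>T. Q t) - 2 * (\<Sum>t\<in>T. sqrt (P t * Q t))"
    if "\<And>t. t \<in> T \<Longrightarrow> 0 \<le> P t" "\<And>t. t \<in> T \<Longrightarrow> 0 \<le> Q t" for P Q
    unfolding h_def sum_distrib_left sum.distrib[symmetric] sum_subtractf[symmetric]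
    using that by (intro sum.cong) (auto simp: power2_diff real_sqrt_mult)
  \<comment> \<open>Each likelihood is a product of one factor per party, so
    \<open>?P00 * ?P11\<close> and \<open>?P01 * ?P10\<close> agree pointwise. As all four masses
    are 1, the expanded distance depends on this product only.\<close>
  have "h ?P00 ?P11 = h ?P01 ?P10"
    using nonneg by (simp add: expand mass mult_ac)
  also have "\<dots> \<le> 2 * h ?P01 ?P00 + 2 * h ?P00 ?P10"
    by (rule triangle)
  \<comment> \<open>\<open>6 = 2 + 2 * 2\<close>: the distance between \<open>?P00\<close> and
    \<open>?P01\<close> is paid once directly and once inside the bound on
    \<open>h ?P00 ?P11\<close>.\<close>
  finally have "h ?P01 ?P11 \<le> 6 * h ?P00 ?P01 + 4 * h ?P00 ?P10"
    using triangle[of ?P01 ?P11 ?P00] sym[of ?P00 ?P01] by simp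
  also have "h ?P00 ?P01 = (\<Sum>t\<in>T. F0 t * (sqrt (G0 t) - sqrt (G1 t))\<^sup>2)"
    unfolding h_def using nonneg
    by (intro sum.cong) (auto simp: real_sqrt_mult power_mult_distrib simp flip: right_diff_distrib)
  also have "h ?P00 ?P10 = (\<Sum>t\<in>T. G0 t * (sqrt (F0 t) - sqrt (F1 t))\<^sup>2)"
    unfolding h_def using nonneg
    by (intro sum.cong) (auto simp: real_sqrt_mult power_mult_distrib mult.commute simp flip: left_diff_distrib)
  finally have h: "h ?P01 ?P11 \<le> 6 * (\<Sum>t\<in>T. F0 t * ((G0 t - G1 t)\<^sup>2 / (G0 t + G1 t))) +
     4 * (\<Sum>t\<in>T. G0 t * ((F0 t - F1 t)\<^sup>2 / (F0 t + F1 t)))"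
    by (rule order_trans) (intro add_mono mult_left_mono sum_mono square_diff_sqrt_le nonneg; simp)
  have "(\<Sum>t\<in>T. G1 t * \<bar>F0 t - F1 t\<bar>)
      \<le> (\<Sum>t\<in>T. (sqrt (?P01 t) - sqrt (?P11 t))\<^sup>2 / \<theta> + \<theta> / 2 * (?P01 t + ?P11 t))"
  proof (rule sum_mono)
    fix t assume t: "t \<in> T"
    define a b where "a = sqrt (?P01 t)" and "b = sqrt (?P11 t)"
    have ab: "0 \<le> a" "0 \<le> b" "a\<^sup>2 = ?P01 t" "b\<^sup>2 = ?P11 t"
      using nonneg[OF t] by (auto simp: a_def b_def)
    have "G1 t * \<bar>F0 t - F1 t\<bar> = \<bar>a\<^sup>2 - b\<^sup>2\<bar>"
      using nonneg(4)[OF t] by (simp add: ab abs_mult flip: left_diff_distrib)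
    also have "\<dots> = \<bar>a - b\<bar> * (a + b)"
    proof -
      have "a\<^sup>2 - b\<^sup>2 = (a - b) * (a + b)"
        by (simp add: power2_eq_square algebra_simps)
      then show ?thesis
        using ab(1,2) by (simp add: abs_mult)
    qed
    \<comment> \<open>Weighted AM-GM; \<open>\<theta>\<close> trades the additive loss against the
      factor on the Hellinger distance.\<close>
    also have "\<dots> \<le> \<bar>a - b\<bar>\<^sup>2 / \<theta> + \<theta> / 4 * (a + b)\<^sup>2"
    proof -
      have "0 \<le> (\<bar>a - b\<bar> - \<theta> / 2 * (a + b))\<^sup>2 / \<theta>"
        using \<theta> by simp
      also have "\<dots> = \<bar>a - b\<bar>\<^sup>2 / \<theta> + \<theta> / 4 * (a + b)\<^sup>2 - \<bar>a - b\<bar> * (a + b)"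
        using \<theta> by (simp add: power2_diff power_mult_distrib field_simps power2_eq_square)
      finally show ?thesis by simp
    qed
    also have "(a + b)\<^sup>2 \<le> 2 * (a\<^sup>2 + b\<^sup>2)"
      using zero_le_power2[of "a - b"] by (simp add: power2_eq_square algebra_simps)
    finally show "G1 t * \<bar>F0 t - F1 t\<bar>
        \<le> (sqrt (?P01 t) - sqrt (?P11 t))\<^sup>2 / \<theta> + \<theta> / 2 * (?P01 t + ?P11 t)"
      using \<theta> by (simp add: ab distrib_left add_divide_distrib flip: a_def b_def)
  qed
  also have "\<dots> = h ?P01 ?P11 / \<theta> + \<theta>"
    by (simp add: h_def sum.distrib mass flip: sum_divide_distrib sum_distrib_left)
  also have "\<dots> \<le> \<theta> + (6 * (\<Sum>t\<in>T. F0 t * ((G0 t - G1 t)\<^sup>2 / (G0 t + G1 t))) +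
     4 * (\<Sum>t\<in>T. G0 t * ((F0 t - F1 t)\<^sup>2 / (F0 t + F1 t)))) / \<theta>"
    using h \<theta> by (simp add: divide_right_mono)
  finally show ?thesis .
qed

section \<open>Information revealed per coordinate\<close>

text \<open>The likelihood of \<open>t\<close> is \<open>p t = w t * F\<close>, with
  \<open>F\<close> the average of \<open>\<phi> t\<close>. By \<open>level_one\<close> the
  coordinate biases of one history contribute at most \<open>2 * p t * (2 * ln (1 / F))\<close>.
  Since \<open>w t \<le> 1\<close> gives \<open>p t \<le> F\<close>, this is at most four times an
  entropy summand, and \<open>42 / 5 = 4 * (21 / 10)\<close>.\<close>

lemma sum_information_le:
  fixes \<phi> :: "event list \<Rightarrow> 'a set \<Rightarrow> real"
  assumes fin: "finite T" "finite S"
    and \<phi>: "\<And>t x. t \<in> T \<Longrightarrow> x \<subseteq> S \<Longrightarrow> 0 \<le> \<phi> t x" "\<And>t x. t \<in> T \<Longrightarrow> x \<subseteq> S \<Longrightarrow> \<phi> t x \<le> 1"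
    and w: "\<And>t. t \<in> T \<Longrightarrow> 0 \<le> w t" "\<And>t. t \<in> T \<Longrightarrow> w t \<le> 1"
    and mass: "(\<Sum>t\<in>T. w t * subset_avg S (\<phi> t)) = 1"
  shows "(\<Sum>l\<in>S. \<Sum>t\<in>T. w t *
      ((subset_avg (S - {l}) (\<phi> t) - subset_avg (S - {l}) (\<lambda>x. \<phi> t (insert l x)))\<^sup>2 /
       (subset_avg (S - {l}) (\<phi> t) + subset_avg (S - {l}) (\<lambda>x. \<phi> t (insert l x)))))
    \<le> 42 / 5 * ((\<Sum>t\<in>T. w t * subset_avg S (\<phi> t) * real (length t)) + 1)"
proof -
  define p where "p t = w t * subset_avg S (\<phi> t)" for t
  have p_nonneg: "0 \<le> p t" if "t \<in> T" for t
    unfolding p_def using that w \<phi> by (intro mult_nonneg_nonneg subset_avg_nonneg) auto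
  have "(\<Sum>l\<in>S. w t *
      ((subset_avg (S - {l}) (\<phi> t) - subset_avg (S - {l}) (\<lambda>x. \<phi> t (insert l x)))\<^sup>2 /
       (subset_avg (S - {l}) (\<phi> t) + subset_avg (S - {l}) (\<lambda>x. \<phi> t (insert l x)))))
      \<le> 4 * (p t * ln (1 / p t))" (is "?L \<le> _") if t: "t \<in> T" for t
  proof -
    define F where "F = subset_avg S (\<phi> t)"
    define d where "d l = subset_avg (S - {l}) (\<phi> t) - subset_avg (S - {l}) (\<lambda>x. \<phi> t (insert l x))" for l
    have F: "0 \<le> F" "F \<le> 1"
      unfolding F_def using \<phi> t fin by (auto intro: subset_avg_nonneg subset_avg_le_1)
    have "subset_avg (S - {l}) (\<phi> t) + subset_avg (S - {l}) (\<lambda>x. \<phi> t (insert l x)) = 2 * F"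
      if "l \<in> S" for l
      using subset_avg_remove[OF fin(2) that, of "\<phi> t"] by (simp add: F_def)
    hence L: "?L = (\<Sum>l\<in>S. w t * ((d l)\<^sup>2 / (2 * F)))"
      by (intro sum.cong) (auto simp: d_def)
    show ?thesis
    proof (cases "p t = 0")
      case True
      hence "w t * ((d l)\<^sup>2 / (2 * F)) = 0" for l
        by (auto simp: p_def F_def)
      hence "?L = 0"
        unfolding L by (intro sum.neutral) blast
      then show ?thesis
        using True by simp
    next
      case False
      hence pos: "0 < F" "0 < w t" "0 < p t"
        using F w(1)[OF t] p_nonneg[OF t] by (auto simp: p_def F_def less_le)
      have "w t * ((d l)\<^sup>2 / (2 * F)) = 2 * p t * (d l / (2 * F))\<^sup>2" for l
        using pos by (simp add: p_def F_def[symmetric] field_simps power2_eq_square)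
      hence "?L = 2 * p t * (\<Sum>l\<in>S. (d l / (2 * F))\<^sup>2)"
        unfolding L sum_distrib_left by (intro sum.cong) auto
      also have "\<dots> \<le> 2 * p t * (2 * ln (1 / F))"
        unfolding d_def using pos fin \<phi> t
        by (intro mult_left_mono level_one) (auto simp: F_def)
      also have "\<dots> \<le> 2 * p t * (2 * ln (1 / p t))"
      proof -
        have "p t \<le> F"
          using pos w(2)[OF t] by (simp add: p_def F_def[symmetric] mult_left_le_one_le)
        then show ?thesis
          using pos by (simp add: ln_div)
      qed
      finally show ?thesis by simp
    qed
  qed
  hence "(\<Sum>t\<in>T. \<Sum>l\<in>S. w t *
      ((subset_avg (S - {l}) (\<phi> t) - subset_avg (S - {l}) (\<lambda>x. \<phi> t (insert l x)))\<^sup>2 /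
       (subset_avg (S - {l}) (\<phi> t) + subset_avg (S - {l}) (\<lambda>x. \<phi> t (insert l x)))))
      \<le> (\<Sum>t\<in>T. 4 * (p t * ln (1 / p t)))"
    by (rule sum_mono)
  also have "\<dots> = 4 * (\<Sum>t\<in>T. p t * ln (1 / p t))"
    by (simp add: sum_distrib_left)
  also have "\<dots> \<le> 4 * (21 / 10 * ((\<Sum>t\<in>T. p t * real (length t)) + 1))"
    using entropy_event_lists[OF fin(1), of p] p_nonneg mass by (simp add: p_def)
  finally show ?thesis
    by (subst sum.swap) (simp add: p_def)
qed

lemma subset_avg_bilinear_mass:
  assumes "finite R" "finite S"
    and "\<And>x y. x \<subseteq> R \<Longrightarrow> y \<subseteq> S \<Longrightarrow> (\<Sum>t\<in>T. \<phi> t x * \<psi> t y) = 1"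
  shows "(\<Sum>t\<in>T. subset_avg R (\<phi> t) * subset_avg S (\<psi> t)) = 1"
proof -
  have "(\<Sum>t\<in>T. subset_avg R (\<phi> t) * subset_avg S (\<psi> t))
      = (\<Sum>t\<in>T. \<Sum>x\<in>Pow R. \<Sum>y\<in>Pow S. \<phi> t x * \<psi> t y / (2 ^ card R * 2 ^ card S))"
    by (simp add: subset_avg_def sum_product sum_divide_distrib)
  also have "\<dots> = (\<Sum>x\<in>Pow R. \<Sum>y\<in>Pow S. (\<Sum>t\<in>T. \<phi> t x * \<psi> t y) / (2 ^ card R * 2 ^ card S))"
    unfolding sum_divide_distrib
    by (subst sum.swap) (rule sum.cong[OF refl], subst sum.swap, rule refl)
  also have "\<dots> = (\<Sum>x\<in>Pow R. \<Sum>y\<in>Pow S. 1 / (2 ^ card R * 2 ^ card S))"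
    using assms(3) by (intro sum.cong) auto
  also have "\<dots> = 1"
    using assms by (simp add: card_Pow)
  finally show ?thesis .
qed

lemma sum_Pow_remove_swap:
  fixes h :: "'a \<Rightarrow> 'a set \<Rightarrow> real"
  assumes "finite U"
  shows "(\<Sum>l\<in>U. \<Sum>\<sigma>\<in>Pow (U - {l}). h l \<sigma>) = (\<Sum>\<sigma>\<in>Pow U. \<Sum>l\<in>U - \<sigma>. h l \<sigma>)"
proof -
  have "(\<Sum>\<sigma>\<in>Pow U. \<Sum>l\<in>U - \<sigma>. h l \<sigma>) = (\<Sum>(\<sigma>, l)\<in>(SIGMA \<sigma>:Pow U. U - \<sigma>). h l \<sigma>)"
    using assms by (intro sum.Sigma) (auto intro: finite_subset)
  also have "\<dots> = (\<Sum>(l, \<sigma>)\<in>(SIGMA l:U. Pow (U - {l})). h l \<sigma>)"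
    by (rule sum.reindex_bij_witness[of _ prod.swap prod.swap]) auto
  also have "\<dots> = (\<Sum>l\<in>U. \<Sum>\<sigma>\<in>Pow (U - {l}). h l \<sigma>)"
    using assms by (intro sum.Sigma[symmetric]) auto
  finally show ?thesis ..
qed

lemma sum_Pow_insert_swap:
  fixes h :: "'a \<Rightarrow> 'a set \<Rightarrow> real"
  assumes "finite U"
  shows "(\<Sum>l\<in>U. \<Sum>\<sigma>\<in>Pow (U - {l}). h l (insert l \<sigma>)) = (\<Sum>\<sigma>\<in>Pow U. \<Sum>l\<in>\<sigma>. h l \<sigma>)"
proof -
  have "(\<Sum>\<sigma>\<in>Pow U. \<Sum>l\<in>\<sigma>. h l \<sigma>) = (\<Sum>(\<sigma>, l)\<in>(SIGMA \<sigma>:Pow U. \<sigma>). h l \<sigma>)"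
    using assms by (intro sum.Sigma) (auto intro: finite_subset)
  also have "\<dots> = (\<Sum>(l, \<sigma>)\<in>(SIGMA l:U. Pow (U - {l})). h l (insert l \<sigma>))"
    by (rule sum.reindex_bij_witness[of _ "\<lambda>(l, \<sigma>). (insert l \<sigma>, l)" "\<lambda>(\<sigma>, l). (l, \<sigma> - {l})"])
      (auto simp: insert_absorb)
  also have "\<dots> = (\<Sum>l\<in>U. \<Sum>\<sigma>\<in>Pow (U - {l}). h l (insert l \<sigma>))"
    using assms by (intro sum.Sigma[symmetric]) auto
  finally show ?thesis ..
qed

text \<open>For a coordinate \<open>l\<close> and \<open>\<sigma> \<subseteq> U - {l}\<close>,
  adding \<open>l\<close> or not to \<open>x\<close> and to \<open>y\<close> gives the four corners
  of \<open>cut_and_paste\<close>. The corner with \<open>l\<close> on both sides has no weight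
  among disjoint pairs; it is controlled by the other three. Of the two information terms,
  \<open>a\<close> belongs to the split \<open>\<sigma>\<close>, where \<open>l\<close> may go to
  \<open>y\<close>, and \<open>b\<close> to the split \<open>insert l \<sigma>\<close>, where it may
  go to \<open>x\<close>. Regrouped by split, each is a full sum over the coordinates of one
  party.\<close>

lemma two_party_information:
  fixes f g :: "event list \<Rightarrow> 'a set \<Rightarrow> real"
  assumes fin: "finite T" "finite U"
    and f: "\<And>t x. t \<in> T \<Longrightarrow> x \<subseteq> U \<Longrightarrow> 0 \<le> f t x" "\<And>t x. t \<in> T \<Longrightarrow> x \<subseteq> U \<Longrightarrow> f t x \<le> 1"
    and g: "\<And>t y. t \<in> T \<Longrightarrow> y \<subseteq> U \<Longrightarrow> 0 \<le> g t y" "\<And>t y. t \<in> T \<Longrightarrow> y \<subseteq> U \<Longrightarrow> g t y \<le> 1"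
    and mass: "\<And>x y. x \<subseteq> U \<Longrightarrow> y \<subseteq> U \<Longrightarrow> (\<Sum>t\<in>T. f t x * g t y) = 1"
  shows "(\<Sum>l\<in>U. \<Sum>\<sigma>\<in>Pow (U - {l}). \<Sum>t\<in>T. subset_avg (U - \<sigma> - {l}) (\<lambda>y. g t (insert l y)) *
      \<bar>subset_avg \<sigma> (f t) - subset_avg \<sigma> (\<lambda>x. f t (insert l x))\<bar>)
    \<le> 2 ^ card U * real (card U) / 8 + 672 * (\<Sum>\<sigma>\<in>Pow U.
        (\<Sum>t\<in>T. subset_avg \<sigma> (f t) * subset_avg (U - \<sigma>) (g t) * real (length t)) + 1)"
proof -
  define F0 where "F0 \<sigma> t = subset_avg \<sigma> (f t)" for \<sigma> t
  define F1 where "F1 \<sigma> l t = subset_avg \<sigma> (\<lambda>x. f t (insert l x))" for \<sigma> l t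
  define G0 where "G0 \<sigma> t = subset_avg \<sigma> (g t)" for \<sigma> t
  define G1 where "G1 \<sigma> l t = subset_avg \<sigma> (\<lambda>y. g t (insert l y))" for \<sigma> l t
  define a where "a l \<sigma> = (\<Sum>t\<in>T. F0 \<sigma> t * ((G0 (U - \<sigma> - {l}) t - G1 (U - \<sigma> - {l}) l t)\<^sup>2 /
      (G0 (U - \<sigma> - {l}) t + G1 (U - \<sigma> - {l}) l t)))" for l \<sigma>
  define b where "b l \<sigma> = (\<Sum>t\<in>T. G0 (U - \<sigma>) t * ((F0 (\<sigma> - {l}) t - F1 (\<sigma> - {l}) l t)\<^sup>2 /
      (F0 (\<sigma> - {l}) t + F1 (\<sigma> - {l}) l t)))" for l \<sigma>
  define E where "E \<sigma> = (\<Sum>t\<in>T. F0 \<sigma> t * G0 (U - \<sigma>) t * real (length t)) + 1" for \<sigma>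
  have finU: "finite S" if "S \<subseteq> U" for S
    using that fin(2) by (rule finite_subset)
  \<comment> \<open>With \<open>\<theta> = 1 / 8\<close> the additive loss ends up as
    \<open>card U / 16\<close>, a quarter of the expected size \<open>card U / 4\<close> of
    \<open>y\<close>.\<close>
  have "(\<Sum>t\<in>T. G1 (U - \<sigma> - {l}) l t * \<bar>F0 \<sigma> t - F1 \<sigma> l t\<bar>)
      \<le> 1 / 8 + (6 * a l \<sigma> + 4 * b l (insert l \<sigma>)) / (1 / 8)"
    if l: "l \<in> U" and \<sigma>: "\<sigma> \<subseteq> U - {l}" for l \<sigma>
  proof -
    have eq: "U - insert l \<sigma> = U - \<sigma> - {l}" "insert l \<sigma> - {l} = \<sigma>"
      using \<sigma> by auto
    have sub: "\<sigma> \<subseteq> U" "U - \<sigma> - {l} \<subseteq> U"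
      using \<sigma> by auto
    show ?thesis
      unfolding a_def b_def eq
    proof (rule cut_and_paste)
      show "0 \<le> F0 \<sigma> t" "0 \<le> F1 \<sigma> l t" "0 \<le> G0 (U - \<sigma> - {l}) t" "0 \<le> G1 (U - \<sigma> - {l}) l t" if "t \<in> T" for t
        unfolding F0_def F1_def G0_def G1_def using sub f g l that
        by (auto intro!: subset_avg_nonneg)
      show "(\<Sum>t\<in>T. F0 \<sigma> t * G0 (U - \<sigma> - {l}) t) = 1" "(\<Sum>t\<in>T. F0 \<sigma> t * G1 (U - \<sigma> - {l}) l t) = 1"
        "(\<Sum>t\<in>T. F1 \<sigma> l t * G0 (U - \<sigma> - {l}) t) = 1" "(\<Sum>t\<in>T. F1 \<sigma> l t * G1 (U - \<sigma> - {l}) l t) = 1"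
        unfolding F0_def F1_def G0_def G1_def using sub l
        by (auto intro!: subset_avg_bilinear_mass mass finU)
    qed simp
  qed
  hence "(\<Sum>l\<in>U. \<Sum>\<sigma>\<in>Pow (U - {l}). \<Sum>t\<in>T. G1 (U - \<sigma> - {l}) l t * \<bar>F0 \<sigma> t - F1 \<sigma> l t\<bar>)
      \<le> (\<Sum>l\<in>U. \<Sum>\<sigma>\<in>Pow (U - {l}). 1 / 8 + (6 * a l \<sigma> + 4 * b l (insert l \<sigma>)) / (1 / 8))"
    by (intro sum_mono) auto
  also have "\<dots> = (\<Sum>l\<in>U. \<Sum>\<sigma>\<in>Pow (U - {l}). 1 / 8) + 48 * (\<Sum>l\<in>U. \<Sum>\<sigma>\<in>Pow (U - {l}). a l \<sigma>)
      + 32 * (\<Sum>l\<in>U. \<Sum>\<sigma>\<in>Pow (U - {l}). b l (insert l \<sigma>))"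
    by (simp add: sum.distrib sum_distrib_left algebra_simps)
  also have "(\<Sum>l\<in>U. \<Sum>\<sigma>\<in>Pow (U - {l}). a l \<sigma>) = (\<Sum>\<sigma>\<in>Pow U. \<Sum>l\<in>U - \<sigma>. a l \<sigma>)"
    using fin(2) by (rule sum_Pow_remove_swap)
  also have "(\<Sum>l\<in>U. \<Sum>\<sigma>\<in>Pow (U - {l}). b l (insert l \<sigma>)) = (\<Sum>\<sigma>\<in>Pow U. \<Sum>l\<in>\<sigma>. b l \<sigma>)"
    using fin(2) by (rule sum_Pow_insert_swap)
  finally have "(\<Sum>l\<in>U. \<Sum>\<sigma>\<in>Pow (U - {l}). \<Sum>t\<in>T. G1 (U - \<sigma> - {l}) l t * \<bar>F0 \<sigma> t - F1 \<sigma> l t\<bar>)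
      \<le> (\<Sum>l\<in>U. \<Sum>\<sigma>\<in>Pow (U - {l}). 1 / 8) + 48 * (\<Sum>\<sigma>\<in>Pow U. \<Sum>l\<in>U - \<sigma>. a l \<sigma>)
        + 32 * (\<Sum>\<sigma>\<in>Pow U. \<Sum>l\<in>\<sigma>. b l \<sigma>)" .
  moreover have "(\<Sum>l\<in>U. \<Sum>\<sigma>\<in>Pow (U - {l}). 1 / 8) \<le> 2 ^ card U * real (card U) / 8"
  proof -
    have "(\<Sum>l\<in>U. \<Sum>\<sigma>\<in>Pow (U - {l}). 1 / 8) \<le> (\<Sum>l\<in>U. 2 ^ card U / 8 :: real)"
      using fin(2) by (intro sum_mono) (auto simp: card_Pow)
    then show ?thesis
      by (simp add: mult.commute)
  qed
  moreover have "(\<Sum>\<sigma>\<in>Pow U. \<Sum>l\<in>U - \<sigma>. a l \<sigma>) \<le> (\<Sum>\<sigma>\<in>Pow U. 42 / 5 * E \<sigma>)"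
  proof (rule sum_mono)
    fix \<sigma> assume "\<sigma> \<in> Pow U"
    hence sub: "\<sigma> \<subseteq> U" "U - \<sigma> \<subseteq> U" by auto
    show "(\<Sum>l\<in>U - \<sigma>. a l \<sigma>) \<le> 42 / 5 * E \<sigma>"
      unfolding a_def E_def F0_def G0_def G1_def
      by (intro sum_information_le subset_avg_bilinear_mass mass fin finU subset_avg_nonneg
          subset_avg_le_1 f g) (use sub in auto)
  qed
  moreover have "(\<Sum>\<sigma>\<in>Pow U. \<Sum>l\<in>\<sigma>. b l \<sigma>) \<le> (\<Sum>\<sigma>\<in>Pow U. 42 / 5 * E \<sigma>)"
  proof (rule sum_mono)
    fix \<sigma> assume "\<sigma> \<in> Pow U"
    hence sub: "\<sigma> \<subseteq> U" "U - \<sigma> \<subseteq> U" by auto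
    have E: "E \<sigma> = (\<Sum>t\<in>T. G0 (U - \<sigma>) t * F0 \<sigma> t * real (length t)) + 1"
      by (simp add: E_def mult_ac)
    have "(\<Sum>t\<in>T. G0 (U - \<sigma>) t * F0 \<sigma> t) = (\<Sum>t\<in>T. F0 \<sigma> t * G0 (U - \<sigma>) t)"
      by (simp add: mult_ac)
    also have "\<dots> = 1"
      unfolding F0_def G0_def
      by (intro subset_avg_bilinear_mass mass finU) (use sub in auto)
    finally show "(\<Sum>l\<in>\<sigma>. b l \<sigma>) \<le> 42 / 5 * E \<sigma>"
      unfolding b_def E F0_def G0_def F1_def
      by (intro sum_information_le fin finU subset_avg_nonneg
          subset_avg_le_1 f g) (use sub in auto)
  qed
  \<comment> \<open>\<open>672 = (48 + 32) * (42 / 5)\<close>.\<close>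
  ultimately have "(\<Sum>l\<in>U. \<Sum>\<sigma>\<in>Pow (U - {l}). \<Sum>t\<in>T. G1 (U - \<sigma> - {l}) l t * \<bar>F0 \<sigma> t - F1 \<sigma> l t\<bar>)
      \<le> 2 ^ card U * real (card U) / 8 + 672 * (\<Sum>\<sigma>\<in>Pow U. E \<sigma>)"
    unfolding sum_distrib_left[symmetric] by linarith
  then show ?thesis
    unfolding F0_def F1_def G0_def G1_def E_def .
qed

subsection \<open>Two-party disjointness\<close>

text \<open>
  The hard pairs \<open>(x, y)\<close> are disjoint. They arise from a uniform set \<open>\<sigma>\<close> by taking \<open>x\<close> uniform
  below \<open>\<sigma>\<close> and \<open>y\<close> uniform below \<open>U - \<sigma>\<close>, so that they are independent given \<open>\<sigma>\<close>.
  Below, \<open>pair_weight U x y\<close> is the probability of the pair, \<open>set_weight U y\<close> that of \<open>y\<close>, and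
  \<open>cond_weight U y x\<close> that of \<open>x\<close> given \<open>y\<close>.
\<close>

definition pair_weight :: "'a set \<Rightarrow> 'a set \<Rightarrow> 'a set \<Rightarrow> real" where
  "pair_weight U x y = real (card {\<sigma>. x \<subseteq> \<sigma> \<and> \<sigma> \<subseteq> U - y}) / 4 ^ card U"

definition set_weight :: "'a set \<Rightarrow> 'a set \<Rightarrow> real" where
  "set_weight U y = (\<Sum>x\<in>Pow (U - y). pair_weight U x y)"

definition cond_weight :: "'a set \<Rightarrow> 'a set \<Rightarrow> 'a set \<Rightarrow> real" where
  "cond_weight U y x = pair_weight U x y / set_weight U y"

text \<open>Given \<open>y\<close>, the set \<open>x\<close> is a mixture over
  \<open>\<sigma>\<close> of uniform subsets of \<open>\<sigma>\<close>. Counting the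
  \<open>\<sigma>\<close> above each \<open>x\<close> and exchanging the sums makes the mixture
  visible.\<close>

lemma sum_pair_weight:
  assumes "finite U"
  shows "(\<Sum>x\<in>Pow (U - y). pair_weight U x y * \<phi> x)
    = (\<Sum>\<sigma>\<in>Pow (U - y). 2 ^ card \<sigma> / 4 ^ card U * subset_avg \<sigma> \<phi>)"
proof -
  have fin: "finite (Pow (U - y))"
    using assms by simp
  have "pair_weight U x y * \<phi> x = (\<Sum>\<sigma>\<in>Pow (U - y). if x \<subseteq> \<sigma> then \<phi> x / 4 ^ card U else 0)" for x
  proof -
    have "{\<sigma>. x \<subseteq> \<sigma> \<and> \<sigma> \<subseteq> U - y} = {\<sigma> \<in> Pow (U - y). x \<subseteq> \<sigma>}"
      by auto
    then show ?thesis
      using fin by (simp add: pair_weight_def flip: sum.inter_filter)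
  qed
  hence "(\<Sum>x\<in>Pow (U - y). pair_weight U x y * \<phi> x)
      = (\<Sum>\<sigma>\<in>Pow (U - y). \<Sum>x\<in>Pow (U - y). if x \<subseteq> \<sigma> then \<phi> x / 4 ^ card U else 0)"
    by (simp only:) (rule sum.swap)
  also have "\<dots> = (\<Sum>\<sigma>\<in>Pow (U - y). \<Sum>x\<in>Pow \<sigma>. \<phi> x / 4 ^ card U)"
  proof (rule sum.cong[OF refl])
    fix \<sigma> assume "\<sigma> \<in> Pow (U - y)"
    hence "{x \<in> Pow (U - y). x \<subseteq> \<sigma>} = Pow \<sigma>"
      by auto
    then show "(\<Sum>x\<in>Pow (U - y). if x \<subseteq> \<sigma> then \<phi> x / 4 ^ card U else 0) = (\<Sum>x\<in>Pow \<sigma>. \<phi> x / 4 ^ card U)"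
      using fin by (simp flip: sum.inter_filter)
  qed
  also have "\<dots> = (\<Sum>\<sigma>\<in>Pow (U - y). 2 ^ card \<sigma> / 4 ^ card U * subset_avg \<sigma> \<phi>)"
    by (simp add: subset_avg_def flip: sum_divide_distrib)
  finally show ?thesis .
qed

lemma pair_weight_nonneg: "0 \<le> pair_weight U x y"
  by (simp add: pair_weight_def)

lemma set_weight_eq:
  assumes "finite U"
  shows "set_weight U y = (\<Sum>\<sigma>\<in>Pow (U - y). 2 ^ card \<sigma> / 4 ^ card U)"
proof -
  have "set_weight U y = (\<Sum>\<sigma>\<in>Pow (U - y). 2 ^ card \<sigma> / 4 ^ card U * subset_avg \<sigma> (\<lambda>_. 1))"
    using sum_pair_weight[OF assms, of y "\<lambda>_. 1"] by (simp add: set_weight_def)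
  also have "\<dots> = (\<Sum>\<sigma>\<in>Pow (U - y). 2 ^ card \<sigma> / 4 ^ card U)"
    using assms by (intro sum.cong) (auto dest: finite_subset)
  finally show ?thesis .
qed

lemma set_weight_pos: "finite U \<Longrightarrow> 0 < set_weight U y"
  unfolding set_weight_eq by (rule sum_pos) auto

lemma set_weight_cond_weight: "finite U \<Longrightarrow> set_weight U y * cond_weight U y x = pair_weight U x y"
  using set_weight_pos[of U y] by (simp add: cond_weight_def)

lemma cond_weight_nonneg: "finite U \<Longrightarrow> 0 \<le> cond_weight U y x"
  using set_weight_pos[of U y] by (simp add: cond_weight_def pair_weight_nonneg)

lemma sum_cond_weight: "finite U \<Longrightarrow> (\<Sum>x\<in>Pow (U - y). cond_weight U y x) = 1"
  using set_weight_pos[of U y] by (simp add: cond_weight_def set_weight_def flip: sum_divide_distrib)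

lemma sum_disjoint_swap:
  fixes h :: "'a set \<Rightarrow> 'a set \<Rightarrow> real"
  assumes "finite U"
  shows "(\<Sum>y\<in>Pow U. \<Sum>\<sigma>\<in>Pow (U - y). h y \<sigma>) = (\<Sum>\<sigma>\<in>Pow U. \<Sum>y\<in>Pow (U - \<sigma>). h y \<sigma>)"
proof -
  have "(\<Sum>y\<in>Pow U. \<Sum>\<sigma>\<in>Pow (U - y). h y \<sigma>) = (\<Sum>(y, \<sigma>)\<in>(SIGMA y:Pow U. Pow (U - y)). h y \<sigma>)"
    using assms by (intro sum.Sigma) auto
  also have "\<dots> = (\<Sum>(\<sigma>, y)\<in>(SIGMA \<sigma>:Pow U. Pow (U - \<sigma>)). h y \<sigma>)"
    by (rule sum.reindex_bij_witness[of _ prod.swap prod.swap]) auto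
  also have "\<dots> = (\<Sum>\<sigma>\<in>Pow U. \<Sum>y\<in>Pow (U - \<sigma>). h y \<sigma>)"
    using assms by (intro sum.Sigma[symmetric]) auto
  finally show ?thesis .
qed

text \<open>Brings the marked element and \<open>\<sigma>\<close> outside, so that the rest of
  \<open>y\<close> ranges freely below \<open>U - \<sigma> - {l}\<close>. This is the order of
  summation in \<open>two_party_information\<close>.\<close>

lemma sum_marked_disjoint_swap:
  fixes h :: "'a \<Rightarrow> 'a set \<Rightarrow> 'a set \<Rightarrow> real"
  assumes "finite U"
  shows "(\<Sum>y\<in>Pow U. \<Sum>l\<in>y. \<Sum>\<sigma>\<in>Pow (U - y). h l y \<sigma>)
    = (\<Sum>l\<in>U. \<Sum>\<sigma>\<in>Pow (U - {l}). \<Sum>y\<in>Pow (U - \<sigma> - {l}). h l (insert l y) \<sigma>)"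
proof -
  have "(\<Sum>y\<in>Pow U. \<Sum>l\<in>y. \<Sum>\<sigma>\<in>Pow (U - y). h l y \<sigma>)
      = (\<Sum>l\<in>U. \<Sum>y\<in>Pow (U - {l}). \<Sum>\<sigma>\<in>Pow (U - insert l y). h l (insert l y) \<sigma>)"
    using sum_Pow_insert_swap[OF assms, of "\<lambda>l y. \<Sum>\<sigma>\<in>Pow (U - y). h l y \<sigma>"] by simp
  also have "\<dots> = (\<Sum>l\<in>U. \<Sum>y\<in>Pow (U - {l}). \<Sum>\<sigma>\<in>Pow (U - {l} - y). h l (insert l y) \<sigma>)"
    by (subst Diff_insert2) (rule refl)
  also have "\<dots> = (\<Sum>l\<in>U. \<Sum>\<sigma>\<in>Pow (U - {l}). \<Sum>y\<in>Pow (U - {l} - \<sigma>). h l (insert l y) \<sigma>)"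
    using assms by (intro sum.cong refl sum_disjoint_swap) auto
  also have "\<dots> = (\<Sum>l\<in>U. \<Sum>\<sigma>\<in>Pow (U - {l}). \<Sum>y\<in>Pow (U - \<sigma> - {l}). h l (insert l y) \<sigma>)"
    by (intro sum.cong refl arg_cong[where f = Pow]) auto
  finally show ?thesis .
qed

lemma power_card_split:
  assumes "finite U" "\<sigma> \<subseteq> U"
  shows "2 ^ card \<sigma> * 2 ^ card (U - \<sigma>) = (2 ^ card U :: real)"
  using assms by (simp add: card_Diff_subset finite_subset card_mono flip: power_add)

lemma sum_set_weight:
  assumes "finite U"
  shows "(\<Sum>y\<in>Pow U. set_weight U y) = 1"
proof -
  have "(\<Sum>y\<in>Pow U. set_weight U y) = (\<Sum>\<sigma>\<in>Pow U. \<Sum>y\<in>Pow (U - \<sigma>). 2 ^ card \<sigma> / 4 ^ card U)"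
    unfolding set_weight_eq[OF assms] by (rule sum_disjoint_swap[OF assms])
  also have "\<dots> = (\<Sum>\<sigma>\<in>Pow U. 2 ^ card U / 4 ^ card U)"
    using assms power_card_split[OF assms] by (intro sum.cong) (auto simp: card_Pow mult.commute)
  also have "\<dots> = 1"
    using assms by (simp add: card_Pow power_mult_distrib[symmetric])
  finally show ?thesis .
qed

text \<open>An element is in \<open>y\<close> when it falls outside \<open>\<sigma>\<close> and is
  then picked: two fair coins, hence \<open>1 / 4\<close>.\<close>

lemma sum_set_weight_card:
  assumes "finite U"
  shows "(\<Sum>y\<in>Pow U. set_weight U y * real (card y)) = real (card U) / 4"
proof -
  have "(\<Sum>y\<in>Pow U. set_weight U y * real (card y))
      = (\<Sum>y\<in>Pow U. \<Sum>l\<in>y. \<Sum>\<sigma>\<in>Pow (U - y). 2 ^ card \<sigma> / 4 ^ card U)"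
    by (simp add: set_weight_eq[OF assms] mult.commute)
  also have "\<dots> = (\<Sum>l\<in>U. \<Sum>\<sigma>\<in>Pow (U - {l}). \<Sum>y\<in>Pow (U - \<sigma> - {l}). 2 ^ card \<sigma> / 4 ^ card U)"
    by (rule sum_marked_disjoint_swap[OF assms])
  also have "\<dots> = (\<Sum>l\<in>U. 1 / 4)"
  proof (intro sum.cong refl)
    fix l assume l: "l \<in> U"
    have "(\<Sum>\<sigma>\<in>Pow (U - {l}). \<Sum>y\<in>Pow (U - \<sigma> - {l}). 2 ^ card \<sigma> / 4 ^ card U :: real)
        = (\<Sum>\<sigma>\<in>Pow (U - {l}). 2 ^ card (U - {l}) / 4 ^ card U)"
    proof (intro sum.cong refl)
      fix \<sigma> assume "\<sigma> \<in> Pow (U - {l})"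
      moreover have "U - \<sigma> - {l} = U - {l} - \<sigma>"
        by auto
      ultimately show "(\<Sum>y\<in>Pow (U - \<sigma> - {l}). 2 ^ card \<sigma> / 4 ^ card U) = (2 ^ card (U - {l}) / 4 ^ card U :: real)"
        using assms power_card_split[of "U - {l}" \<sigma>] by (auto simp: card_Pow mult.commute)
    qed
    also have "\<dots> = 2 ^ card (U - {l}) * 2 ^ card (U - {l}) / 4 ^ card U"
      using assms by (simp add: card_Pow)
    also have "\<dots> = 1 / 4"
    proof -
      have "card U = Suc (card (U - {l}))"
        using l assms by (metis card_Suc_Diff1)
      then show ?thesis
        by (simp add: power_mult_distrib[symmetric])
    qed
    finally show "(\<Sum>\<sigma>\<in>Pow (U - {l}). \<Sum>y\<in>Pow (U - \<sigma> - {l}). 2 ^ card \<sigma> / 4 ^ card U) = (1 / 4 :: real)" .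
  qed
  finally show ?thesis by simp
qed

text \<open>Given \<open>y\<close>, \<open>x\<close> is a mixture over \<open>\<sigma>\<close>, and
  the positive part of a mixed difference is at most the mixture of the absolute differences. After
  exchanging sums this is \<open>two_party_information\<close> at half its weight per
  \<open>\<sigma>\<close>, because an \<open>l\<close> outside \<open>\<sigma>\<close> joins
  \<open>y\<close> with probability \<open>1 / 2\<close>; this turns 672 into 336.\<close>

lemma two_party_disjointness:
  fixes f g :: "event list \<Rightarrow> 'a set \<Rightarrow> real"
  assumes fin: "finite T" "finite U"
    and f: "\<And>t x. t \<in> T \<Longrightarrow> x \<subseteq> U \<Longrightarrow> 0 \<le> f t x" "\<And>t x. t \<in> T \<Longrightarrow> x \<subseteq> U \<Longrightarrow> f t x \<le> 1"
    and g: "\<And>t y. t \<in> T \<Longrightarrow> y \<subseteq> U \<Longrightarrow> 0 \<le> g t y" "\<And>t y. t \<in> T \<Longrightarrow> y \<subseteq> U \<Longrightarrow> g t y \<le> 1"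
    and mass: "\<And>x y. x \<subseteq> U \<Longrightarrow> y \<subseteq> U \<Longrightarrow> (\<Sum>t\<in>T. f t x * g t y) = 1"
  shows "(\<Sum>y\<in>Pow U. set_weight U y * (\<Sum>l\<in>y. \<Sum>t\<in>T. g t y *
      max 0 (\<Sum>x\<in>Pow (U - y). cond_weight U y x * (f t x - f t (insert l x)))))
    \<le> real (card U) / 16 + 336 * ((\<Sum>y\<in>Pow U. set_weight U y *
        (\<Sum>t\<in>T. g t y * (\<Sum>x\<in>Pow (U - y). cond_weight U y x * f t x) * real (length t))) + 1)"
    (is "?L \<le> _ + 336 * (?E + 1)")
proof -
  define c :: real where "c = 1 / 4 ^ card U"
  have avg_diff: "subset_avg \<sigma> (\<lambda>x. f t x - f t (insert l x))
      = subset_avg \<sigma> (f t) - subset_avg \<sigma> (\<lambda>x. f t (insert l x))" for \<sigma> t l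
    by (simp add: subset_avg_def sum_subtractf diff_divide_distrib)
  have weighted: "set_weight U y * (\<Sum>x\<in>Pow (U - y). cond_weight U y x * \<phi> x)
      = (\<Sum>\<sigma>\<in>Pow (U - y). c * 2 ^ card \<sigma> * subset_avg \<sigma> \<phi>)" for y \<phi>
    using sum_pair_weight[OF fin(2), of y \<phi>]
    by (simp add: sum_distrib_left mult.assoc[symmetric] set_weight_cond_weight[OF fin(2)] c_def)
  have "?L = (\<Sum>y\<in>Pow U. \<Sum>l\<in>y. \<Sum>t\<in>T. g t y *
      max 0 (\<Sum>\<sigma>\<in>Pow (U - y). c * 2 ^ card \<sigma> * (subset_avg \<sigma> (f t) - subset_avg \<sigma> (\<lambda>x. f t (insert l x)))))"
    unfolding sum_distrib_left
  proof (intro sum.cong refl)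
    fix y l t
    have "set_weight U y * (g t y * max 0 (\<Sum>x\<in>Pow (U - y). cond_weight U y x * (f t x - f t (insert l x))))
       = g t y * max 0 (set_weight U y * (\<Sum>x\<in>Pow (U - y). cond_weight U y x * (f t x - f t (insert l x))))"
    proof -
      have "w * max 0 s = max 0 (w * s)" if "0 < w" for w s :: real
        using that by (simp add: max_mult_distrib_left)
      from this[OF set_weight_pos[OF fin(2)]] show ?thesis
        by (simp only: mult.left_commute[of "set_weight U y"])
    qed
    then show "set_weight U y * (g t y * max 0 (\<Sum>x\<in>Pow (U - y). cond_weight U y x * (f t x - f t (insert l x))))
       = g t y * max 0 (\<Sum>\<sigma>\<in>Pow (U - y). c * 2 ^ card \<sigma> * (subset_avg \<sigma> (f t) - subset_avg \<sigma> (\<lambda>x. f t (insert l x))))"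
      unfolding weighted avg_diff .
  qed
  also have "\<dots> \<le> (\<Sum>y\<in>Pow U. \<Sum>l\<in>y. \<Sum>t\<in>T. g t y *
      (\<Sum>\<sigma>\<in>Pow (U - y). c * 2 ^ card \<sigma> * \<bar>subset_avg \<sigma> (f t) - subset_avg \<sigma> (\<lambda>x. f t (insert l x))\<bar>))"
  proof (intro sum_mono mult_left_mono)
    fix y l t
    show "max 0 (\<Sum>\<sigma>\<in>Pow (U - y). c * 2 ^ card \<sigma> * (subset_avg \<sigma> (f t) - subset_avg \<sigma> (\<lambda>x. f t (insert l x))))
      \<le> (\<Sum>\<sigma>\<in>Pow (U - y). c * 2 ^ card \<sigma> * \<bar>subset_avg \<sigma> (f t) - subset_avg \<sigma> (\<lambda>x. f t (insert l x))\<bar>)"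
      by (intro max.boundedI sum_mono sum_nonneg mult_left_mono) (auto simp: c_def)
  qed (use g in auto)
  also have "\<dots> = (\<Sum>y\<in>Pow U. \<Sum>l\<in>y. \<Sum>\<sigma>\<in>Pow (U - y). \<Sum>t\<in>T. g t y *
      (c * 2 ^ card \<sigma> * \<bar>subset_avg \<sigma> (f t) - subset_avg \<sigma> (\<lambda>x. f t (insert l x))\<bar>))"
    unfolding sum_distrib_left by (rule sum.cong[OF refl], rule sum.cong[OF refl], rule sum.swap)
  also have "\<dots> = (\<Sum>l\<in>U. \<Sum>\<sigma>\<in>Pow (U - {l}). \<Sum>y\<in>Pow (U - \<sigma> - {l}). \<Sum>t\<in>T. g t (insert l y) *
      (c * 2 ^ card \<sigma> * \<bar>subset_avg \<sigma> (f t) - subset_avg \<sigma> (\<lambda>x. f t (insert l x))\<bar>))"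
    by (rule sum_marked_disjoint_swap[OF fin(2)])
  also have "\<dots> = (\<Sum>l\<in>U. \<Sum>\<sigma>\<in>Pow (U - {l}). c * 2 ^ card U / 2 * (\<Sum>t\<in>T.
      subset_avg (U - \<sigma> - {l}) (\<lambda>y. g t (insert l y)) *
      \<bar>subset_avg \<sigma> (f t) - subset_avg \<sigma> (\<lambda>x. f t (insert l x))\<bar>))"
  proof (intro sum.cong refl)
    fix l \<sigma> assume l: "l \<in> U" and \<sigma>: "\<sigma> \<in> Pow (U - {l})"
    have "insert l \<sigma> \<subseteq> U" and U': "U - insert l \<sigma> = U - \<sigma> - {l}" and "finite \<sigma>" "l \<notin> \<sigma>"
      using l \<sigma> fin by (auto dest: finite_subset)
    hence "2 * 2 ^ card \<sigma> * 2 ^ card (U - \<sigma> - {l}) = (2 ^ card U :: real)"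
      using power_card_split[OF fin(2), of "insert l \<sigma>"] by simp
    hence *: "2 ^ card \<sigma> * 2 ^ card (U - \<sigma> - {l}) = (2 ^ card U / 2 :: real)"
      by simp
    have "(\<Sum>y\<in>Pow (U - \<sigma> - {l}). \<Sum>t\<in>T. g t (insert l y) *
        (c * 2 ^ card \<sigma> * \<bar>subset_avg \<sigma> (f t) - subset_avg \<sigma> (\<lambda>x. f t (insert l x))\<bar>))
      = (\<Sum>t\<in>T. (\<Sum>y\<in>Pow (U - \<sigma> - {l}). g t (insert l y)) *
        (c * 2 ^ card \<sigma> * \<bar>subset_avg \<sigma> (f t) - subset_avg \<sigma> (\<lambda>x. f t (insert l x))\<bar>))"
      unfolding sum_distrib_right by (rule sum.swap)
    also have "\<dots> = (\<Sum>t\<in>T. c * (2 ^ card \<sigma> * 2 ^ card (U - \<sigma> - {l})) *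
        (subset_avg (U - \<sigma> - {l}) (\<lambda>y. g t (insert l y)) *
          \<bar>subset_avg \<sigma> (f t) - subset_avg \<sigma> (\<lambda>x. f t (insert l x))\<bar>))"
      by (simp add: subset_avg_def[of "U - \<sigma> - {l}"] mult_ac)
    finally show "(\<Sum>y\<in>Pow (U - \<sigma> - {l}). \<Sum>t\<in>T. g t (insert l y) *
        (c * 2 ^ card \<sigma> * \<bar>subset_avg \<sigma> (f t) - subset_avg \<sigma> (\<lambda>x. f t (insert l x))\<bar>))
      = c * 2 ^ card U / 2 * (\<Sum>t\<in>T. subset_avg (U - \<sigma> - {l}) (\<lambda>y. g t (insert l y)) *
          \<bar>subset_avg \<sigma> (f t) - subset_avg \<sigma> (\<lambda>x. f t (insert l x))\<bar>)"
      unfolding * by (simp add: sum_distrib_left)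
  qed
  also have "\<dots> = c * 2 ^ card U / 2 * (\<Sum>l\<in>U. \<Sum>\<sigma>\<in>Pow (U - {l}). \<Sum>t\<in>T.
      subset_avg (U - \<sigma> - {l}) (\<lambda>y. g t (insert l y)) *
      \<bar>subset_avg \<sigma> (f t) - subset_avg \<sigma> (\<lambda>x. f t (insert l x))\<bar>)"
    by (simp only: sum_distrib_left)
  also have "\<dots> \<le> c * 2 ^ card U / 2 * (2 ^ card U * real (card U) / 8 + 672 * (\<Sum>\<sigma>\<in>Pow U.
        (\<Sum>t\<in>T. subset_avg \<sigma> (f t) * subset_avg (U - \<sigma>) (g t) * real (length t)) + 1))"
    by (intro mult_left_mono two_party_information fin f g mass) (auto simp: c_def)
  \<comment> \<open>\<open>?E\<close> is the expected history length over the hard pairs; here it is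
    identified with the average over \<open>\<sigma>\<close> in which
    \<open>two_party_information\<close> measures length.\<close>
  also have "(\<Sum>\<sigma>\<in>Pow U. (\<Sum>t\<in>T. subset_avg \<sigma> (f t) * subset_avg (U - \<sigma>) (g t) * real (length t)) + 1)
      = 2 ^ card U * (?E + 1)"
  proof -
    have "?E = (\<Sum>y\<in>Pow U. \<Sum>t\<in>T. g t y * real (length t) *
        (set_weight U y * (\<Sum>x\<in>Pow (U - y). cond_weight U y x * f t x)))"
      unfolding sum_distrib_left[of "set_weight U _" _ T] by (simp only: mult_ac)
    also have "\<dots> = (\<Sum>y\<in>Pow U. \<Sum>\<sigma>\<in>Pow (U - y). \<Sum>t\<in>T. g t y * real (length t) *
        (c * 2 ^ card \<sigma> * subset_avg \<sigma> (f t)))"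
      unfolding weighted sum_distrib_left[of "g _ _ * real (length _)"] by (rule sum.cong[OF refl], rule sum.swap)
    also have "\<dots> = (\<Sum>\<sigma>\<in>Pow U. \<Sum>y\<in>Pow (U - \<sigma>). \<Sum>t\<in>T. g t y * real (length t) *
        (c * 2 ^ card \<sigma> * subset_avg \<sigma> (f t)))"
      by (rule sum_disjoint_swap[OF fin(2)])
    also have "\<dots> = (\<Sum>\<sigma>\<in>Pow U. \<Sum>t\<in>T. c * (2 ^ card \<sigma> * 2 ^ card (U - \<sigma>)) *
        (subset_avg \<sigma> (f t) * subset_avg (U - \<sigma>) (g t) * real (length t)))"
    proof (rule sum.cong[OF refl])
      fix \<sigma>
      have "(\<Sum>y\<in>Pow (U - \<sigma>). \<Sum>t\<in>T. g t y * real (length t) * (c * 2 ^ card \<sigma> * subset_avg \<sigma> (f t)))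
        = (\<Sum>t\<in>T. \<Sum>y\<in>Pow (U - \<sigma>). g t y * real (length t) * (c * 2 ^ card \<sigma> * subset_avg \<sigma> (f t)))"
        by (rule sum.swap)
      also have "\<dots> = (\<Sum>t\<in>T. (\<Sum>y\<in>Pow (U - \<sigma>). g t y) * real (length t) * (c * 2 ^ card \<sigma> * subset_avg \<sigma> (f t)))"
        unfolding sum_distrib_right ..
      also have "\<dots> = (\<Sum>t\<in>T. c * (2 ^ card \<sigma> * 2 ^ card (U - \<sigma>)) *
        (subset_avg \<sigma> (f t) * subset_avg (U - \<sigma>) (g t) * real (length t)))"
      proof (rule sum.cong[OF refl])
        fix t
        have *: "s * L * (c * P * F) = c * (P * Q) * (F * (s / Q) * L)" if "Q \<noteq> 0" for s L P Q F :: real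
          using that by (simp add: field_simps)
        show "(\<Sum>y\<in>Pow (U - \<sigma>). g t y) * real (length t) * (c * 2 ^ card \<sigma> * subset_avg \<sigma> (f t))
          = c * (2 ^ card \<sigma> * 2 ^ card (U - \<sigma>)) * (subset_avg \<sigma> (f t) * subset_avg (U - \<sigma>) (g t) * real (length t))"
          unfolding subset_avg_def[of "U - \<sigma>"] by (rule *) simp
      qed
      finally show "(\<Sum>y\<in>Pow (U - \<sigma>). \<Sum>t\<in>T. g t y * real (length t) * (c * 2 ^ card \<sigma> * subset_avg \<sigma> (f t)))
        = (\<Sum>t\<in>T. c * (2 ^ card \<sigma> * 2 ^ card (U - \<sigma>)) *
        (subset_avg \<sigma> (f t) * subset_avg (U - \<sigma>) (g t) * real (length t)))" .
    qed
    also have "\<dots> = (\<Sum>\<sigma>\<in>Pow U. \<Sum>t\<in>T. c * 2 ^ card U *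
        (subset_avg \<sigma> (f t) * subset_avg (U - \<sigma>) (g t) * real (length t)))"
      using power_card_split[OF fin(2)] by (intro sum.cong refl) auto
    also have "\<dots> = c * 2 ^ card U *
        (\<Sum>\<sigma>\<in>Pow U. \<Sum>t\<in>T. subset_avg \<sigma> (f t) * subset_avg (U - \<sigma>) (g t) * real (length t))"
      unfolding sum_distrib_left ..
    finally have E: "?E = c * 2 ^ card U *
        (\<Sum>\<sigma>\<in>Pow U. \<Sum>t\<in>T. subset_avg \<sigma> (f t) * subset_avg (U - \<sigma>) (g t) * real (length t))" .
    have "2 ^ card U * (c * 2 ^ card U * S + 1) = S + 2 ^ card U" for S
      by (simp add: c_def power_mult_distrib[symmetric] algebra_simps)
    then show ?thesis
      unfolding E using fin by (simp only: sum.distrib) (simp add: card_Pow)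
  qed
  also have "c * 2 ^ card U / 2 * (2 ^ card U * real (card U) / 8 + 672 * (2 ^ card U * (?E + 1)))
      = (c * 2 ^ card U * 2 ^ card U) * (real (card U) / 16 + 336 * (?E + 1))"
  proof -
    have "c * P / 2 * (P * k / 8 + 672 * (P * Q)) = (c * P * P) * (k / 16 + 336 * Q)" for P k Q
      by (simp add: algebra_simps)
    then show ?thesis .
  qed
  also have "c * 2 ^ card U * 2 ^ card U = 1"
    by (simp add: c_def power_mult_distrib[symmetric])
  finally show ?thesis by (simp only: mult_1)
qed

subsection \<open>The number of occupied groups\<close>

text \<open>The left side is \<open>1 - r + r * cis \<theta>\<close>, the characteristic function of
  a Bernoulli variable. It is written in terms of \<open>1 - r\<close>, the probability of an empty
  group, since this is the form that the expansion over groups produces.\<close>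

lemma norm_bernoulli_char_le:
  fixes r :: real
  assumes "0 \<le> r" "r \<le> 1"
  shows "norm (cis \<theta> + (1 - cis \<theta>) * complex_of_real (1 - r)) \<le> exp (- (1 - cos \<theta>) * (r * (1 - r)))"
proof (rule power2_le_imp_le)
  have "(norm (cis \<theta> + (1 - cis \<theta>) * complex_of_real (1 - r)))\<^sup>2
      = (1 - r + r * cos \<theta>)\<^sup>2 + (r * sin \<theta>)\<^sup>2"
    by (simp add: cmod_power2 algebra_simps)
  also have "\<dots> = 1 + (r\<^sup>2 * ((sin \<theta>)\<^sup>2 + (cos \<theta>)\<^sup>2) + r\<^sup>2 - 2 * r + 2 * r * (1 - r) * cos \<theta>)"
    by algebra
  also have "\<dots> = 1 + - 2 * (1 - cos \<theta>) * (r * (1 - r))"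
    unfolding sin_cos_squared_add by (simp add: power2_eq_square algebra_simps)
  also have "\<dots> \<le> exp (- 2 * (1 - cos \<theta>) * (r * (1 - r)))"
    by (rule exp_ge_add_one_self)
  also have "\<dots> = (exp (- (1 - cos \<theta>) * (r * (1 - r))))\<^sup>2"
    by (simp add: exp_double[symmetric] mult.assoc)
  finally show "(norm (cis \<theta> + (1 - cis \<theta>) * complex_of_real (1 - r)))\<^sup>2 \<le> (exp (- (1 - cos \<theta>) * (r * (1 - r))))\<^sup>2" .
qed simp

lemma cos_ge_one_minus_half_square: "1 - x\<^sup>2 / 2 \<le> cos x" for x :: real
proof -
  have "(sin (x / 2))\<^sup>2 \<le> (x / 2)\<^sup>2"
    using abs_sin_x_le_abs_x[of "x / 2"] by (simp only: abs_le_square_iff)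
  moreover have "cos x = 1 - 2 * (sin (x / 2))\<^sup>2"
    using cos_double_sin[of "x / 2"] by simp
  ultimately show ?thesis
    by (simp add: power_divide)
qed

lemma one_minus_cos_ge:
  fixes x :: real
  assumes "0 \<le> x" "x \<le> 1"
  shows "x\<^sup>2 / 4 \<le> 1 - cos x"
proof -
  have "\<bar>sin (x / 2) - (\<Sum>m<3. sin_coeff m * (x / 2) ^ m)\<bar> \<le> inverse (fact 3) * \<bar>x / 2\<bar> ^ 3"
    by (rule Maclaurin_sin_bound)
  hence "x / 2 - (x / 2) ^ 3 / 6 \<le> sin (x / 2)"
    using assms by (simp add: eval_nat_numeral sin_coeff_def field_simps abs_if split: if_splits)
  moreover have "(x / 2) ^ 3 \<le> x / 2 * (1 / 4)"
  proof -
    have "(x / 2) ^ 3 = x / 2 * (x / 2)\<^sup>2"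
      by (simp add: eval_nat_numeral)
    also have "\<dots> \<le> x / 2 * (1 / 4)"
      using assms power_mono[of "x / 2" "1 / 2" 2] by (intro mult_left_mono) (auto simp: power_divide)
    finally show ?thesis .
  qed
  ultimately have "23 / 48 * x \<le> sin (x / 2)"
    by simp
  hence "(23 / 48 * x)\<^sup>2 \<le> (sin (x / 2))\<^sup>2"
    using assms by (intro power_mono) auto
  moreover have "x\<^sup>2 / 8 \<le> (23 / 48 * x)\<^sup>2"
    by (simp add: power2_eq_square)
  ultimately show ?thesis
    using cos_double_sin[of "x / 2"] by simp
qed

text \<open>Given the groups \<open>J\<close>, the number of occupied groups is a sum of independent Bernoulli variables,
  so its characteristic function at \<open>1 / sqrt m\<close> is bounded away from 1 in terms of its variance;
  a variable concentrated on a short window has a characteristic function close to 1 there.\<close>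

lemma occupied_groups_anticoncentration:
  fixes q :: "'i \<Rightarrow> real" and J :: "'i \<Rightarrow> 'l" and m a W :: real
  assumes fin: "finite I" "finite Y" and q: "\<And>i. i \<in> I \<Longrightarrow> 0 \<le> q i" "\<And>i. i \<in> I \<Longrightarrow> q i \<le> 1"
    and m: "1 \<le> m" "real (card Y) \<le> m" and W: "0 \<le> W"
  defines "D \<equiv> \<lambda>Z. real (card {l\<in>Y. \<exists>i\<in>Z. J i = l})"
    and "r \<equiv> \<lambda>l. 1 - (\<Prod>i\<in>{i\<in>I. J i = l}. 1 - q i)"
  shows "(\<Sum>l\<in>Y. r l * (1 - r l)) / (16 * m) - W\<^sup>2 / (4 * m)
    \<le> (\<Sum>Z\<in>Pow I. (\<Prod>i\<in>Z. q i) * (\<Prod>i\<in>I - Z. 1 - q i) * of_bool (D Z < a \<or> a + W < D Z))"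
proof -
  define P where "P Z = (\<Prod>i\<in>Z. q i) * (\<Prod>i\<in>I - Z. 1 - q i)" for Z
  define V where "V = (\<Sum>l\<in>Y. r l * (1 - r l))"
  define e where "e = (\<Sum>Z\<in>Pow I. P Z * of_bool (D Z < a \<or> a + W < D Z))"
  define \<theta> where "\<theta> = 1 / sqrt m"
  define \<phi> where "\<phi> = (\<Sum>Z\<in>Pow I. complex_of_real (P Z) * cis (\<theta> * D Z))"
  have \<theta>: "0 < \<theta>" "\<theta> \<le> 1" "\<theta>\<^sup>2 = 1 / m"
    using m by (auto simp: \<theta>_def power_divide)
  have P_nonneg: "0 \<le> P Z" if "Z \<in> Pow I" for Z
    unfolding P_def using that q by (intro mult_nonneg_nonneg prod_nonneg) auto
  have sum_P: "(\<Sum>Z\<in>Pow I. P Z) = 1"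
    unfolding P_def prod_add[OF fin(1), symmetric] by simp
  have r: "0 \<le> r l" "r l \<le> 1" for l
    unfolding r_def using q by (auto intro!: prod_nonneg prod_le_1)
  \<comment> \<open>On the window the cosine is close to 1, elsewhere it is at least -1, so escaping
    costs at most \<open>2 * e\<close>. The rotation by \<open>a\<close> moves the left end of the
    window to angle 0.\<close>
  have "1 - \<theta>\<^sup>2 * W\<^sup>2 / 2 - 2 * e \<le> norm \<phi>"
  proof -
    have "1 - \<theta>\<^sup>2 * W\<^sup>2 / 2 - 2 * e
        = (\<Sum>Z\<in>Pow I. P Z * (1 - \<theta>\<^sup>2 * W\<^sup>2 / 2 - 2 * of_bool (D Z < a \<or> a + W < D Z)))"
      unfolding e_def right_diff_distrib sum_subtractf
      by (simp add: sum_P sum_distrib_left sum_distrib_right[symmetric] mult_ac)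
    also have "\<dots> \<le> (\<Sum>Z\<in>Pow I. P Z * cos (\<theta> * (D Z - a)))"
    proof (intro sum_mono mult_left_mono P_nonneg)
      fix Z
      show "1 - \<theta>\<^sup>2 * W\<^sup>2 / 2 - 2 * of_bool (D Z < a \<or> a + W < D Z) \<le> cos (\<theta> * (D Z - a))"
      proof (cases "D Z < a \<or> a + W < D Z")
        case True
        hence "of_bool (D Z < a \<or> a + W < D Z) = (1 :: real)" by simp
        moreover have "0 \<le> \<theta>\<^sup>2 * W\<^sup>2 / 2" by simp
        ultimately show ?thesis
          using cos_ge_minus_one[of "\<theta> * (D Z - a)"] by linarith
      next
        case False
        hence "(\<theta> * (D Z - a))\<^sup>2 \<le> \<theta>\<^sup>2 * W\<^sup>2"
          unfolding power_mult_distrib by (intro mult_left_mono power_mono) auto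
        then show ?thesis
          using False cos_ge_one_minus_half_square[of "\<theta> * (D Z - a)"] by simp
      qed
    qed
    also have "\<dots> = Re (cis (- (\<theta> * a)) * \<phi>)"
    proof -
      have "cis (- (\<theta> * a)) * \<phi> = (\<Sum>Z\<in>Pow I. complex_of_real (P Z) * cis (\<theta> * (D Z - a)))"
        unfolding \<phi>_def sum_distrib_left
        by (intro sum.cong refl) (simp add: mult.left_commute cis_mult right_diff_distrib)
      then show ?thesis by (simp add: Re_sum)
    qed
    also have "\<dots> \<le> norm (cis (- (\<theta> * a)) * \<phi>)"
      by (rule complex_Re_le_cmod)
    finally show ?thesis
      by (simp add: norm_mult)
  qed
  moreover have "norm \<phi> \<le> exp (- (1 - cos \<theta>) * V)"
  proof -
    define N :: "'l \<Rightarrow> 'i set \<Rightarrow> complex" where "N l Z = of_bool (\<forall>i\<in>Z. J i \<noteq> l)" for l Z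
    \<comment> \<open>\<open>N l Z\<close> indicates that group \<open>l\<close> is empty; a group
      contributes the factor 1 when empty and \<open>cis \<theta>\<close> when occupied.\<close>
    have cis_D: "cis (\<theta> * D Z) = (\<Prod>l\<in>Y. (1 - cis \<theta>) * N l Z + cis \<theta>)" for Z
    proof -
      have "(\<Prod>l\<in>Y. (1 - cis \<theta>) * N l Z + cis \<theta>) = (\<Prod>l\<in>Y. if \<exists>i\<in>Z. J i = l then cis \<theta> else 1)"
        by (intro prod.cong) (auto simp: N_def)
      also have "\<dots> = cis \<theta> ^ card {l\<in>Y. \<exists>i\<in>Z. J i = l}"
        using fin by (simp flip: prod.inter_filter)
      finally show ?thesis
        by (simp add: D_def Complex.DeMoivre mult.commute)
    qed
    have avg_N: "(\<Sum>Z\<in>Pow I. complex_of_real (P Z) * (\<Prod>l\<in>S. N l Z)) = (\<Prod>l\<in>S. complex_of_real (1 - r l))"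
      if S: "S \<subseteq> Y" for S
    proof -
      have finS: "finite S" using S fin(2) by (rule finite_subset)
      have "(\<Sum>Z\<in>Pow I. complex_of_real (P Z) * (\<Prod>l\<in>S. N l Z))
          = (\<Sum>Z\<in>Pow I. (\<Prod>i\<in>Z. of_real (q i) * of_bool (J i \<notin> S)) * (\<Prod>i\<in>I - Z. complex_of_real (1 - q i)))"
      proof (intro sum.cong refl)
        fix Z assume "Z \<in> Pow I"
        hence "finite Z" using fin(1) finite_subset by auto
        hence "(\<Prod>i\<in>Z. of_bool (J i \<notin> S)) = (of_bool (\<forall>i\<in>Z. J i \<notin> S) :: complex)"
          by (induction Z rule: finite_induct) auto
        moreover have "(\<Prod>l\<in>S. N l Z) = of_bool (\<forall>i\<in>Z. J i \<notin> S)"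
          unfolding N_def using finS by (induction S rule: finite_induct) auto
        ultimately show "complex_of_real (P Z) * (\<Prod>l\<in>S. N l Z)
            = (\<Prod>i\<in>Z. of_real (q i) * of_bool (J i \<notin> S)) * (\<Prod>i\<in>I - Z. complex_of_real (1 - q i))"
          by (simp add: P_def prod.distrib mult_ac)
      qed
      also have "\<dots> = (\<Prod>i\<in>I. of_real (q i) * of_bool (J i \<notin> S) + complex_of_real (1 - q i))"
        by (rule prod_add[OF fin(1), symmetric])
      also have "\<dots> = (\<Prod>i\<in>I. if J i \<in> S then complex_of_real (1 - q i) else 1)"
        by (intro prod.cong) auto
      also have "\<dots> = (\<Prod>i\<in>{i\<in>I. J i \<in> S}. complex_of_real (1 - q i))"
        using fin(1) by (simp flip: prod.inter_filter)
      also have "\<dots> = (\<Prod>l\<in>S. \<Prod>i\<in>{i\<in>{i\<in>I. J i \<in> S}. J i = l}. complex_of_real (1 - q i))"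
        using fin finS by (intro prod.group[symmetric]) auto
      also have "\<dots> = (\<Prod>l\<in>S. complex_of_real (1 - r l))"
      proof (intro prod.cong refl)
        fix l assume "l \<in> S"
        hence "{i\<in>{i\<in>I. J i \<in> S}. J i = l} = {i\<in>I. J i = l}"
          by auto
        then show "(\<Prod>i\<in>{i\<in>{i\<in>I. J i \<in> S}. J i = l}. complex_of_real (1 - q i)) = complex_of_real (1 - r l)"
          by (simp add: r_def)
      qed
      finally show ?thesis .
    qed
    \<comment> \<open>Expanding over sets \<open>S\<close> of groups required to be empty reduces
      the average to \<open>avg_N\<close>; folding the product back replaces each
      \<open>N l Z\<close> by \<open>1 - r l\<close>.\<close>
    have "\<phi> = (\<Sum>Z\<in>Pow I. \<Sum>S\<in>Pow Y. complex_of_real (P Z) *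
        ((\<Prod>l\<in>S. (1 - cis \<theta>) * N l Z) * (\<Prod>l\<in>Y - S. cis \<theta>)))"
      unfolding \<phi>_def cis_D prod_add[OF fin(2)] sum_distrib_left ..
    also have "\<dots> = (\<Sum>S\<in>Pow Y. \<Sum>Z\<in>Pow I. complex_of_real (P Z) *
        ((\<Prod>l\<in>S. (1 - cis \<theta>) * N l Z) * (\<Prod>l\<in>Y - S. cis \<theta>)))"
      by (rule sum.swap)
    also have "\<dots> = (\<Sum>S\<in>Pow Y. (\<Prod>l\<in>S. 1 - cis \<theta>) * (\<Sum>Z\<in>Pow I. complex_of_real (P Z) * (\<Prod>l\<in>S. N l Z))
        * (\<Prod>l\<in>Y - S. cis \<theta>))"
      unfolding prod.distrib sum_distrib_left sum_distrib_right by (simp only: mult_ac)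
    also have "\<dots> = (\<Sum>S\<in>Pow Y. (\<Prod>l\<in>S. (1 - cis \<theta>) * complex_of_real (1 - r l)) * (\<Prod>l\<in>Y - S. cis \<theta>))"
      unfolding prod.distrib by (intro sum.cong refl) (auto simp: avg_N)
    also have "\<dots> = (\<Prod>l\<in>Y. cis \<theta> + (1 - cis \<theta>) * complex_of_real (1 - r l))"
      by (simp only: prod_add[OF fin(2), symmetric] add.commute)
    finally have "norm \<phi> = (\<Prod>l\<in>Y. norm (cis \<theta> + (1 - cis \<theta>) * complex_of_real (1 - r l)))"
      by (simp add: prod_norm)
    also have "\<dots> \<le> (\<Prod>l\<in>Y. exp (- (1 - cos \<theta>) * (r l * (1 - r l))))"
      by (intro prod_mono conjI norm_bernoulli_char_le r norm_ge_zero)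
    also have "\<dots> = exp (- (1 - cos \<theta>) * V)"
      by (simp add: V_def exp_sum fin sum_distrib_left)
    finally show ?thesis .
  qed
  moreover have V: "0 \<le> V" "V \<le> m"
  proof -
    show "0 \<le> V"
      unfolding V_def using r by (intro sum_nonneg mult_nonneg_nonneg) auto
    have "V \<le> (\<Sum>l\<in>Y. 1)"
      unfolding V_def using r by (intro sum_mono mult_le_one) auto
    then show "V \<le> m" using m by simp
  qed
  moreover have "exp (- (1 - cos \<theta>) * V) \<le> 1 - V / (8 * m)"
  proof -
    \<comment> \<open>By the choice of \<open>\<theta>\<close>, \<open>1 - cos \<theta>\<close> is
      at least \<open>1 / (4 * m)\<close>. The bound \<open>V \<le> m\<close> keeps \<open>u\<close>
      in the range where \<open>exp (- u) \<le> 1 - u / 2\<close>.\<close>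
    define u where "u = V / (4 * m)"
    have u: "0 \<le> u" "u \<le> 1"
      using V m by (auto simp: u_def field_simps)
    have "u \<le> (1 - cos \<theta>) * V"
      using mult_right_mono[OF one_minus_cos_ge[of \<theta>] V(1)] \<theta> by (simp add: u_def)
    hence "exp (- (1 - cos \<theta>) * V) \<le> exp (- u)"
      by (simp add: algebra_simps)
    also have "\<dots> \<le> 1 / (1 + u)"
      using exp_ge_add_one_self[of u] u by (simp add: exp_minus inverse_eq_divide frac_le)
    also have "\<dots> \<le> 1 - u / 2"
    proof -
      have "u * u \<le> u" using u by (simp add: mult_left_le)
      then show ?thesis using u by (simp add: field_simps)
    qed
    finally show ?thesis by (simp add: u_def)
  qed
  ultimately have "V / (8 * m) - \<theta>\<^sup>2 * W\<^sup>2 / 2 \<le> 2 * e"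
    by linarith
  hence "V / (16 * m) - W\<^sup>2 / (4 * m) \<le> e"
    using \<theta> by simp
  then show ?thesis
    by (simp add: V_def e_def P_def)
qed

lemma prod_one_minus_ge:
  fixes q :: "'i \<Rightarrow> real"
  assumes "finite G" "\<And>i. i \<in> G \<Longrightarrow> 0 \<le> q i" "\<And>i. i \<in> G \<Longrightarrow> q i \<le> 1"
  shows "1 - (\<Sum>i\<in>G. q i) \<le> (\<Prod>i\<in>G. 1 - q i)"
  using assms
proof (induction G rule: finite_induct)
  case (insert i G)
  have P: "(\<Prod>i\<in>G. 1 - q i) \<le> 1"
    using insert.prems by (intro prod_le_1) auto
  have "q i * (\<Prod>i\<in>G. 1 - q i) \<le> q i"
    using insert.prems P by (simp add: mult_left_le)
  then show ?case
    using insert by (simp add: algebra_simps)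
qed simp

text \<open>The quadratics for \<open>u\<close> and \<open>- u\<close> multiply to
  \<open>1 + (u\<^sup>2)\<^sup>2 / 4\<close>, and the one for \<open>u\<close> is a lower bound of
  \<open>exp u\<close>.\<close>

lemma exp_minus_le_quadratic:
  fixes u :: real
  assumes "0 \<le> u"
  shows "exp (- u) \<le> 1 - u + u\<^sup>2 / 2"
proof -
  have e: "1 + u + u\<^sup>2 / 2 \<le> exp u"
    using assms by (rule exp_lower_Taylor_quadratic)
  have "0 \<le> (1 - u)\<^sup>2" by simp
  hence pos: "0 \<le> 1 - u + u\<^sup>2 / 2"
    by (simp add: power2_diff)
  have "1 \<le> 1 + (u\<^sup>2)\<^sup>2 / 4" by simp
  also have "\<dots> = (1 - u + u\<^sup>2 / 2) * (1 + u + u\<^sup>2 / 2)"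
    by (simp add: power2_eq_square algebra_simps)
  also have "\<dots> \<le> (1 - u + u\<^sup>2 / 2) * exp u"
    using e pos by (rule mult_left_mono)
  finally have "exp (- u) * 1 \<le> exp (- u) * ((1 - u + u\<^sup>2 / 2) * exp u)"
    by (intro mult_left_mono) auto
  also have "\<dots> = 1 - u + u\<^sup>2 / 2"
    by (simp add: exp_minus)
  finally show ?thesis by simp
qed

text \<open>To first order the variance of a group is the sum of its probabilities; truncating at
  \<open>\<beta>\<close> keeps the quadratic corrections under control. With \<open>u\<close> the
  truncated and \<open>s\<close> the full sum, \<open>u - u\<^sup>2 / 2 \<le> r l \<le> s\<close>.
  The corrections are charged to the members of the group and subtracted for all of
  \<open>I\<close>, also outside \<open>Y\<close>, which leaves terms with simple averages over
  assignments.\<close>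

lemma occupied_groups_variance_ge:
  fixes q :: "'i \<Rightarrow> real" and J :: "'i \<Rightarrow> 'l"
  assumes fin: "finite I" "finite Y" and q: "\<And>i. i \<in> I \<Longrightarrow> 0 \<le> q i" "\<And>i. i \<in> I \<Longrightarrow> q i \<le> 1"
    and \<beta>: "0 \<le> \<beta>"
  defines "n \<equiv> \<lambda>i. real (card {i'\<in>I. J i' = J i})"
    and "r \<equiv> \<lambda>l. 1 - (\<Prod>i\<in>{i\<in>I. J i = l}. 1 - q i)"
  shows "(\<Sum>i\<in>I. of_bool (J i \<in> Y) * min (q i) \<beta> - \<beta> * n i * q i - \<beta>\<^sup>2 / 2 * n i)
    \<le> (\<Sum>l\<in>Y. r l * (1 - r l))"
proof -
  have "(\<Sum>i\<in>{i\<in>I. J i = l}. min (q i) \<beta> - \<beta> * n i * q i - \<beta>\<^sup>2 / 2 * n i) \<le> r l * (1 - r l)" for l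
  proof -
    define G where "G = {i\<in>I. J i = l}"
    define N where "N = real (card G)"
    define u where "u = (\<Sum>i\<in>G. min (q i) \<beta>)"
    define s where "s = (\<Sum>i\<in>G. q i)"
    have G: "finite G" "\<And>i. i \<in> G \<Longrightarrow> 0 \<le> q i" "\<And>i. i \<in> G \<Longrightarrow> q i \<le> 1" "\<And>i. i \<in> G \<Longrightarrow> n i = N"
      using fin q by (auto simp: G_def n_def N_def)
    have rl: "r l = 1 - (\<Prod>i\<in>G. 1 - q i)"
      by (simp add: r_def G_def)
    have P: "0 \<le> 1 - r l" "0 \<le> r l"
      unfolding rl using G by (auto intro!: prod_nonneg prod_le_1)
    have u: "0 \<le> u" "u \<le> N * \<beta>"
      unfolding u_def N_def using G \<beta> by (auto intro!: sum_nonneg sum_bounded_above)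
    have "r l \<le> s"
      using prod_one_minus_ge[of G q] G by (simp add: rl s_def)
    moreover have "u - u\<^sup>2 / 2 \<le> r l"
    proof -
      have "(\<Prod>i\<in>G. 1 - q i) \<le> (\<Prod>i\<in>G. exp (- min (q i) \<beta>))"
      proof (intro prod_mono conjI)
        fix i assume i: "i \<in> G"
        show "0 \<le> 1 - q i" using G i by simp
        have "1 - q i \<le> 1 + - min (q i) \<beta>" by simp
        also have "\<dots> \<le> exp (- min (q i) \<beta>)" by (rule exp_ge_add_one_self)
        finally show "1 - q i \<le> exp (- min (q i) \<beta>)" .
      qed
      also have "\<dots> = exp (- u)"
        using G by (simp add: u_def exp_sum flip: sum_negf)
      also have "\<dots> \<le> 1 - u + u\<^sup>2 / 2"
        using u by (intro exp_minus_le_quadratic)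
      finally show ?thesis by (simp add: rl)
    qed
    ultimately have r: "u - u\<^sup>2 / 2 \<le> r l" "r l \<le> s" by auto
    have "u\<^sup>2 \<le> (N * \<beta>)\<^sup>2"
      using u by (intro power_mono) auto
    moreover have "r l * u \<le> s * (N * \<beta>)"
      using r u P by (intro mult_mono) auto
    moreover have "0 \<le> r l * u\<^sup>2" using P by simp
    moreover have "(1 - r l) * (u - u\<^sup>2 / 2) \<le> (1 - r l) * r l"
      using r P by (intro mult_left_mono) auto
    moreover have "(1 - r l) * (u - u\<^sup>2 / 2) = u - u\<^sup>2 / 2 - r l * u + r l * u\<^sup>2 / 2"
        "(1 - r l) * r l = r l * (1 - r l)"
      by (simp_all add: algebra_simps diff_divide_distrib)
    ultimately have "u - s * (N * \<beta>) - (N * \<beta>)\<^sup>2 / 2 \<le> r l * (1 - r l)"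
      by linarith
    moreover have "(\<Sum>i\<in>G. min (q i) \<beta> - \<beta> * n i * q i - \<beta>\<^sup>2 / 2 * n i) = u - s * (N * \<beta>) - (N * \<beta>)\<^sup>2 / 2"
    proof -
      have "(\<Sum>i\<in>G. min (q i) \<beta> - \<beta> * n i * q i - \<beta>\<^sup>2 / 2 * n i)
          = (\<Sum>i\<in>G. min (q i) \<beta> - \<beta> * N * q i - \<beta>\<^sup>2 / 2 * N)"
        using G by (intro sum.cong) auto
      also have "\<dots> = u - \<beta> * N * s - real (card G) * (\<beta>\<^sup>2 / 2 * N)"
        by (simp add: sum_subtractf u_def s_def flip: sum_distrib_left)
      finally show ?thesis
        by (simp add: N_def power2_eq_square mult_ac)
    qed
    ultimately show ?thesis
      by (simp add: G_def)
  qed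
  hence "(\<Sum>l\<in>Y. \<Sum>i\<in>{i\<in>I. J i = l}. min (q i) \<beta> - \<beta> * n i * q i - \<beta>\<^sup>2 / 2 * n i)
      \<le> (\<Sum>l\<in>Y. r l * (1 - r l))"
    by (rule sum_mono)
  moreover have "(\<Sum>l\<in>Y. \<Sum>i\<in>{i\<in>I. J i = l}. min (q i) \<beta> - \<beta> * n i * q i - \<beta>\<^sup>2 / 2 * n i)
      = (\<Sum>i\<in>{i\<in>I. J i \<in> Y}. min (q i) \<beta> - \<beta> * n i * q i - \<beta>\<^sup>2 / 2 * n i)"
  proof -
    have "(\<Sum>l\<in>Y. \<Sum>i\<in>{i\<in>{i\<in>I. J i \<in> Y}. J i = l}. min (q i) \<beta> - \<beta> * n i * q i - \<beta>\<^sup>2 / 2 * n i)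
      = (\<Sum>i\<in>{i\<in>I. J i \<in> Y}. min (q i) \<beta> - \<beta> * n i * q i - \<beta>\<^sup>2 / 2 * n i)"
      using fin by (intro sum.group) auto
    moreover have "{i\<in>{i\<in>I. J i \<in> Y}. J i = l} = {i\<in>I. J i = l}" if "l \<in> Y" for l
      using that by auto
    ultimately show ?thesis
      by (metis (no_types, lifting) sum.cong)
  qed
  moreover have "(\<Sum>i\<in>{i\<in>I. J i \<in> Y}. min (q i) \<beta> - \<beta> * n i * q i - \<beta>\<^sup>2 / 2 * n i)
      \<ge> (\<Sum>i\<in>I. of_bool (J i \<in> Y) * min (q i) \<beta> - \<beta> * n i * q i - \<beta>\<^sup>2 / 2 * n i)"
    unfolding sum.inter_filter[OF fin(1)]
  proof (rule sum_mono)
    fix i assume i: "i \<in> I"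
    have "0 \<le> \<beta> * n i * q i" "0 \<le> \<beta>\<^sup>2 / 2 * n i"
      using \<beta> q i by (auto simp: n_def)
    then show "of_bool (J i \<in> Y) * min (q i) \<beta> - \<beta> * n i * q i - \<beta>\<^sup>2 / 2 * n i
      \<le> (if J i \<in> Y then min (q i) \<beta> - \<beta> * n i * q i - \<beta>\<^sup>2 / 2 * n i else 0)"
      by simp
  qed
  ultimately show ?thesis by linarith
qed

section \<open>Uniform assignments of elements to sites\<close>

text \<open>The coordinates of a uniform \<open>J\<close> are independent: a sum over functions of a
  product is a product of sums.\<close>

lemma avg_PiE_split:
  fixes \<phi> :: "'l \<Rightarrow> real" and h :: "'i \<Rightarrow> 'l \<Rightarrow> real"
  assumes "finite I" "finite U" "i \<in> I"
  shows "(\<Sum>J\<in>I \<rightarrow>\<^sub>E U. \<phi> (J i) * (\<Prod>i'\<in>I - {i}. h i' (J i'))) / real (card U) ^ card I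
    = (\<Sum>l\<in>U. \<phi> l) / real (card U) * (\<Prod>i'\<in>I - {i}. (\<Sum>l\<in>U. h i' l) / real (card U))"
proof -
  define g where "g i' = (if i' = i then \<phi> else h i')" for i'
  have "(\<Sum>J\<in>I \<rightarrow>\<^sub>E U. \<phi> (J i) * (\<Prod>i'\<in>I - {i}. h i' (J i'))) = (\<Sum>J\<in>I \<rightarrow>\<^sub>E U. \<Prod>i'\<in>I. g i' (J i'))"
  proof (rule sum.cong[OF refl])
    fix J
    have "(\<Prod>i'\<in>I. g i' (J i')) = g i (J i) * (\<Prod>i'\<in>I - {i}. g i' (J i'))"
      using assms by (intro prod.remove) auto
    moreover have "(\<Prod>i'\<in>I - {i}. g i' (J i')) = (\<Prod>i'\<in>I - {i}. h i' (J i'))"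
      by (intro prod.cong) (auto simp: g_def)
    ultimately show "\<phi> (J i) * (\<Prod>i'\<in>I - {i}. h i' (J i')) = (\<Prod>i'\<in>I. g i' (J i'))"
      by (simp add: g_def)
  qed
  also have "\<dots> = (\<Prod>i'\<in>I. \<Sum>l\<in>U. g i' l)"
    using assms by (subst prod_sum_PiE) auto
  finally have "(\<Sum>J\<in>I \<rightarrow>\<^sub>E U. \<phi> (J i) * (\<Prod>i'\<in>I - {i}. h i' (J i'))) / real (card U) ^ card I
      = (\<Prod>i'\<in>I. (\<Sum>l\<in>U. g i' l) / real (card U))"
    by (simp add: prod_dividef)
  also have "\<dots> = (\<Sum>l\<in>U. g i l) / real (card U) * (\<Prod>i'\<in>I - {i}. (\<Sum>l\<in>U. g i' l) / real (card U))"
    using assms by (intro prod.remove) auto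
  also have "(\<Prod>i'\<in>I - {i}. (\<Sum>l\<in>U. g i' l) / real (card U)) = (\<Prod>i'\<in>I - {i}. (\<Sum>l\<in>U. h i' l) / real (card U))"
    by (intro prod.cong) (auto simp: g_def)
  finally show ?thesis
    by (simp add: g_def)
qed

lemma avg_PiE_component:
  fixes \<phi> :: "'l \<Rightarrow> real"
  assumes "finite I" "finite U" "U \<noteq> {}" "i \<in> I"
  shows "(\<Sum>J\<in>I \<rightarrow>\<^sub>E U. \<phi> (J i)) / real (card U) ^ card I = (\<Sum>l\<in>U. \<phi> l) / real (card U)"
  using avg_PiE_split[OF assms(1,2,4), of \<phi> "\<lambda>_ _. 1"] assms by simp

text \<open>Fixing the common value \<open>l\<close> turns a collision into a product over the
  coordinates, to which \<open>avg_PiE_split\<close> applies.\<close>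

lemma avg_PiE_collision:
  fixes I :: "'i set" and U :: "'l set"
  assumes "finite I" "finite U" "U \<noteq> {}" "i \<in> I" "i' \<in> I" "i \<noteq> i'"
  shows "(\<Sum>J\<in>I \<rightarrow>\<^sub>E U. of_bool (J i' = J i)) / real (card U) ^ card I = 1 / real (card U)"
proof -
  define h :: "'l \<Rightarrow> 'i \<Rightarrow> 'l \<Rightarrow> real" where "h l a l' = (if a = i' then of_bool (l' = l) else 1)" for l a l'
  have prod_h: "(\<Prod>a\<in>I - {i}. h l a (g a)) = of_bool (g i' = l)" for l g
  proof -
    have "(\<Prod>a\<in>I - {i}. h l a (g a)) = h l i' (g i') * (\<Prod>a\<in>I - {i} - {i'}. h l a (g a))"
      using assms by (intro prod.remove) auto
    also have "(\<Prod>a\<in>I - {i} - {i'}. h l a (g a)) = 1"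
      by (intro prod.neutral) (auto simp: h_def)
    finally show ?thesis by (simp add: h_def)
  qed
  have sum_h: "(\<Prod>a\<in>I - {i}. (\<Sum>l'\<in>U. h l a l') / real (card U)) = 1 / real (card U)" if "l \<in> U" for l
  proof -
    have "(\<Prod>a\<in>I - {i}. (\<Sum>l'\<in>U. h l a l') / real (card U)) =
        (\<Sum>l'\<in>U. h l i' l') / real (card U) * (\<Prod>a\<in>I - {i} - {i'}. (\<Sum>l'\<in>U. h l a l') / real (card U))"
      using assms by (intro prod.remove) auto
    also have "(\<Prod>a\<in>I - {i} - {i'}. (\<Sum>l'\<in>U. h l a l') / real (card U)) = 1"
      using assms by (intro prod.neutral) (auto simp: h_def)
    also have "(\<Sum>l'\<in>U. h l i' l') = 1"
      using assms that by (simp add: h_def)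
    finally show ?thesis by simp
  qed
  have "(\<Sum>J\<in>I \<rightarrow>\<^sub>E U. of_bool (J i' = J i)) / real (card U) ^ card I
      = (\<Sum>J\<in>I \<rightarrow>\<^sub>E U. \<Sum>l\<in>U. of_bool (J i = l) * (\<Prod>a\<in>I - {i}. h l a (J a))) / real (card U) ^ card I"
  proof (intro arg_cong2[where f = "(/)"] refl sum.cong[OF refl])
    fix J assume "J \<in> I \<rightarrow>\<^sub>E U"
    hence "J i \<in> U" using assms by auto
    hence "(\<Sum>l\<in>U. of_bool (J i = l) * of_bool (J i' = l)) = (of_bool (J i' = J i) :: real)"
      using assms(2) by (subst sum.remove[of _ "J i"]) (auto intro!: sum.neutral)
    then show "of_bool (J i' = J i) = (\<Sum>l\<in>U. of_bool (J i = l) * (\<Prod>a\<in>I - {i}. h l a (J a)))"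
      by (simp add: prod_h)
  qed
  also have "\<dots> = (\<Sum>l\<in>U. (\<Sum>J\<in>I \<rightarrow>\<^sub>E U. of_bool (J i = l) * (\<Prod>a\<in>I - {i}. h l a (J a))) / real (card U) ^ card I)"
    by (subst sum.swap) (simp add: sum_divide_distrib)
  also have "\<dots> = (\<Sum>l\<in>U. 1 / real (card U) * (1 / real (card U)))"
  proof (rule sum.cong[OF refl])
    fix l assume l: "l \<in> U"
    have "(\<Sum>l'\<in>U. of_bool (l' = l)) = (1 :: real)"
      using l assms(2) by simp
    then show "(\<Sum>J\<in>I \<rightarrow>\<^sub>E U. of_bool (J i = l) * (\<Prod>a\<in>I - {i}. h l a (J a))) / real (card U) ^ card I
      = 1 / real (card U) * (1 / real (card U))"
      using avg_PiE_split[OF assms(1,2,4), of "\<lambda>l'. of_bool (l' = l)" "h l"] sum_h[OF l] by simp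
  qed
  also have "\<dots> = 1 / real (card U)"
    using assms by simp
  finally show ?thesis .
qed

text \<open>Group sizes count ordered pairs: the diagonal ones give \<open>card I\<close>, and every
  other pair collides with probability \<open>1 / card U\<close>.\<close>

lemma avg_PiE_sum_group_size:
  assumes "finite I" "finite U" "U \<noteq> {}"
  shows "(\<Sum>J\<in>I \<rightarrow>\<^sub>E U. \<Sum>i\<in>I. real (card {i'\<in>I. J i' = J i})) / real (card U) ^ card I
    \<le> real (card I) + (real (card I))\<^sup>2 / real (card U)"
proof -
  have pos: "0 < real (card U)"
    using assms by (simp add: card_gt_0_iff)
  have "(\<Sum>J\<in>I \<rightarrow>\<^sub>E U. \<Sum>i\<in>I. real (card {i'\<in>I. J i' = J i})) / real (card U) ^ card I
      = (\<Sum>J\<in>I \<rightarrow>\<^sub>E U. \<Sum>i\<in>I. \<Sum>i'\<in>I. of_bool (J i' = J i)) / real (card U) ^ card I"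
    using assms(1) by (simp add: Int_def conj_commute)
  also have "\<dots> = (\<Sum>i\<in>I. \<Sum>i'\<in>I. (\<Sum>J\<in>I \<rightarrow>\<^sub>E U. of_bool (J i' = J i)) / real (card U) ^ card I)"
    unfolding sum_divide_distrib
    by (subst sum.swap) (rule sum.cong[OF refl], subst sum.swap, rule refl)
  also have "\<dots> \<le> (\<Sum>i\<in>I. \<Sum>i'\<in>I. of_bool (i' = i) + 1 / real (card U))"
  proof (intro sum_mono)
    fix i i' assume i: "i \<in> I" "i' \<in> I"
    show "(\<Sum>J\<in>I \<rightarrow>\<^sub>E U. of_bool (J i' = J i)) / real (card U) ^ card I \<le> of_bool (i' = i) + 1 / real (card U)"
    proof (cases "i' = i")
      case True
      have "(\<Sum>J\<in>I \<rightarrow>\<^sub>E U. of_bool (J i' = J i)) / real (card U) ^ card I = (1 :: real)"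
        using True avg_PiE_component[OF assms i(1), of "\<lambda>_. 1"] pos by simp
      then show ?thesis using True pos by (subst \<open>_ = 1\<close>) simp
    next
      case False
      then show ?thesis
        using avg_PiE_collision[OF assms i] by auto
    qed
  qed
  also have "\<dots> = real (card I) + (real (card I))\<^sup>2 / real (card U)"
    using assms(1) by (simp add: sum.distrib power2_eq_square distrib_left)
  finally show ?thesis .
qed

subsection \<open>Transcripts\<close>

primrec transcript :: "(nat \<Rightarrow> site) \<Rightarrow> (nat \<Rightarrow> nat set) \<Rightarrow> nat coordinator \<Rightarrow> (nat \<Rightarrow> event list) \<Rightarrow> nat \<Rightarrow> event list" where
  "transcript s A (Output v) h = h"
| "transcript s A (Send i b p) h = transcript s A p (h(i := h i @ [To_Site b]))"
| "transcript s A (Receive i q) h =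
    (let b = s i (A i) (h i) in transcript s A (q b) (h(i := h i @ [From_Site b])))"

definition consistent :: "site \<Rightarrow> event list \<Rightarrow> nat set \<Rightarrow> bool" where
  "consistent s t x \<longleftrightarrow> (\<forall>n b. n < length t \<longrightarrow> t ! n = From_Site b \<longrightarrow> s x (take n t) = b)"

lemma consistent_snoc:
  "consistent s (t @ [e]) x \<longleftrightarrow> consistent s t x \<and> (\<forall>b. e = From_Site b \<longrightarrow> s x t = b)"
  unfolding consistent_def by (auto simp: nth_append less_Suc_eq)

lemma consistent_append_snocD:
  assumes "consistent s (t @ [From_Site b] @ t') x"
  shows "s x t = b"
  using assms unfolding consistent_def by (auto dest!: spec[of _ "length t"])

lemma transcript_extends: "\<exists>t. transcript s A p h i = h i @ t"
proof (induction p arbitrary: h)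
  case (Send j b p)
  define h' where "h' = h(j := h j @ [To_Site b])"
  obtain t where "transcript s A p h' i = h' i @ t"
    using Send by blast
  moreover have "transcript s A (Send j b p) h = transcript s A p h'" "h' i = h i \<or> h' i = h i @ [To_Site b]"
    by (auto simp: h'_def)
  ultimately show ?case by auto
next
  case (Receive j q)
  define b where "b = s j (A j) (h j)"
  define h' where "h' = h(j := h j @ [From_Site b])"
  obtain t where "transcript s A (q b) h' i = h' i @ t"
    using Receive by blast
  moreover have "transcript s A (Receive j q) h = transcript s A (q b) h'" "h' i = h i \<or> h' i = h i @ [From_Site b]"
    by (auto simp: h'_def b_def Let_def)
  ultimately show ?case by auto
qed auto

lemma transcript_consistent:
  assumes "\<And>i. consistent (s i) (h i) (A i)"
  shows "consistent (s i) (transcript s A p h i) (A i)"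
  using assms
proof (induction p arbitrary: h)
  case (Send j b p)
  show ?case
    using Send.prems by (auto intro!: Send.IH simp: consistent_snoc)
next
  case (Receive j q)
  show ?case
    using Receive.prems by (auto intro!: Receive.IH simp: consistent_snoc Let_def)
qed auto

text \<open>The inputs with a given transcript form a rectangle: consistency is a condition on each site
  separately.\<close>

lemma transcript_determined:
  assumes "contacted p \<subseteq> I"
    and "\<And>i. i \<in> I \<Longrightarrow> consistent (s i) (transcript s A p h i) (A' i)"
  shows "transcript s A' p h = transcript s A p h \<and> result s A' p h = result s A p h"
  using assms
proof (induction p arbitrary: h)
  case (Receive j q)
  define b where "b = s j (A j) (h j)"
  define h' where "h' = h(j := h j @ [From_Site b])"
  have j: "j \<in> I"
    using Receive.prems(1) by auto
  have step: "transcript s A (Receive j q) h = transcript s A (q b) h'"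
      "result s A (Receive j q) h = result s A (q b) h'"
    by (simp_all add: b_def h'_def Let_def)
  \<comment> \<open>Histories only grow, so the bit recorded now sits in the final history of
    channel \<open>j\<close> at position \<open>length (h j)\<close>. Consistency of
    \<open>A' j\<close> with that history forces the same bit.\<close>
  obtain t where "transcript s A (q b) h' j = h' j @ t"
    using transcript_extends by blast
  hence "transcript s A (Receive j q) h j = h j @ [From_Site b] @ t"
    by (simp only: step) (simp add: h'_def)
  hence "s j (A' j) (h j) = b"
    using Receive.prems(2)[OF j] by (metis consistent_append_snocD)
  hence step': "transcript s A' (Receive j q) h = transcript s A' (q b) h'"
      "result s A' (Receive j q) h = result s A' (q b) h'"
    by (simp_all add: h'_def Let_def)
  have "contacted (q b) \<subseteq> I"
    using Receive.prems(1) by auto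
  then show ?case
    unfolding step step' using Receive.prems(2) unfolding step by (intro Receive.IH) auto
qed auto

lemma cost_eq_length_transcript:
  assumes "contacted p \<subseteq> {..<k}"
  shows "cost s A p h + (\<Sum>i<k. length (h i)) = (\<Sum>i<k. length (transcript s A p h i))"
proof -
  have upd: "(\<Sum>i<k. length ((h(j := h j @ [e])) i)) = Suc (\<Sum>i<k. length (h i))" if "j < k"
    for j e and h :: "nat \<Rightarrow> event list"
  proof -
    have "(\<Sum>i<k. length ((h(j := h j @ [e])) i)) = (\<Sum>i<k. length (h i) + (if i = j then 1 else 0))"
      by (intro sum.cong) auto
    then show ?thesis
      using that by (simp add: sum.distrib)
  qed
  show ?thesis
    using assms
  proof (induction p arbitrary: h)
    case (Send j b p)
    define h' where "h' = h(j := h j @ [To_Site b])"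
    have "cost s A (Send j b p) h = Suc (cost s A p h')" "transcript s A (Send j b p) h = transcript s A p h'"
      by (simp_all add: h'_def)
    moreover have "contacted p \<subseteq> {..<k}" "j < k"
      using Send.prems by auto
    moreover have "(\<Sum>i<k. length (h' i)) = Suc (\<Sum>i<k. length (h i))"
      unfolding h'_def using \<open>j < k\<close> by (rule upd)
    ultimately show ?case
      using Send.IH[of h'] by simp
  next
    case (Receive j q)
    define b where "b = s j (A j) (h j)"
    define h' where "h' = h(j := h j @ [From_Site b])"
    have "cost s A (Receive j q) h = Suc (cost s A (q b) h')"
      "transcript s A (Receive j q) h = transcript s A (q b) h'"
      by (simp_all add: h'_def b_def Let_def)
    moreover have "contacted (q b) \<subseteq> {..<k}" "j < k"
      using Receive.prems by auto
    moreover have "(\<Sum>i<k. length (h' i)) = Suc (\<Sum>i<k. length (h i))"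
      unfolding h'_def using \<open>j < k\<close> by (rule upd)
    ultimately show ?case
      using Receive.IH[of "q b" h'] by simp
  qed auto
qed

lemma finite_inputs: "finite (inputs k m)"
  by (simp add: inputs_def finite_PiE)

section \<open>Protocols as partitions into rectangles\<close>

text \<open>What is kept of a deterministic protocol: its transcripts cut the inputs into nonempty
  rectangles, one for each \<open>h \<in> H\<close>, with the sets satisfying
  \<open>cons i (h i)\<close> as its side at site \<open>i\<close>. The likelihood arguments up to
  \<open>error_ge\<close> use only this.\<close>

locale transcripts =
  fixes k m :: nat and H :: "(nat \<Rightarrow> event list) set" and cons :: "nat \<Rightarrow> event list \<Rightarrow> nat set \<Rightarrow> bool"
  assumes finite_H: "finite H"
    and unique: "\<And>A. A \<in> inputs k m \<Longrightarrow> \<exists>!h. h \<in> H \<and> (\<forall>i<k. cons i (h i) (A i))"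
    and realized: "\<And>h. h \<in> H \<Longrightarrow> \<exists>A\<in>inputs k m. \<forall>i<k. cons i (h i) (A i)"
begin

definition ind :: "nat \<Rightarrow> event list \<Rightarrow> nat set \<Rightarrow> real" where
  "ind i t x = of_bool (cons i t x)"

text \<open>\<open>L\<close> is the likelihood of a channel history when the input of site
  \<open>i\<close> follows a weighting \<open>a\<close>, possibly signed, of total mass
  \<open>s\<close>. The notion is closed under sums and scaling, so one multilinear identity yields
  the normalizations of all the mixtures below.\<close>

definition site_mass :: "nat \<Rightarrow> (event list \<Rightarrow> real) \<Rightarrow> real \<Rightarrow> bool" where
  "site_mass i L s \<longleftrightarrow>
    (\<exists>a. L = (\<lambda>t. \<Sum>x\<in>Pow {1..m}. a x * ind i t x) \<and> s = (\<Sum>x\<in>Pow {1..m}. a x))"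

lemma ind_nonneg: "0 \<le> ind i t x" and ind_le_1: "ind i t x \<le> 1"
  by (simp_all add: ind_def)

lemma site_mass_point:
  assumes "x \<subseteq> {1..m}"
  shows "site_mass i (\<lambda>t. ind i t x) 1"
  unfolding site_mass_def
  by (rule exI[of _ "\<lambda>x'. of_bool (x' = x)"]) (use assms in auto)

lemma site_mass_scale:
  assumes "site_mass i L s"
  shows "site_mass i (\<lambda>t. c * L t) (c * s)"
proof -
  obtain a where "L = (\<lambda>t. \<Sum>x\<in>Pow {1..m}. a x * ind i t x)" "s = (\<Sum>x\<in>Pow {1..m}. a x)"
    using assms unfolding site_mass_def by blast
  then show ?thesis
    unfolding site_mass_def
    by (intro exI[of _ "\<lambda>x. c * a x"]) (simp add: sum_distrib_left mult.assoc)
qed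

lemma site_mass_sum:
  assumes "\<And>w. w \<in> W \<Longrightarrow> site_mass i (L w) (s w)"
  shows "site_mass i (\<lambda>t. \<Sum>w\<in>W. L w t) (\<Sum>w\<in>W. s w)"
proof -
  obtain a where a: "\<And>w. w \<in> W \<Longrightarrow> L w = (\<lambda>t. \<Sum>x\<in>Pow {1..m}. a w x * ind i t x)"
      "\<And>w. w \<in> W \<Longrightarrow> s w = (\<Sum>x\<in>Pow {1..m}. a w x)"
    using assms unfolding site_mass_def by metis
  have "(\<Sum>w\<in>W. L w t) = (\<Sum>x\<in>Pow {1..m}. (\<Sum>w\<in>W. a w x) * ind i t x)" for t
    unfolding sum_distrib_right by (subst sum.swap) (use a(1) in \<open>auto intro!: sum.cong\<close>)
  moreover have "(\<Sum>w\<in>W. s w) = (\<Sum>x\<in>Pow {1..m}. (\<Sum>w\<in>W. a w x))"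
    by (subst sum.swap) (use a(2) in \<open>auto intro!: sum.cong\<close>)
  ultimately show ?thesis
    unfolding site_mass_def by (intro exI[of _ "\<lambda>x. \<Sum>w\<in>W. a w x"]) auto
qed

lemma site_mass_add:
  assumes "site_mass i L s" "site_mass i L' s'"
  shows "site_mass i (\<lambda>t. L t + L' t) (s + s')"
  using site_mass_sum[of "UNIV :: bool set" i "\<lambda>b. if b then L else L'" "\<lambda>b. if b then s else s'"] assms
  by (simp add: UNIV_bool add.commute)

lemma sum_prod_ind:
  assumes "A \<in> inputs k m"
  shows "(\<Sum>h\<in>H. (\<Prod>i<k. ind i (h i) (A i)) * \<phi> h) = \<phi> (THE h. h \<in> H \<and> (\<forall>i<k. cons i (h i) (A i)))"
proof -
  define h0 where "h0 = (THE h. h \<in> H \<and> (\<forall>i<k. cons i (h i) (A i)))"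
  have h0: "h0 \<in> H \<and> (\<forall>i<k. cons i (h0 i) (A i))"
    unfolding h0_def by (rule theI'[OF unique[OF assms]])
  have "(\<Prod>i<k. ind i (h i) (A i)) = of_bool (h = h0)" if "h \<in> H" for h
  proof (cases "h = h0")
    case True
    then show ?thesis
      using h0 by (simp add: ind_def)
  next
    case False
    hence "\<exists>i<k. \<not> cons i (h i) (A i)"
      using unique[OF assms] h0 that by blast
    then show ?thesis
      using False by (auto simp: ind_def intro!: prod_zero)
  qed
  hence "(\<Sum>h\<in>H. (\<Prod>i<k. ind i (h i) (A i)) * \<phi> h) = (\<Sum>h\<in>H. if h = h0 then \<phi> h else 0)"
    by (intro sum.cong) auto
  then show ?thesis
    using h0 finite_H by (simp add: h0_def)
qed

text \<open>Both sides are multilinear in the weightings; for point masses the claim is that exactly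
  one transcript is consistent with the input.\<close>

lemma sum_prod_site_mass:
  assumes "\<And>i. i < k \<Longrightarrow> site_mass i (L i) (s i)"
  shows "(\<Sum>h\<in>H. \<Prod>i<k. L i (h i)) = (\<Prod>i<k. s i)"
proof -
  obtain a where a: "\<And>i. i < k \<Longrightarrow> L i = (\<lambda>t. \<Sum>x\<in>Pow {1..m}. a i x * ind i t x)"
      "\<And>i. i < k \<Longrightarrow> s i = (\<Sum>x\<in>Pow {1..m}. a i x)"
    using assms unfolding site_mass_def by metis
  have "(\<Sum>h\<in>H. \<Prod>i<k. L i (h i)) = (\<Sum>h\<in>H. \<Prod>i<k. \<Sum>x\<in>Pow {1..m}. a i x * ind i (h i) x)"
    using a(1) by (intro sum.cong prod.cong) auto
  also have "\<dots> = (\<Sum>h\<in>H. \<Sum>A\<in>inputs k m. \<Prod>i<k. a i (A i) * ind i (h i) (A i))"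
    unfolding inputs_def by (subst prod_sum_PiE) auto
  also have "\<dots> = (\<Sum>A\<in>inputs k m. \<Sum>h\<in>H. \<Prod>i<k. a i (A i) * ind i (h i) (A i))"
    by (rule sum.swap)
  also have "\<dots> = (\<Sum>A\<in>inputs k m. \<Prod>i<k. a i (A i))"
    using sum_prod_ind[where \<phi> = "\<lambda>_. 1"]
    by (intro sum.cong) (auto simp: prod.distrib simp flip: sum_distrib_left)
  also have "\<dots> = (\<Prod>i<k. \<Sum>x\<in>Pow {1..m}. a i x)"
    unfolding inputs_def by (subst prod_sum_PiE) auto
  also have "\<dots> = (\<Prod>i<k. s i)"
    using a(2) by (intro prod.cong) auto
  finally show ?thesis .
qed

end

lemma transcripts_of_protocol:
  assumes "contacted (coord \<pi>) \<subseteq> {..<k}"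
  defines "tr \<equiv> \<lambda>A. transcript (site \<pi>) A (coord \<pi>) (\<lambda>_. [])"
  shows "transcripts k m (tr ` inputs k m) (\<lambda>i. consistent (site \<pi> i))"
    and "A \<in> inputs k m \<Longrightarrow> h = tr A' \<Longrightarrow> \<forall>i<k. consistent (site \<pi> i) (h i) (A i) \<Longrightarrow>
      h = tr A \<and> protocol_output \<pi> A = protocol_output \<pi> A'"
    and "(\<Sum>i<k. length (tr A i)) = bits_exchanged \<pi> A"
proof -
  have self: "consistent (site \<pi> i) (tr A i) (A i)" for A i
    unfolding tr_def by (rule transcript_consistent) (simp add: consistent_def)
  have det: "tr A' = tr A \<and> protocol_output \<pi> A' = protocol_output \<pi> A"
    if "\<forall>i<k. consistent (site \<pi> i) (tr A i) (A' i)" for A A'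
    using transcript_determined[OF assms(1), of "site \<pi>" A "\<lambda>_. []" A'] that
    by (auto simp: tr_def protocol_output_def)
  show "transcripts k m (tr ` inputs k m) (\<lambda>i. consistent (site \<pi> i))"
  proof
    show "finite (tr ` inputs k m)"
      by (simp add: finite_inputs)
    show "\<exists>!h. h \<in> tr ` inputs k m \<and> (\<forall>i<k. consistent (site \<pi> i) (h i) (A i))" if "A \<in> inputs k m" for A
      using that self det by (intro ex1I[of _ "tr A"]) auto
    show "\<exists>A\<in>inputs k m. \<forall>i<k. consistent (site \<pi> i) (h i) (A i)" if "h \<in> tr ` inputs k m" for h
      using that self by auto
  qed
  show "h = tr A \<and> protocol_output \<pi> A = protocol_output \<pi> A'"
    if "A \<in> inputs k m" "h = tr A'" "\<forall>i<k. consistent (site \<pi> i) (h i) (A i)"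
    using det[of A' A] that by auto
  show "(\<Sum>i<k. length (tr A i)) = bits_exchanged \<pi> A"
    using cost_eq_length_transcript[OF assms(1), of "site \<pi>" A "\<lambda>_. []"]
    by (simp add: tr_def bits_exchanged_def)
qed

subsection \<open>The hard distribution\<close>

declare One_nat_def [simp del]

text \<open>
  Sites \<open>0, \<dots>, K - 1\<close> and the universe \<open>U = {1..m}\<close>. Site \<open>K\<close> holds \<open>U - y\<close>; a site \<open>i < K\<close> holds a
  set \<open>x\<close> drawn given \<open>y\<close> and, with probability \<open>\<beta>\<close>, in addition the element \<open>l\<close> assigned to it.
  Then \<open>miss i y t\<close> and \<open>hit i y l t\<close> are the probabilities that site \<open>i\<close> is consistent with the
  channel history \<open>t\<close> in the two cases, and \<open>mix i y l t\<close> is the overall one.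
\<close>

locale hard_distribution = transcripts "Suc K" m H cons
  for K m :: nat and H :: "(nat \<Rightarrow> event list) set" and cons :: "nat \<Rightarrow> event list \<Rightarrow> nat set \<Rightarrow> bool" +
  fixes \<beta> :: real
  assumes \<beta>: "0 \<le> \<beta>" "\<beta> \<le> 1" and m_pos: "0 < m"
begin

abbreviation U :: "nat set" where "U \<equiv> {1..m}"

definition miss :: "nat \<Rightarrow> nat set \<Rightarrow> event list \<Rightarrow> real" where
  "miss i y t = (\<Sum>x\<in>Pow (U - y). cond_weight U y x * ind i t x)"

definition hit :: "nat \<Rightarrow> nat set \<Rightarrow> nat \<Rightarrow> event list \<Rightarrow> real" where
  "hit i y l t = (\<Sum>x\<in>Pow (U - y). cond_weight U y x * ind i t (insert l x))"

definition mix :: "nat \<Rightarrow> nat set \<Rightarrow> nat \<Rightarrow> event list \<Rightarrow> real" where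
  "mix i y l t = (1 - \<beta>) * miss i y t + \<beta> * hit i y l t"

definition avg_mix :: "nat \<Rightarrow> nat set \<Rightarrow> event list \<Rightarrow> real" where
  "avg_mix i y t = (\<Sum>l\<in>U. mix i y l t) / real (card U)"

text \<open>Treats site \<open>i\<close> against everybody else as a two-party protocol. Given
  \<open>y\<close>, the inputs of the others do not depend on that of site \<open>i\<close>, so the
  holder of \<open>y\<close> can simulate them. This is the second party's factor, \<open>g\<close>
  in \<open>two_party_disjointness\<close>, with the assignments of the other sites averaged
  out.\<close>

definition rest :: "nat \<Rightarrow> nat set \<Rightarrow> event list \<Rightarrow> real" where
  "rest i y t = (\<Sum>h\<in>{h\<in>H. h i = t}. ind K (h K) (U - y) * (\<Prod>i'\<in>{..<K} - {i}. avg_mix i' y (h i')))"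

lemma miss_nonneg: "0 \<le> miss i y t" and hit_nonneg: "0 \<le> hit i y l t"
  by (auto simp: miss_def hit_def intro!: sum_nonneg mult_nonneg_nonneg cond_weight_nonneg ind_nonneg)

lemma mix_nonneg: "0 \<le> mix i y l t"
  using \<beta> by (simp add: mix_def miss_nonneg hit_nonneg)

lemma avg_mix_nonneg: "0 \<le> avg_mix i y t"
  by (simp add: avg_mix_def mix_nonneg sum_nonneg)

lemma site_mass_miss: "site_mass i (miss i y) 1"
proof -
  have "site_mass i (\<lambda>t. \<Sum>x\<in>Pow (U - y). cond_weight U y x * ind i t x) (\<Sum>x\<in>Pow (U - y). cond_weight U y x * 1)"
    by (intro site_mass_sum site_mass_scale site_mass_point) auto
  then show ?thesis
    by (simp add: sum_cond_weight flip: miss_def)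
qed

lemma site_mass_hit:
  assumes "l \<in> U"
  shows "site_mass i (hit i y l) 1"
proof -
  have "site_mass i (\<lambda>t. \<Sum>x\<in>Pow (U - y). cond_weight U y x * ind i t (insert l x)) (\<Sum>x\<in>Pow (U - y). cond_weight U y x * 1)"
    using assms by (intro site_mass_sum site_mass_scale site_mass_point) auto
  then show ?thesis
    by (simp add: sum_cond_weight flip: hit_def)
qed

lemma site_mass_mix:
  assumes "l \<in> U"
  shows "site_mass i (mix i y l) 1"
proof -
  have "site_mass i (\<lambda>t. (1 - \<beta>) * miss i y t + \<beta> * hit i y l t) ((1 - \<beta>) * 1 + \<beta> * 1)"
    using assms by (intro site_mass_add site_mass_scale site_mass_miss site_mass_hit)
  then show ?thesis
    by (simp flip: mix_def)
qed

lemma site_mass_avg_mix: "site_mass i (avg_mix i y) 1"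
proof -
  have "site_mass i (\<lambda>t. 1 / real (card U) * (\<Sum>l\<in>U. mix i y l t)) (1 / real (card U) * (\<Sum>l\<in>U. 1))"
    by (intro site_mass_scale site_mass_sum site_mass_mix) auto
  then show ?thesis
    using m_pos by (simp add: avg_mix_def[abs_def])
qed

lemma sum_transcripts:
  assumes "\<And>i. i < K \<Longrightarrow> site_mass i (L i) 1"
  shows "(\<Sum>h\<in>H. ind K (h K) (U - y) * (\<Prod>i<K. L i (h i))) = 1"
proof -
  define L' where "L' i = (if i = K then (\<lambda>t. ind K t (U - y)) else L i)" for i
  have "(\<Sum>h\<in>H. \<Prod>i<Suc K. L' i (h i)) = (\<Prod>i<Suc K. 1)"
  proof (rule sum_prod_site_mass)
    fix i assume "i < Suc K"
    then show "site_mass i (L' i) 1"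
      using assms site_mass_point[of "U - y" K] by (cases "i = K") (auto simp: L'_def)
  qed
  moreover have "(\<Prod>i<Suc K. L' i (h i)) = ind K (h K) (U - y) * (\<Prod>i<K. L i (h i))" for h
    by (simp add: L'_def mult.commute)
  ultimately show ?thesis by simp
qed

lemma sum_transcripts_split:
  assumes "i < K" "site_mass i L1 1" "\<And>i. i < K \<Longrightarrow> site_mass i (L i) 1"
  shows "(\<Sum>h\<in>H. ind K (h K) (U - y) * (L1 (h i) * (\<Prod>i'\<in>{..<K} - {i}. L i' (h i')))) = 1"
proof -
  define L' where "L' i' = (if i' = i then L1 else L i')" for i'
  have "(\<Prod>i<K. L' i (h i)) = L1 (h i) * (\<Prod>i'\<in>{..<K} - {i}. L i' (h i'))" for h
  proof -
    have "(\<Prod>i<K. L' i (h i)) = L' i (h i) * (\<Prod>i'\<in>{..<K} - {i}. L' i' (h i'))"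
      using assms(1) by (intro prod.remove) auto
    also have "(\<Prod>i'\<in>{..<K} - {i}. L' i' (h i')) = (\<Prod>i'\<in>{..<K} - {i}. L i' (h i'))"
      by (intro prod.cong) (auto simp: L'_def)
    finally show ?thesis by (simp add: L'_def)
  qed
  moreover have "(\<Sum>h\<in>H. ind K (h K) (U - y) * (\<Prod>i<K. L' i (h i))) = 1"
    using assms by (intro sum_transcripts) (auto simp: L'_def)
  ultimately show ?thesis by simp
qed

lemma sum_rest:
  shows "(\<Sum>t\<in>(\<lambda>h. h i) ` H. \<phi> t * rest i y t)
    = (\<Sum>h\<in>H. ind K (h K) (U - y) * (\<phi> (h i) * (\<Prod>i'\<in>{..<K} - {i}. avg_mix i' y (h i'))))"
proof -
  have "(\<Sum>h\<in>H. ind K (h K) (U - y) * (\<phi> (h i) * (\<Prod>i'\<in>{..<K} - {i}. avg_mix i' y (h i'))))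
      = (\<Sum>t\<in>(\<lambda>h. h i) ` H. \<Sum>h\<in>{h\<in>H. h i = t}.
          ind K (h K) (U - y) * (\<phi> (h i) * (\<Prod>i'\<in>{..<K} - {i}. avg_mix i' y (h i'))))"
    using finite_H by (intro sum.group[symmetric]) auto
  also have "\<dots> = (\<Sum>t\<in>(\<lambda>h. h i) ` H. \<phi> t * rest i y t)"
    unfolding rest_def sum_distrib_left by (intro sum.cong) (auto simp: mult_ac)
  finally show ?thesis ..
qed

lemma rest_nonneg: "0 \<le> rest i y t"
  unfolding rest_def by (intro sum_nonneg mult_nonneg_nonneg prod_nonneg ind_nonneg avg_mix_nonneg ballI)

lemma sum_ind_rest:
  assumes "i < K" "x \<subseteq> U"
  shows "(\<Sum>t\<in>(\<lambda>h. h i) ` H. ind i t x * rest i y t) = 1"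
  unfolding sum_rest
  using assms by (intro sum_transcripts_split site_mass_point site_mass_avg_mix)

text \<open>The history \<open>t\<close> is consistent with some set \<open>x\<close>, and for that
  \<open>x\<close> the likelihoods \<open>ind i t x * rest i y t\<close> over all histories sum to
  1.\<close>

lemma rest_le_1:
  assumes "i < K" "t \<in> (\<lambda>h. h i) ` H"
  shows "rest i y t \<le> 1"
proof -
  obtain A where A: "A \<in> inputs (Suc K) m" "cons i t (A i)"
    using assms realized by fastforce
  hence "A i \<subseteq> U"
    using assms(1) by (auto simp: inputs_def PiE_iff less_Suc_eq)
  hence "(\<Sum>t\<in>(\<lambda>h. h i) ` H. ind i t (A i) * rest i y t) = 1"
    using assms(1) by (intro sum_ind_rest)
  moreover have "ind i t (A i) * rest i y t \<le> (\<Sum>t\<in>(\<lambda>h. h i) ` H. ind i t (A i) * rest i y t)"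
    using assms(2) finite_H
    by (intro member_le_sum mult_nonneg_nonneg ind_nonneg rest_nonneg) auto
  ultimately show ?thesis
    using A(2) by (simp add: ind_def)
qed

section \<open>Channel length and distinguishability at one site\<close>

text \<open>Site \<open>i\<close> is taken to miss, because then its set is disjoint from
  \<open>y\<close>, as in the length term of \<open>two_party_disjointness\<close>; the other sites
  follow their mixtures.\<close>

definition expected_length :: "nat \<Rightarrow> real" where
  "expected_length i = (\<Sum>y\<in>Pow U. set_weight U y *
     (\<Sum>h\<in>H. ind K (h K) (U - y) * (miss i y (h i) * real (length (h i)) *
        (\<Prod>i'\<in>{..<K} - {i}. avg_mix i' y (h i')))))"

text \<open>For each \<open>l\<close> in \<open>y\<close>, the sum over \<open>H\<close> is the
  total variation distance between the transcript distributions for a miss and for a hit at site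
  \<open>i\<close>: both have mass 1, so the positive part of the difference suffices.\<close>

definition advantage :: "nat \<Rightarrow> real" where
  "advantage i = (\<Sum>y\<in>Pow U. set_weight U y * (\<Sum>l\<in>y.
     (\<Sum>h\<in>H. ind K (h K) (U - y) * (max 0 (miss i y (h i) - hit i y l (h i)) *
        (\<Prod>i'\<in>{..<K} - {i}. avg_mix i' y (h i'))))))"

lemma advantage_le:
  assumes "i < K"
  shows "advantage i \<le> real m / 16 + 336 * (expected_length i + 1)"
proof -
  let ?T = "(\<lambda>h. h i) ` H"
  have "(\<Sum>y\<in>Pow U. set_weight U y * (\<Sum>l\<in>y. \<Sum>t\<in>?T. rest i y t *
      max 0 (\<Sum>x\<in>Pow (U - y). cond_weight U y x * (ind i t x - ind i t (insert l x)))))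
    \<le> real (card U) / 16 + 336 * ((\<Sum>y\<in>Pow U. set_weight U y *
        (\<Sum>t\<in>?T. rest i y t * (\<Sum>x\<in>Pow (U - y). cond_weight U y x * ind i t x) * real (length t))) + 1)"
    using assms finite_H
    by (intro two_party_disjointness ind_nonneg ind_le_1 rest_nonneg rest_le_1 sum_ind_rest) auto
  moreover have "(\<Sum>t\<in>?T. rest i y t *
      max 0 (\<Sum>x\<in>Pow (U - y). cond_weight U y x * (ind i t x - ind i t (insert l x))))
    = (\<Sum>h\<in>H. ind K (h K) (U - y) * (max 0 (miss i y (h i) - hit i y l (h i)) *
        (\<Prod>i'\<in>{..<K} - {i}. avg_mix i' y (h i'))))" for y l
    using sum_rest[where i = i and y = y and \<phi> = "\<lambda>t. max 0 (miss i y t - hit i y l t)"]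
    by (simp add: miss_def hit_def right_diff_distrib sum_subtractf mult.commute)
  moreover have "(\<Sum>t\<in>?T. rest i y t * (\<Sum>x\<in>Pow (U - y). cond_weight U y x * ind i t x) * real (length t))
    = (\<Sum>h\<in>H. ind K (h K) (U - y) * (miss i y (h i) * real (length (h i)) *
        (\<Prod>i'\<in>{..<K} - {i}. avg_mix i' y (h i'))))" for y
  proof -
    have "(\<Sum>t\<in>?T. rest i y t * (\<Sum>x\<in>Pow (U - y). cond_weight U y x * ind i t x) * real (length t))
        = (\<Sum>t\<in>?T. (miss i y t * real (length t)) * rest i y t)"
      unfolding miss_def[symmetric] by (simp only: mult_ac)
    then show ?thesis
      by (simp only: sum_rest)
  qed
  ultimately show ?thesis
    by (simp add: advantage_def expected_length_def)
qed

text \<open>Each \<open>expected_length i\<close> lives under its own distribution, with site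
  \<open>i\<close> missing. As a miss has probability \<open>1 - \<beta>\<close>, the factor
  \<open>1 - \<beta>\<close> allows a passage to the common mixture, where the lengths of all
  channels add up to at most \<open>b\<close>.\<close>

lemma sum_expected_length_le:
  assumes "\<And>h. h \<in> H \<Longrightarrow> (\<Sum>i<Suc K. length (h i)) \<le> b"
  shows "(1 - \<beta>) * (\<Sum>i<K. expected_length i) \<le> real b"
proof -
  have le: "(1 - \<beta>) * miss i y t \<le> avg_mix i y t" for i y t
  proof -
    have "(1 - \<beta>) * miss i y t = (\<Sum>l\<in>U. (1 - \<beta>) * miss i y t) / real (card U)"
      using m_pos by simp
    also have "\<dots> \<le> avg_mix i y t"
      unfolding avg_mix_def mix_def using \<beta> hit_nonneg by (intro divide_right_mono sum_mono) auto
    finally show ?thesis .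
  qed
  have "(1 - \<beta>) * expected_length i \<le> (\<Sum>y\<in>Pow U. set_weight U y *
     (\<Sum>h\<in>H. ind K (h K) (U - y) * (\<Prod>i<K. avg_mix i y (h i)) * real (length (h i))))" if "i < K" for i
  proof -
    have "(1 - \<beta>) * expected_length i = (\<Sum>y\<in>Pow U. set_weight U y *
     (\<Sum>h\<in>H. ind K (h K) (U - y) * ((1 - \<beta>) * miss i y (h i) *
        (\<Prod>i'\<in>{..<K} - {i}. avg_mix i' y (h i'))) * real (length (h i))))"
      unfolding expected_length_def sum_distrib_left by (simp only: mult_ac)
    also have "\<dots> \<le> (\<Sum>y\<in>Pow U. set_weight U y *
     (\<Sum>h\<in>H. ind K (h K) (U - y) * (avg_mix i y (h i) *
        (\<Prod>i'\<in>{..<K} - {i}. avg_mix i' y (h i'))) * real (length (h i))))"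
      by (intro sum_mono mult_left_mono mult_right_mono le prod_nonneg ballI avg_mix_nonneg ind_nonneg
          less_imp_le[OF set_weight_pos]) auto
    also have "\<dots> = (\<Sum>y\<in>Pow U. set_weight U y *
     (\<Sum>h\<in>H. ind K (h K) (U - y) * (\<Prod>i<K. avg_mix i y (h i)) * real (length (h i))))"
      using that by (subst prod.remove[of "{..<K}" i]) auto
    finally show ?thesis .
  qed
  hence "(\<Sum>i<K. (1 - \<beta>) * expected_length i) \<le> (\<Sum>i<K. \<Sum>y\<in>Pow U. set_weight U y *
     (\<Sum>h\<in>H. ind K (h K) (U - y) * (\<Prod>i<K. avg_mix i y (h i)) * real (length (h i))))"
    by (intro sum_mono) auto
  also have "\<dots> = (\<Sum>y\<in>Pow U. set_weight U y *
     (\<Sum>h\<in>H. ind K (h K) (U - y) * (\<Prod>i<K. avg_mix i y (h i)) * (\<Sum>i<K. real (length (h i)))))"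
    unfolding sum_distrib_left
    by (subst sum.swap) (rule sum.cong[OF refl], rule sum.swap)
  also have "\<dots> \<le> (\<Sum>y\<in>Pow U. set_weight U y *
     (\<Sum>h\<in>H. ind K (h K) (U - y) * (\<Prod>i<K. avg_mix i y (h i)) * real b))"
  proof (intro sum_mono mult_left_mono mult_nonneg_nonneg prod_nonneg ballI avg_mix_nonneg ind_nonneg
          less_imp_le[OF set_weight_pos])
    fix h assume "h \<in> H"
    have "(\<Sum>i<K. real (length (h i))) \<le> real (\<Sum>i<Suc K. length (h i))"
      by simp
    also have "\<dots> \<le> real b"
      using assms[OF \<open>h \<in> H\<close>] by (simp only: of_nat_le_iff)
    finally show "(\<Sum>i<K. real (length (h i))) \<le> real b" .
  qed auto
  also have "\<dots> = (\<Sum>y\<in>Pow U. set_weight U y * real b)"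
  proof -
    have "(\<Sum>h\<in>H. ind K (h K) (U - y) * (\<Prod>i<K. avg_mix i y (h i))) = 1" for y
      by (intro sum_transcripts site_mass_avg_mix)
    then show ?thesis
      by (simp flip: sum_distrib_right)
  qed
  also have "\<dots> = real b"
    by (simp add: sum_set_weight flip: sum_distrib_right)
  finally show ?thesis
    by (simp add: sum_distrib_left)
qed

section \<open>Posterior of a hit and the remaining variance\<close>

definition posterior :: "nat \<Rightarrow> nat set \<Rightarrow> nat \<Rightarrow> event list \<Rightarrow> real" where
  "posterior i y l t = \<beta> * hit i y l t / mix i y l t"

definition weight :: "nat set \<Rightarrow> (nat \<Rightarrow> nat) \<Rightarrow> (nat \<Rightarrow> event list) \<Rightarrow> real" where
  "weight y J h = ind K (h K) (U - y) * (\<Prod>i<K. mix i y (J i) (h i))"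

definition others :: "nat \<Rightarrow> nat set \<Rightarrow> (nat \<Rightarrow> nat) \<Rightarrow> (nat \<Rightarrow> event list) \<Rightarrow> real" where
  "others i y J h = (\<Prod>i'\<in>{..<K} - {i}. mix i' y (J i') (h i'))"

text \<open>The conditional variance of \<open>D\<close> given \<open>y\<close>, \<open>J\<close>
  and \<open>h\<close>. The unsimplified \<open>1 - (1 - ...)\<close> matches
  \<open>r l * (1 - r l)\<close> in \<open>occupied_groups_variance_ge\<close>.\<close>

definition variance :: "nat set \<Rightarrow> (nat \<Rightarrow> nat) \<Rightarrow> (nat \<Rightarrow> event list) \<Rightarrow> real" where
  "variance y J h = (\<Sum>l\<in>y. (1 - (\<Prod>i\<in>{i\<in>{..<K}. J i = l}. 1 - posterior i y (J i) (h i))) *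
     (1 - (1 - (\<Prod>i\<in>{i\<in>{..<K}. J i = l}. 1 - posterior i y (J i) (h i)))))"

text \<open>The counterpart of the inner sum of \<open>advantage\<close> for a fixed assignment: for
  \<open>J\<close> into \<open>U\<close> it is the total variation distance between a miss and a hit
  of \<open>J i\<close> at site \<open>i\<close>.\<close>

definition variation :: "nat \<Rightarrow> nat set \<Rightarrow> (nat \<Rightarrow> nat) \<Rightarrow> real" where
  "variation i y J = (\<Sum>h\<in>H. ind K (h K) (U - y) *
     (max 0 (miss i y (h i) - hit i y (J i) (h i)) * others i y J h))"

definition group_size :: "(nat \<Rightarrow> nat) \<Rightarrow> nat \<Rightarrow> real" where
  "group_size J i = real (card {i'\<in>{..<K}. J i' = J i})"

lemma mix_posterior: "mix i y l t * posterior i y l t = \<beta> * hit i y l t"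
proof (cases "mix i y l t = 0")
  case True
  \<comment> \<open>Division by zero makes the posterior 0. The identity still holds, since a
    vanishing sum of nonnegative parts forces \<open>\<beta> * hit i y l t = 0\<close>.\<close>
  moreover have "0 \<le> (1 - \<beta>) * miss i y t" "0 \<le> \<beta> * hit i y l t"
    using \<beta> miss_nonneg hit_nonneg by auto
  ultimately have "\<beta> * hit i y l t = 0"
    unfolding mix_def by linarith
  then show ?thesis
    using True by simp
qed (simp add: posterior_def)

lemma posterior_nonneg: "0 \<le> posterior i y l t"
  using \<beta> by (simp add: posterior_def hit_nonneg mix_nonneg)

lemma posterior_le_1: "posterior i y l t \<le> 1"
proof -
  have "\<beta> * hit i y l t \<le> mix i y l t"
    using \<beta> miss_nonneg by (simp add: mix_def)
  then show ?thesis
    using mix_nonneg[of i y l t] unfolding posterior_def by (intro divide_le_eq_1[THEN iffD2]) auto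
qed

text \<open>Since \<open>mix - hit = (1 - \<beta>) * (miss - hit)\<close>, the truncated posterior
  falls short of the prior \<open>\<beta>\<close> only where a miss explains \<open>t\<close> better
  than a hit, and by exactly this amount.\<close>

lemma mix_min_posterior:
  "mix i y l t * min (posterior i y l t) \<beta>
    = \<beta> * mix i y l t - \<beta> * (1 - \<beta>) * max 0 (miss i y t - hit i y l t)"
proof -
  have "mix i y l t * min (posterior i y l t) \<beta> = min (mix i y l t * posterior i y l t) (mix i y l t * \<beta>)"
    using mix_nonneg[of i y l t] by (simp add: min_mult_distrib_left)
  also have "\<dots> = mix i y l t * \<beta> - max 0 (\<beta> * (1 - \<beta>) * (miss i y t - hit i y l t))"
    unfolding mix_posterior by (auto simp: mix_def min_def max_def algebra_simps)
  also have "max 0 (\<beta> * (1 - \<beta>) * (miss i y t - hit i y l t)) = \<beta> * (1 - \<beta>) * max 0 (miss i y t - hit i y l t)"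
    using \<beta> by (simp add: max_mult_distrib_left)
  finally show ?thesis by (simp add: mult.commute)
qed

lemma weight_nonneg: "0 \<le> weight y J h"
  by (simp add: weight_def ind_nonneg mix_nonneg prod_nonneg)

lemma weight_split: "i < K \<Longrightarrow> weight y J h = ind K (h K) (U - y) * (mix i y (J i) (h i) * others i y J h)"
  unfolding weight_def others_def by (subst prod.remove[of "{..<K}" i]) auto

lemma sum_weight:
  assumes "J \<in> {..<K} \<rightarrow>\<^sub>E U"
  shows "(\<Sum>h\<in>H. weight y J h) = 1"
  unfolding weight_def using assms by (intro sum_transcripts site_mass_mix) (auto simp: PiE_iff)

lemma sum_weight_posterior:
  assumes "J \<in> {..<K} \<rightarrow>\<^sub>E U" "i < K"
  shows "(\<Sum>h\<in>H. weight y J h * posterior i y (J i) (h i)) = \<beta>"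
proof -
  have "(\<Sum>h\<in>H. weight y J h * posterior i y (J i) (h i))
      = (\<Sum>h\<in>H. \<beta> * (ind K (h K) (U - y) * (hit i y (J i) (h i) * others i y J h)))"
  proof (rule sum.cong[OF refl])
    fix h
    have "weight y J h * posterior i y (J i) (h i)
        = ind K (h K) (U - y) * ((mix i y (J i) (h i) * posterior i y (J i) (h i)) * others i y J h)"
      unfolding weight_split[OF assms(2)] by (simp only: mult_ac)
    then show "weight y J h * posterior i y (J i) (h i)
        = \<beta> * (ind K (h K) (U - y) * (hit i y (J i) (h i) * others i y J h))"
      unfolding mix_posterior by (simp only: mult_ac)
  qed
  also have "\<dots> = \<beta> * (\<Sum>h\<in>H. ind K (h K) (U - y) * (hit i y (J i) (h i) * others i y J h))"
    by (simp only: sum_distrib_left)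
  also have "(\<Sum>h\<in>H. ind K (h K) (U - y) * (hit i y (J i) (h i) * others i y J h)) = 1"
    unfolding others_def using assms
    by (intro sum_transcripts_split site_mass_hit site_mass_mix) (auto simp: PiE_iff)
  finally show ?thesis by simp
qed

lemma sum_weight_min_posterior:
  assumes "J \<in> {..<K} \<rightarrow>\<^sub>E U" "i < K"
  shows "(\<Sum>h\<in>H. weight y J h * min (posterior i y (J i) (h i)) \<beta>) = \<beta> - \<beta> * (1 - \<beta>) * variation i y J"
proof -
  have "(\<Sum>h\<in>H. weight y J h * min (posterior i y (J i) (h i)) \<beta>)
      = (\<Sum>h\<in>H. \<beta> * weight y J h - \<beta> * (1 - \<beta>) * (ind K (h K) (U - y) *
          (max 0 (miss i y (h i) - hit i y (J i) (h i)) * others i y J h)))"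
  proof (rule sum.cong[OF refl])
    fix h
    have "weight y J h * min (posterior i y (J i) (h i)) \<beta>
        = ind K (h K) (U - y) * ((mix i y (J i) (h i) * min (posterior i y (J i) (h i)) \<beta>) * others i y J h)"
      unfolding weight_split[OF assms(2)] by (simp only: mult_ac)
    then show "weight y J h * min (posterior i y (J i) (h i)) \<beta>
        = \<beta> * weight y J h - \<beta> * (1 - \<beta>) * (ind K (h K) (U - y) *
          (max 0 (miss i y (h i) - hit i y (J i) (h i)) * others i y J h))"
      unfolding mix_min_posterior weight_split[OF assms(2)] by (simp add: algebra_simps)
  qed
  also have "\<dots> = \<beta> - \<beta> * (1 - \<beta>) * variation i y J"
    unfolding sum_subtractf sum_distrib_left[symmetric] variation_def sum_weight[OF assms(1)] by simp
  finally show ?thesis .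
qed

text \<open>The factor \<open>3 / 2\<close> collects both corrections of
  \<open>occupied_groups_variance_ge\<close>: a full \<open>\<beta>\<^sup>2\<close> from the term
  with the posterior, whose mean is \<open>\<beta>\<close>, and \<open>\<beta>\<^sup>2 / 2\<close>
  from the other.\<close>

lemma sum_weight_variance_ge:
  assumes "J \<in> {..<K} \<rightarrow>\<^sub>E U" "y \<subseteq> U"
  shows "(\<Sum>i<K. \<beta> * of_bool (J i \<in> y) - \<beta> * (1 - \<beta>) * (of_bool (J i \<in> y) * variation i y J)
      - 3 / 2 * \<beta>\<^sup>2 * group_size J i) \<le> (\<Sum>h\<in>H. weight y J h * variance y J h)"
proof -
  have "(\<Sum>i<K. \<beta> * of_bool (J i \<in> y) - \<beta> * (1 - \<beta>) * (of_bool (J i \<in> y) * variation i y J)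
      - 3 / 2 * \<beta>\<^sup>2 * group_size J i)
    = (\<Sum>i<K. of_bool (J i \<in> y) * (\<Sum>h\<in>H. weight y J h * min (posterior i y (J i) (h i)) \<beta>)
        - \<beta> * group_size J i * (\<Sum>h\<in>H. weight y J h * posterior i y (J i) (h i))
        - \<beta>\<^sup>2 / 2 * group_size J i * (\<Sum>h\<in>H. weight y J h))"
    by (intro sum.cong refl)
      (simp add: sum_weight_min_posterior sum_weight_posterior sum_weight assms power2_eq_square algebra_simps)
  also have "\<dots> = (\<Sum>i<K. \<Sum>h\<in>H. weight y J h * (of_bool (J i \<in> y) * min (posterior i y (J i) (h i)) \<beta>
        - \<beta> * group_size J i * posterior i y (J i) (h i) - \<beta>\<^sup>2 / 2 * group_size J i))"
    unfolding sum_distrib_left sum_subtractf[symmetric]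
    by (intro sum.cong refl) (simp only: right_diff_distrib mult_ac)
  also have "\<dots> = (\<Sum>h\<in>H. \<Sum>i<K. weight y J h * (of_bool (J i \<in> y) * min (posterior i y (J i) (h i)) \<beta>
        - \<beta> * group_size J i * posterior i y (J i) (h i) - \<beta>\<^sup>2 / 2 * group_size J i))"
    by (rule sum.swap)
  also have "\<dots> \<le> (\<Sum>h\<in>H. weight y J h * variance y J h)"
    unfolding sum_distrib_left[symmetric] variance_def group_size_def
    using assms(2) \<beta> finite_subset[OF assms(2)]
    by (intro sum_mono mult_left_mono weight_nonneg occupied_groups_variance_ge posterior_nonneg posterior_le_1) auto
  finally show ?thesis .
qed

text \<open>\<open>J i\<close> is uniform on \<open>U\<close>, and averaging the other, independent
  coordinates turns each \<open>mix\<close> into \<open>avg_mix\<close>. This produces the inner sum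
  of \<open>advantage\<close>.\<close>

lemma avg_variation:
  assumes "i < K" "y \<subseteq> U"
  shows "(\<Sum>J\<in>{..<K} \<rightarrow>\<^sub>E U. of_bool (J i \<in> y) * variation i y J) / real m ^ K
    = (\<Sum>l\<in>y. \<Sum>h\<in>H. ind K (h K) (U - y) * (max 0 (miss i y (h i) - hit i y l (h i)) *
        (\<Prod>i'\<in>{..<K} - {i}. avg_mix i' y (h i')))) / real m"
proof -
  define \<phi> where "\<phi> h l = of_bool (l \<in> y) * max 0 (miss i y (h i) - hit i y l (h i))" for h l
  define c where "c h = ind K (h K) (U - y)" for h
  have "(\<Sum>J\<in>{..<K} \<rightarrow>\<^sub>E U. of_bool (J i \<in> y) * variation i y J) / real m ^ K
      = (\<Sum>J\<in>{..<K} \<rightarrow>\<^sub>E U. \<Sum>h\<in>H. c h * (\<phi> h (J i) * others i y J h) / real m ^ K)"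
    unfolding variation_def sum_distrib_left sum_divide_distrib \<phi>_def c_def by (simp only: mult_ac)
  also have "\<dots> = (\<Sum>h\<in>H. \<Sum>J\<in>{..<K} \<rightarrow>\<^sub>E U. c h * (\<phi> h (J i) * others i y J h) / real m ^ K)"
    by (rule sum.swap)
  also have "\<dots> = (\<Sum>h\<in>H. c h * ((\<Sum>J\<in>{..<K} \<rightarrow>\<^sub>E U. \<phi> h (J i) * others i y J h) / real m ^ K))"
    by (simp add: sum_distrib_left sum_divide_distrib)
  also have "\<dots> = (\<Sum>h\<in>H. c h * ((\<Sum>l\<in>U. \<phi> h l) / real m * (\<Prod>i'\<in>{..<K} - {i}. avg_mix i' y (h i'))))"
  proof (rule sum.cong[OF refl])
    fix h
    have "(\<Sum>J\<in>{..<K} \<rightarrow>\<^sub>E U. \<phi> h (J i) * others i y J h) / real (card U) ^ card {..<K}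
        = (\<Sum>l\<in>U. \<phi> h l) / real (card U) * (\<Prod>i'\<in>{..<K} - {i}. avg_mix i' y (h i'))"
      unfolding others_def avg_mix_def
      using assms(1) by (intro avg_PiE_split[where h = "\<lambda>i' l. mix i' y l (h i')"]) auto
    then show "c h * ((\<Sum>J\<in>{..<K} \<rightarrow>\<^sub>E U. \<phi> h (J i) * others i y J h) / real m ^ K)
        = c h * ((\<Sum>l\<in>U. \<phi> h l) / real m * (\<Prod>i'\<in>{..<K} - {i}. avg_mix i' y (h i')))"
      by simp
  qed
  also have "\<dots> = (\<Sum>h\<in>H. \<Sum>l\<in>y. c h * (max 0 (miss i y (h i) - hit i y l (h i)) *
        (\<Prod>i'\<in>{..<K} - {i}. avg_mix i' y (h i'))) / real m)"
  proof (rule sum.cong[OF refl])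
    fix h
    have "(\<Sum>l\<in>U. \<phi> h l) = (\<Sum>l\<in>y. \<phi> h l)"
      using assms(2) by (intro sum.mono_neutral_right) (auto simp: \<phi>_def)
    also have "\<dots> = (\<Sum>l\<in>y. max 0 (miss i y (h i) - hit i y l (h i)))"
      by (simp add: \<phi>_def)
    finally show "c h * ((\<Sum>l\<in>U. \<phi> h l) / real m * (\<Prod>i'\<in>{..<K} - {i}. avg_mix i' y (h i')))
        = (\<Sum>l\<in>y. c h * (max 0 (miss i y (h i) - hit i y l (h i)) *
        (\<Prod>i'\<in>{..<K} - {i}. avg_mix i' y (h i'))) / real m)"
      by (simp add: sum_distrib_left sum_distrib_right sum_divide_distrib)
  qed
  also have "\<dots> = (\<Sum>l\<in>y. \<Sum>h\<in>H. c h * (max 0 (miss i y (h i) - hit i y l (h i)) *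
        (\<Prod>i'\<in>{..<K} - {i}. avg_mix i' y (h i')))) / real m"
    unfolding sum_divide_distrib by (rule sum.swap)
  finally show ?thesis
    by (simp only: c_def)
qed

text \<open>The gain \<open>\<beta> / 4\<close> per site is \<open>\<beta>\<close> times the
  probability that its assigned element lies in \<open>y\<close>. The losses are what the histories
  reveal about hits, and the collisions of assigned elements.\<close>

lemma expected_variance_ge:
  "(\<Sum>i<K. \<beta> / 4 - \<beta> * (1 - \<beta>) * advantage i / real m) - 3 / 2 * \<beta>\<^sup>2 * (real K + (real K)\<^sup>2 / real m)
    \<le> (\<Sum>y\<in>Pow U. set_weight U y * ((\<Sum>J\<in>{..<K} \<rightarrow>\<^sub>E U. \<Sum>h\<in>H. weight y J h * variance y J h) / real m ^ K))"
proof -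
  let ?J = "{..<K} \<rightarrow>\<^sub>E U"
  define tv where "tv i y = (\<Sum>l\<in>y. \<Sum>h\<in>H. ind K (h K) (U - y) * (max 0 (miss i y (h i) - hit i y l (h i)) *
        (\<Prod>i'\<in>{..<K} - {i}. avg_mix i' y (h i'))))" for i y
  define e where "e = 3 / 2 * \<beta>\<^sup>2 * (real K + (real K)\<^sup>2 / real m)"
  have inner: "(\<Sum>i<K. \<beta> * real (card y) / real m - \<beta> * (1 - \<beta>) * tv i y / real m) - e
      \<le> (\<Sum>J\<in>?J. \<Sum>h\<in>H. weight y J h * variance y J h) / real m ^ K" if y: "y \<subseteq> U" for y
  proof -
    have a: "(\<Sum>J\<in>?J. of_bool (J i \<in> y)) / real m ^ K = real (card y) / real m" if "i < K" for i
    proof -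
      have "(\<Sum>l\<in>U. of_bool (l \<in> y)) = real (card y)"
        using y by (simp add: Int_absorb1)
      then show ?thesis
        using avg_PiE_component[of "{..<K}" U i "\<lambda>l. of_bool (l \<in> y)"] that m_pos by simp
    qed
    have c: "(\<Sum>J\<in>?J. \<Sum>i<K. group_size J i) / real m ^ K \<le> real K + (real K)\<^sup>2 / real m"
      using avg_PiE_sum_group_size[of "{..<K}" U] m_pos by (simp add: group_size_def)
    have "(\<Sum>i<K. \<beta> * real (card y) / real m - \<beta> * (1 - \<beta>) * tv i y / real m) - e
      \<le> (\<Sum>i<K. \<beta> * real (card y) / real m - \<beta> * (1 - \<beta>) * tv i y / real m)
        - 3 / 2 * \<beta>\<^sup>2 * ((\<Sum>J\<in>?J. \<Sum>i<K. group_size J i) / real m ^ K)"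
      unfolding e_def by (intro diff_left_mono mult_left_mono c) auto
    also have "\<dots> = (\<Sum>i<K. \<beta> * ((\<Sum>J\<in>?J. of_bool (J i \<in> y)) / real m ^ K)
          - \<beta> * (1 - \<beta>) * ((\<Sum>J\<in>?J. of_bool (J i \<in> y) * variation i y J) / real m ^ K))
        - 3 / 2 * \<beta>\<^sup>2 * ((\<Sum>J\<in>?J. \<Sum>i<K. group_size J i) / real m ^ K)"
      unfolding tv_def by (intro arg_cong2[where f = "(-)"] refl sum.cong) (simp_all add: a avg_variation[OF _ y])
    also have "\<dots> = (\<Sum>J\<in>?J. \<Sum>i<K. \<beta> * of_bool (J i \<in> y)
        - \<beta> * (1 - \<beta>) * (of_bool (J i \<in> y) * variation i y J) - 3 / 2 * \<beta>\<^sup>2 * group_size J i) / real m ^ K"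
    proof -
      have swap: "(\<Sum>i<K. c * ((\<Sum>J\<in>?J. \<psi> i J) / real m ^ K)) = c * (\<Sum>J\<in>?J. \<Sum>i<K. \<psi> i J) / real m ^ K" for c \<psi>
        unfolding sum_distrib_left sum_divide_distrib by (subst sum.swap) simp
      show ?thesis
        unfolding sum_subtractf swap by (simp only: sum_distrib_left diff_divide_distrib times_divide_eq_right)
    qed
    also have "\<dots> \<le> (\<Sum>J\<in>?J. \<Sum>h\<in>H. weight y J h * variance y J h) / real m ^ K"
      using y by (intro divide_right_mono sum_mono sum_weight_variance_ge) auto
    finally show ?thesis .
  qed
  have "(\<Sum>i<K. \<beta> / 4 - \<beta> * (1 - \<beta>) * advantage i / real m) - e
      = (\<Sum>y\<in>Pow U. set_weight U y * ((\<Sum>i<K. \<beta> * real (card y) / real m - \<beta> * (1 - \<beta>) * tv i y / real m) - e))"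
  proof -
    have one: "(\<Sum>y\<in>Pow U. set_weight U y * e) = e"
      by (simp add: sum_set_weight flip: sum_distrib_right)
    have "\<beta> / 4 - \<beta> * (1 - \<beta>) * advantage i / real m
        = (\<Sum>y\<in>Pow U. set_weight U y * (\<beta> * real (card y) / real m - \<beta> * (1 - \<beta>) * tv i y / real m))" for i
    proof -
      have "(\<Sum>y\<in>Pow U. set_weight U y * (\<beta> * real (card y) / real m - \<beta> * (1 - \<beta>) * tv i y / real m))
        = \<beta> / real m * (\<Sum>y\<in>Pow U. set_weight U y * real (card y))
          - \<beta> * (1 - \<beta>) / real m * (\<Sum>y\<in>Pow U. set_weight U y * tv i y)"
      proof -
        have *: "w * (a * c / M - B * t / M) = a / M * (w * c) - B / M * (w * t)" for a w c t M B :: real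
          by (simp add: right_diff_distrib mult_ac)
        show ?thesis
          unfolding sum_distrib_left sum_subtractf[symmetric] by (intro sum.cong refl *)
      qed
      also have "(\<Sum>y\<in>Pow U. set_weight U y * real (card y)) = real m / 4"
        by (simp add: sum_set_weight_card)
      also have "(\<Sum>y\<in>Pow U. set_weight U y * tv i y) = advantage i"
        by (simp add: advantage_def tv_def)
      finally show ?thesis
        using m_pos by simp
    qed
    then show ?thesis
      unfolding right_diff_distrib[of _ "sum _ _"] sum_subtractf[of _ "\<lambda>y. set_weight U y * e"] one sum_distrib_left
      by (subst sum.swap) simp
  qed
  also have "\<dots> \<le> (\<Sum>y\<in>Pow U. set_weight U y * ((\<Sum>J\<in>?J. \<Sum>h\<in>H. weight y J h * variance y J h) / real m ^ K))"
    using inner by (intro sum_mono mult_left_mono less_imp_le[OF set_weight_pos]) auto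
  finally show ?thesis
    by (simp add: e_def)
qed

end

section \<open>Explicit hard inputs, Bayes' rule and the error\<close>

definition hard_input :: "nat \<Rightarrow> nat \<Rightarrow> nat set \<Rightarrow> (nat \<Rightarrow> nat) \<Rightarrow> nat set \<Rightarrow> (nat \<Rightarrow> nat set) \<Rightarrow> nat \<Rightarrow> nat set" where
  "hard_input K m y J Z X =
    (\<lambda>i\<in>{..<Suc K}. if i = K then {1..m} - y else if i \<in> Z then insert (J i) (X i) else X i)"

text \<open>\<open>Z\<close> is the set of sites that make a hit. Keeping the distribution as a
  finite weighted sum means that linearity suffices to exchange it with the coins of a randomized
  protocol.\<close>

definition hard_expectation :: "nat \<Rightarrow> nat \<Rightarrow> real \<Rightarrow> ((nat \<Rightarrow> nat set) \<Rightarrow> real) \<Rightarrow> real" where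
  "hard_expectation K m \<beta> \<phi> = (\<Sum>y\<in>Pow {1..m}. set_weight {1..m} y *
    ((\<Sum>J\<in>{..<K} \<rightarrow>\<^sub>E {1..m}. \<Sum>Z\<in>Pow {..<K}. \<Sum>X\<in>{..<K} \<rightarrow>\<^sub>E Pow ({1..m} - y).
      (\<Prod>i\<in>Z. \<beta>) * (\<Prod>i\<in>{..<K} - Z. 1 - \<beta>) * (\<Prod>i<K. cond_weight {1..m} y (X i)) *
      \<phi> (hard_input K m y J Z X)) / real m ^ K))"

lemma hard_input_in_inputs:
  assumes "J \<in> {..<K} \<rightarrow>\<^sub>E {1..m}" "X \<in> {..<K} \<rightarrow>\<^sub>E Pow ({1..m} - y)"
  shows "hard_input K m y J Z X \<in> inputs (Suc K) m"
  using assms by (fastforce simp: hard_input_def inputs_def PiE_iff less_Suc_eq)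

lemma F0_hard_input:
  assumes "y \<subseteq> {1..m}" "J \<in> {..<K} \<rightarrow>\<^sub>E {1..m}" "Z \<subseteq> {..<K}" "X \<in> {..<K} \<rightarrow>\<^sub>E Pow ({1..m} - y)"
  shows "F0 (Suc K) (hard_input K m y J Z X) = card ({1..m} - y) + card {l\<in>y. \<exists>i\<in>Z. J i = l}"
proof -
  have X: "X i \<subseteq> {1..m} - y" "J i \<in> {1..m}" if "i < K" for i
    using assms(2,4) that by (auto simp: PiE_iff)
  have "(\<Union>i<Suc K. hard_input K m y J Z X i) = ({1..m} - y) \<union> (\<Union>i<K. hard_input K m y J Z X i)"
    by (auto simp: lessThan_Suc hard_input_def)
  also have "(\<Union>i<K. hard_input K m y J Z X i) = (\<Union>i<K. X i) \<union> (\<Union>i\<in>Z. {J i})"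
    using assms(3) by (fastforce simp: hard_input_def split: if_splits)
  also have "({1..m} - y) \<union> ((\<Union>i<K. X i) \<union> (\<Union>i\<in>Z. {J i})) = ({1..m} - y) \<union> {l\<in>y. \<exists>i\<in>Z. J i = l}"
    using X assms(3) by blast
  finally have "F0 (Suc K) (hard_input K m y J Z X) = card (({1..m} - y) \<union> {l\<in>y. \<exists>i\<in>Z. J i = l})"
    by (simp only: F0_def)
  also have "\<dots> = card ({1..m} - y) + card {l\<in>y. \<exists>i\<in>Z. J i = l}"
    using finite_subset[OF assms(1)] by (intro card_Un_disjoint) auto
  finally show ?thesis .
qed

lemma hard_expectation_mono:
  assumes "0 \<le> \<beta>" "\<beta> \<le> 1" "\<And>A. A \<in> inputs (Suc K) m \<Longrightarrow> \<phi> A \<le> \<psi> A"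
  shows "hard_expectation K m \<beta> \<phi> \<le> hard_expectation K m \<beta> \<psi>"
  unfolding hard_expectation_def using assms
  by (intro sum_mono mult_left_mono divide_right_mono less_imp_le[OF set_weight_pos] mult_nonneg_nonneg
      prod_nonneg ballI cond_weight_nonneg hard_input_in_inputs assms(3)) auto

lemma hard_expectation_const:
  assumes "0 < m"
  shows "hard_expectation K m \<beta> (\<lambda>_. c) = c"
proof -
  let ?U = "{1..m}"
  have X: "(\<Sum>X\<in>{..<K} \<rightarrow>\<^sub>E Pow (?U - y). \<Prod>i<K. cond_weight ?U y (X i)) = 1" for y
  proof -
    have "(\<Prod>i<K. \<Sum>x\<in>Pow (?U - y). cond_weight ?U y x)
        = (\<Sum>X\<in>{..<K} \<rightarrow>\<^sub>E Pow (?U - y). \<Prod>i<K. cond_weight ?U y (X i))"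
      by (rule prod_sum_PiE) auto
    then show ?thesis
      by (simp add: sum_cond_weight)
  qed
  have Z: "(\<Sum>Z\<in>Pow {..<K}. (\<Prod>i\<in>Z. \<beta>) * (\<Prod>i\<in>{..<K} - Z. 1 - \<beta>)) = 1"
    using prod_add[of "{..<K}" "\<lambda>_. \<beta>" "\<lambda>_. 1 - \<beta>"] by simp
  have "(\<Sum>Z\<in>Pow {..<K}. \<Sum>X\<in>{..<K} \<rightarrow>\<^sub>E Pow (?U - y).
      (\<Prod>i\<in>Z. \<beta>) * (\<Prod>i\<in>{..<K} - Z. 1 - \<beta>) * (\<Prod>i<K. cond_weight ?U y (X i)) * c) = c" for y
    unfolding sum_distrib_right[symmetric] sum_distrib_left[symmetric] X mult_1_right Z by simp
  hence "hard_expectation K m \<beta> (\<lambda>_. c) = (\<Sum>y\<in>Pow ?U. set_weight ?U y * ((\<Sum>J\<in>{..<K} \<rightarrow>\<^sub>E ?U. c) / real m ^ K))"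
    unfolding hard_expectation_def by simp
  also have "(\<Sum>J\<in>{..<K} \<rightarrow>\<^sub>E ?U. c) / real m ^ K = c"
    using assms by (simp add: card_PiE)
  also have "(\<Sum>y\<in>Pow ?U. set_weight ?U y * c) = c"
    by (simp add: sum_set_weight flip: sum_distrib_right)
  finally show ?thesis .
qed

lemma expectation_hard_expectation:
  assumes "\<And>\<pi> A. \<bar>\<phi> \<pi> A\<bar> \<le> 1"
  shows "measure_pmf.expectation P (\<lambda>\<pi>. hard_expectation K m \<beta> (\<phi> \<pi>))
    = hard_expectation K m \<beta> (\<lambda>A. measure_pmf.expectation P (\<lambda>\<pi>. \<phi> \<pi> A))"
proof -
  have "integrable (measure_pmf P) (\<lambda>\<pi>. \<phi> \<pi> A)" for A
    by (rule measure_pmf.integrable_const_bound[of _ 1]) (use assms in auto)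
  then show ?thesis
    unfolding hard_expectation_def by simp
qed

lemma abs_hard_expectation_le_1:
  assumes "0 \<le> \<beta>" "\<beta> \<le> 1" "0 < m" "\<And>A. \<bar>\<phi> A\<bar> \<le> 1"
  shows "\<bar>hard_expectation K m \<beta> \<phi>\<bar> \<le> 1"
proof -
  have \<phi>: "- 1 \<le> \<phi> A" "\<phi> A \<le> 1" for A
    using assms(4)[of A] by auto
  have "hard_expectation K m \<beta> \<phi> \<le> hard_expectation K m \<beta> (\<lambda>_. 1)"
    "hard_expectation K m \<beta> (\<lambda>_. - 1) \<le> hard_expectation K m \<beta> \<phi>"
    using assms(1,2) \<phi> by (auto intro!: hard_expectation_mono)
  then show ?thesis
    by (simp add: hard_expectation_const[OF assms(3)] abs_le_iff)
qed

context hard_distribution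
begin

lemma sum_inputs_consistent:
  assumes "Z \<subseteq> {..<K}"
  shows "(\<Sum>X\<in>{..<K} \<rightarrow>\<^sub>E Pow (U - y). (\<Prod>i<K. cond_weight U y (X i)) *
      (\<Prod>i<Suc K. ind i (h i) (hard_input K m y J Z X i)))
    = ind K (h K) (U - y) * ((\<Prod>i\<in>Z. hit i y (J i) (h i)) * (\<Prod>i\<in>{..<K} - Z. miss i y (h i)))"
proof -
  define g where "g i x = cond_weight U y x * ind i (h i) (if i \<in> Z then insert (J i) x else x)" for i x
  have "(\<Prod>i<K. cond_weight U y (X i)) * (\<Prod>i<Suc K. ind i (h i) (hard_input K m y J Z X i))
      = ind K (h K) (U - y) * (\<Prod>i<K. g i (X i))" for X
    by (simp add: g_def hard_input_def prod.distrib mult_ac)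
  hence "(\<Sum>X\<in>{..<K} \<rightarrow>\<^sub>E Pow (U - y). (\<Prod>i<K. cond_weight U y (X i)) *
      (\<Prod>i<Suc K. ind i (h i) (hard_input K m y J Z X i)))
    = ind K (h K) (U - y) * (\<Sum>X\<in>{..<K} \<rightarrow>\<^sub>E Pow (U - y). \<Prod>i<K. g i (X i))"
    by (simp add: sum_distrib_left)
  also have "(\<Sum>X\<in>{..<K} \<rightarrow>\<^sub>E Pow (U - y). \<Prod>i<K. g i (X i)) = (\<Prod>i<K. \<Sum>x\<in>Pow (U - y). g i x)"
    by (rule prod_sum_PiE[symmetric]) auto
  also have "\<dots> = (\<Prod>i\<in>{..<K} - Z. \<Sum>x\<in>Pow (U - y). g i x) * (\<Prod>i\<in>Z. \<Sum>x\<in>Pow (U - y). g i x)"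
    using assms by (intro prod.subset_diff) auto
  also have "\<dots> = (\<Prod>i\<in>{..<K} - Z. miss i y (h i)) * (\<Prod>i\<in>Z. hit i y (J i) (h i))"
    by (intro arg_cong2[where f = "(*)"] prod.cong) (auto simp: g_def miss_def hit_def)
  finally show ?thesis
    by (simp add: mult.commute)
qed

text \<open>Bayes' rule: the prior of \<open>Z\<close> times the likelihood of \<open>h\<close>
  equals the total likelihood \<open>weight y J h\<close> times a product over sites. So given
  \<open>y\<close>, \<open>J\<close> and \<open>h\<close> the hits are independent, with the
  posteriors as probabilities.\<close>

lemma prod_posterior:
  assumes "Z \<subseteq> {..<K}"
  shows "(\<Prod>i\<in>Z. \<beta>) * (\<Prod>i\<in>{..<K} - Z. 1 - \<beta>) *
      (ind K (h K) (U - y) * ((\<Prod>i\<in>Z. hit i y (J i) (h i)) * (\<Prod>i\<in>{..<K} - Z. miss i y (h i))))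
    = weight y J h * ((\<Prod>i\<in>Z. posterior i y (J i) (h i)) * (\<Prod>i\<in>{..<K} - Z. 1 - posterior i y (J i) (h i)))"
proof -
  have "(\<Prod>i\<in>Z. \<beta>) * (\<Prod>i\<in>Z. hit i y (J i) (h i))
      = (\<Prod>i\<in>Z. mix i y (J i) (h i)) * (\<Prod>i\<in>Z. posterior i y (J i) (h i))"
    by (simp only: mix_posterior prod.distrib[symmetric])
  moreover have "(\<Prod>i\<in>{..<K} - Z. 1 - \<beta>) * (\<Prod>i\<in>{..<K} - Z. miss i y (h i))
      = (\<Prod>i\<in>{..<K} - Z. mix i y (J i) (h i)) * (\<Prod>i\<in>{..<K} - Z. 1 - posterior i y (J i) (h i))"
    unfolding prod.distrib[symmetric]
    by (intro prod.cong refl) (simp add: right_diff_distrib mix_posterior, simp add: mix_def algebra_simps)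
  moreover have "(\<Prod>i<K. mix i y (J i) (h i)) = (\<Prod>i\<in>{..<K} - Z. mix i y (J i) (h i)) * (\<Prod>i\<in>Z. mix i y (J i) (h i))"
    using assms by (intro prod.subset_diff) auto
  ultimately show ?thesis
    unfolding weight_def by algebra
qed

text \<open>The output \<open>v h\<close> is a function of the transcript, so given \<open>y\<close>
  and \<open>h\<close> a correct answer confines \<open>D\<close> to a fixed window. The chance that
  \<open>D\<close> leaves it is bounded by \<open>occupied_groups_anticoncentration\<close>, term by
  term in \<open>y\<close>, \<open>J\<close> and \<open>h\<close>.\<close>

lemma error_ge:
  assumes "0 \<le> \<epsilon>"
  shows "(\<Sum>y\<in>Pow U. set_weight U y * ((\<Sum>J\<in>{..<K} \<rightarrow>\<^sub>E U. \<Sum>h\<in>H. weight y J h * variance y J h) / real m ^ K))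
      / (16 * real m) - \<epsilon>\<^sup>2 * real m / 4
    \<le> hard_expectation K m \<beta> (\<lambda>A. \<Sum>h\<in>H. (\<Prod>i<Suc K. ind i (h i) (A i)) *
        of_bool (\<not> is_approx \<epsilon> (real (F0 (Suc K) A)) (v h)))"
proof -
  let ?J = "{..<K} \<rightarrow>\<^sub>E U"
  define err where "err y J Z h = (of_bool (\<not> is_approx \<epsilon> (real (card (U - y) + card {l\<in>y. \<exists>i\<in>Z. J i = l})) (v h)) :: real)"
    for y Z h and J :: "nat \<Rightarrow> nat"
  define P where "P y J Z h = (\<Prod>i\<in>Z. posterior i y (J i) (h i)) * (\<Prod>i\<in>{..<K} - Z. 1 - posterior i y (J i) (h i))"
    for y J Z h
  have window: "variance y J h / (16 * real m) - \<epsilon>\<^sup>2 * real m / 4 \<le> (\<Sum>Z\<in>Pow {..<K}. P y J Z h * err y J Z h)"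
    if y: "y \<subseteq> U" for y J h
  proof -
    define W where "W = \<epsilon> * real m"
    \<comment> \<open>A correct output satisfies
      \<open>F0 \<le> v h \<le> F0 + \<epsilon> * m\<close>, because \<open>F0 \<le> m\<close>.
      Solving for \<open>D\<close> gives the window from \<open>a\<close> to
      \<open>a + W\<close>.\<close>
    define a where "a = v h - real (card (U - y)) - W"
    have fin: "finite y"
      using y finite_subset by blast
    have card_y: "card (U - y) + card y = m" "card y \<le> m"
      using y fin card_mono[OF _ y] by (auto simp: card_Diff_subset)
    have "variance y J h / (16 * real m) - W\<^sup>2 / (4 * real m)
        \<le> (\<Sum>Z\<in>Pow {..<K}. P y J Z h * of_bool (real (card {l\<in>y. \<exists>i\<in>Z. J i = l}) < a \<or>
            a + W < real (card {l\<in>y. \<exists>i\<in>Z. J i = l})))"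
      unfolding variance_def P_def using m_pos assms fin card_y(2)
      by (intro occupied_groups_anticoncentration posterior_nonneg posterior_le_1) (auto simp: W_def)
    also have "\<dots> \<le> (\<Sum>Z\<in>Pow {..<K}. P y J Z h * err y J Z h)"
    proof (intro sum_mono mult_left_mono)
      fix Z
      define D where "D = card {l\<in>y. \<exists>i\<in>Z. J i = l}"
      have "D \<le> card y"
        unfolding D_def using fin by (intro card_mono) auto
      hence "card (U - y) + D \<le> m"
        using card_y by simp
      hence "real (card (U - y) + D) \<le> real m"
        by (simp only: of_nat_le_iff)
      hence "\<epsilon> * real (card (U - y) + D) \<le> W"
        unfolding W_def using assms by (intro mult_left_mono)
      hence "is_approx \<epsilon> (real (card (U - y) + D)) (v h) \<Longrightarrow> a \<le> real D \<and> real D \<le> a + W"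
        unfolding is_approx_def a_def by (simp add: algebra_simps)
      then show "of_bool (real (card {l\<in>y. \<exists>i\<in>Z. J i = l}) < a \<or> a + W < real (card {l\<in>y. \<exists>i\<in>Z. J i = l})) \<le> err y J Z h"
        unfolding err_def D_def[symmetric] by (auto simp: of_bool_def)
      show "0 \<le> P y J Z h"
        unfolding P_def using posterior_nonneg posterior_le_1
        by (intro mult_nonneg_nonneg prod_nonneg) auto
    qed
    also have "W\<^sup>2 / (4 * real m) = \<epsilon>\<^sup>2 * real m / 4"
      using m_pos by (simp add: W_def power2_eq_square)
    finally show ?thesis .
  qed
  have inner: "(\<Sum>Z\<in>Pow {..<K}. \<Sum>X\<in>{..<K} \<rightarrow>\<^sub>E Pow (U - y).
      (\<Prod>i\<in>Z. \<beta>) * (\<Prod>i\<in>{..<K} - Z. 1 - \<beta>) * (\<Prod>i<K. cond_weight U y (X i)) *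
      (\<Sum>h\<in>H. (\<Prod>i<Suc K. ind i (h i) (hard_input K m y J Z X i)) *
        of_bool (\<not> is_approx \<epsilon> (real (F0 (Suc K) (hard_input K m y J Z X))) (v h))))
    = (\<Sum>h\<in>H. weight y J h * (\<Sum>Z\<in>Pow {..<K}. P y J Z h * err y J Z h))"
    if y: "y \<subseteq> U" and J: "J \<in> ?J" for y J
  proof -
    have "(\<Sum>X\<in>{..<K} \<rightarrow>\<^sub>E Pow (U - y).
      (\<Prod>i\<in>Z. \<beta>) * (\<Prod>i\<in>{..<K} - Z. 1 - \<beta>) * (\<Prod>i<K. cond_weight U y (X i)) *
      (\<Sum>h\<in>H. (\<Prod>i<Suc K. ind i (h i) (hard_input K m y J Z X i)) *
        of_bool (\<not> is_approx \<epsilon> (real (F0 (Suc K) (hard_input K m y J Z X))) (v h))))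
      = (\<Sum>h\<in>H. weight y J h * (P y J Z h * err y J Z h))" if Z: "Z \<in> Pow {..<K}" for Z
    proof -
      define b where "b = (\<Prod>i\<in>Z. \<beta>) * (\<Prod>i\<in>{..<K} - Z. 1 - \<beta>)"
      have "(\<Sum>X\<in>{..<K} \<rightarrow>\<^sub>E Pow (U - y). b * (\<Prod>i<K. cond_weight U y (X i)) *
          (\<Sum>h\<in>H. (\<Prod>i<Suc K. ind i (h i) (hard_input K m y J Z X i)) *
            of_bool (\<not> is_approx \<epsilon> (real (F0 (Suc K) (hard_input K m y J Z X))) (v h))))
        = (\<Sum>X\<in>{..<K} \<rightarrow>\<^sub>E Pow (U - y). \<Sum>h\<in>H. b * ((\<Prod>i<K. cond_weight U y (X i)) *
            (\<Prod>i<Suc K. ind i (h i) (hard_input K m y J Z X i))) * err y J Z h)"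
      proof (rule sum.cong[OF refl])
        fix X assume X: "X \<in> {..<K} \<rightarrow>\<^sub>E Pow (U - y)"
        have "F0 (Suc K) (hard_input K m y J Z X) = card (U - y) + card {l\<in>y. \<exists>i\<in>Z. J i = l}"
          using y J Z X by (intro F0_hard_input) auto
        then show "b * (\<Prod>i<K. cond_weight U y (X i)) *
          (\<Sum>h\<in>H. (\<Prod>i<Suc K. ind i (h i) (hard_input K m y J Z X i)) *
            of_bool (\<not> is_approx \<epsilon> (real (F0 (Suc K) (hard_input K m y J Z X))) (v h)))
        = (\<Sum>h\<in>H. b * ((\<Prod>i<K. cond_weight U y (X i)) *
            (\<Prod>i<Suc K. ind i (h i) (hard_input K m y J Z X i))) * err y J Z h)"
          by (simp only: err_def sum_distrib_left mult.assoc)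
      qed
      also have "\<dots> = (\<Sum>h\<in>H. \<Sum>X\<in>{..<K} \<rightarrow>\<^sub>E Pow (U - y). b * ((\<Prod>i<K. cond_weight U y (X i)) *
            (\<Prod>i<Suc K. ind i (h i) (hard_input K m y J Z X i))) * err y J Z h)"
        by (rule sum.swap)
      also have "\<dots> = (\<Sum>h\<in>H. b * (ind K (h K) (U - y) * ((\<Prod>i\<in>Z. hit i y (J i) (h i)) *
          (\<Prod>i\<in>{..<K} - Z. miss i y (h i)))) * err y J Z h)"
        unfolding sum_distrib_right[symmetric] sum_distrib_left[symmetric]
        using Z by (simp only: sum_inputs_consistent Pow_iff)
      also have "\<dots> = (\<Sum>h\<in>H. weight y J h * (P y J Z h * err y J Z h))"
        unfolding b_def P_def using Z by (simp only: prod_posterior Pow_iff mult.assoc[of "weight _ _ _"])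
      finally show ?thesis
        unfolding b_def .
    qed
    hence "(\<Sum>Z\<in>Pow {..<K}. \<Sum>X\<in>{..<K} \<rightarrow>\<^sub>E Pow (U - y).
      (\<Prod>i\<in>Z. \<beta>) * (\<Prod>i\<in>{..<K} - Z. 1 - \<beta>) * (\<Prod>i<K. cond_weight U y (X i)) *
      (\<Sum>h\<in>H. (\<Prod>i<Suc K. ind i (h i) (hard_input K m y J Z X i)) *
        of_bool (\<not> is_approx \<epsilon> (real (F0 (Suc K) (hard_input K m y J Z X))) (v h))))
      = (\<Sum>Z\<in>Pow {..<K}. \<Sum>h\<in>H. weight y J h * (P y J Z h * err y J Z h))"
      by (rule sum.cong[OF refl])
    also have "\<dots> = (\<Sum>h\<in>H. weight y J h * (\<Sum>Z\<in>Pow {..<K}. P y J Z h * err y J Z h))"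
      unfolding sum_distrib_left by (rule sum.swap)
    finally show ?thesis .
  qed
  define c where "c = \<epsilon>\<^sup>2 * real m / 4"
  define V where "V y = (\<Sum>J\<in>?J. \<Sum>h\<in>H. weight y J h * variance y J h) / real m ^ K" for y
  have "(\<Sum>y\<in>Pow U. set_weight U y * V y) / (16 * real m) - c
      = (\<Sum>y\<in>Pow U. set_weight U y * (V y / (16 * real m) - c))"
    by (simp add: right_diff_distrib sum_subtractf sum_set_weight sum_divide_distrib flip: sum_distrib_right)
  also have "\<dots> \<le> (\<Sum>y\<in>Pow U. set_weight U y * ((\<Sum>J\<in>?J. \<Sum>h\<in>H. weight y J h *
      (\<Sum>Z\<in>Pow {..<K}. P y J Z h * err y J Z h)) / real m ^ K))"
  proof (intro sum_mono mult_left_mono less_imp_le[OF set_weight_pos])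
    fix y assume y: "y \<in> Pow U"
    have "(\<Sum>J\<in>?J. \<Sum>h\<in>H. weight y J h * c) = real m ^ K * c"
      by (simp add: sum_weight card_PiE flip: sum_distrib_right)
    hence "V y / (16 * real m) - c = (\<Sum>J\<in>?J. \<Sum>h\<in>H. weight y J h * (variance y J h / (16 * real m) - c)) / real m ^ K"
      using m_pos unfolding V_def right_diff_distrib sum_subtractf
      by (simp add: diff_divide_distrib sum_divide_distrib mult_ac)
    also have "\<dots> \<le> (\<Sum>J\<in>?J. \<Sum>h\<in>H. weight y J h * (\<Sum>Z\<in>Pow {..<K}. P y J Z h * err y J Z h)) / real m ^ K"
      unfolding c_def using y by (intro divide_right_mono sum_mono mult_left_mono window weight_nonneg) auto
    finally show "V y / (16 * real m) - c
        \<le> (\<Sum>J\<in>?J. \<Sum>h\<in>H. weight y J h * (\<Sum>Z\<in>Pow {..<K}. P y J Z h * err y J Z h)) / real m ^ K" .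
  qed auto
  also have "\<dots> = hard_expectation K m \<beta> (\<lambda>A. \<Sum>h\<in>H. (\<Prod>i<Suc K. ind i (h i) (A i)) *
        of_bool (\<not> is_approx \<epsilon> (real (F0 (Suc K) A)) (v h)))"
    unfolding hard_expectation_def
    by (intro sum.cong refl arg_cong2[where f = "(*)"] arg_cong2[where f = "(/)"]) (simp only: inner Pow_iff)
  finally show ?thesis
    unfolding V_def c_def .
qed

end

subsection \<open>The lower bound\<close>

text \<open>The budget in units of \<open>m / 768\<close>: the gain
  \<open>K * \<beta> / 4 = m / 192\<close> is four units. The additive loss of the disjointness
  bound, the term for its length and constant parts, and the collisions take one unit each, leaving
  one. The number 48 in \<open>\<beta>\<close> is chosen so that collisions take at most a quarter
  of the gain when \<open>m \<le> K\<close>. Finally \<open>12288 = 16 * 768\<close>, with 16 from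
  the anticoncentration bound.\<close>

lemma protocol_error_ge:
  assumes contacted: "contacted (coord \<pi>) \<subseteq> {..<Suc K}"
    and bits: "\<And>A. A \<in> inputs (Suc K) m \<Longrightarrow> bits_exchanged \<pi> A \<le> b"
    and m: "10752 \<le> m" "m \<le> K" and b: "10752 * real b \<le> real K * real m" and \<epsilon>: "0 \<le> \<epsilon>"
  shows "1 / 12288 - \<epsilon>\<^sup>2 * real m / 4 \<le> hard_expectation K m (real m / (48 * real K))
    (\<lambda>A. of_bool (\<not> is_approx \<epsilon> (real (F0 (Suc K) A)) (protocol_output \<pi> A)))"
proof -
  define tr where "tr A = transcript (site \<pi>) A (coord \<pi>) (\<lambda>_. [])" for A
  define H where "H = tr ` inputs (Suc K) m"
  define \<beta> where "\<beta> = real m / (48 * real K)"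
  note tr = transcripts_of_protocol(1)[OF contacted, of m, folded tr_def, folded H_def]
    transcripts_of_protocol(2,3)[OF contacted, folded tr_def]
  have pos: "0 < real K" "0 < real m"
    using m by auto
  have \<beta>: "0 \<le> \<beta>" "\<beta> \<le> 1"
    using m pos by (auto simp: \<beta>_def field_simps)
  interpret transcripts "Suc K" m H "\<lambda>i. consistent (site \<pi> i)"
    by (rule tr(1))
  interpret hard_distribution K m H "\<lambda>i. consistent (site \<pi> i)" \<beta>
    using \<beta> pos by unfold_locales auto
  \<comment> \<open>Any input with transcript \<open>h\<close> may be used here: the transcript
    determines the output.\<close>
  define v where "v h = protocol_output \<pi> (inv_into (inputs (Suc K) m) tr h)" for h
  have error_eq: "(\<Sum>h\<in>H. (\<Prod>i<Suc K. ind i (h i) (A i)) * of_bool (\<not> is_approx \<epsilon> (real (F0 (Suc K) A)) (v h)))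
      = of_bool (\<not> is_approx \<epsilon> (real (F0 (Suc K) A)) (protocol_output \<pi> A))" if A: "A \<in> inputs (Suc K) m" for A
  proof -
    define h where "h = (THE h. h \<in> H \<and> (\<forall>i<Suc K. consistent (site \<pi> i) (h i) (A i)))"
    have h: "h \<in> H" "\<forall>i<Suc K. consistent (site \<pi> i) (h i) (A i)"
      using theI'[OF unique[OF A]] by (auto simp: h_def)
    have "h = tr (inv_into (inputs (Suc K) m) tr h)"
      using h(1) by (simp add: H_def f_inv_into_f)
    hence "v h = protocol_output \<pi> A"
      using tr(2)[OF A _ h(2)] by (simp add: v_def)
    then show ?thesis
      unfolding sum_prod_ind[OF A] by (simp flip: h_def)
  qed
  have len: "(\<Sum>i<Suc K. length (h i)) \<le> b" if "h \<in> H" for h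
    using that bits tr(3) by (auto simp: H_def)
  define EV where "EV = (\<Sum>y\<in>Pow {1..m}. set_weight {1..m} y *
    ((\<Sum>J\<in>{..<K} \<rightarrow>\<^sub>E {1..m}. \<Sum>h\<in>H. weight y J h * variance y J h) / real m ^ K))"
  have "real m / 768 \<le> EV"
  proof -
    have *: "\<beta> * (1 - \<beta>) * advantage i / real m
        \<le> \<beta> / 16 + 336 * \<beta> / real m * ((1 - \<beta>) * expected_length i + 1)" if "i < K" for i
    proof -
      have "\<beta> * ((1 - \<beta>) * advantage i) \<le> \<beta> * ((1 - \<beta>) * (real m / 16 + 336 * (expected_length i + 1)))"
        using advantage_le[OF that] \<beta> by (intro mult_left_mono) auto
      also have "(1 - \<beta>) * (real m / 16 + 336 * (expected_length i + 1))
          = (1 - \<beta>) * (real m / 16 + 336) + 336 * ((1 - \<beta>) * expected_length i)"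
        by (simp add: algebra_simps)
      also have "(1 - \<beta>) * (real m / 16 + 336) \<le> 1 * (real m / 16 + 336)"
        using \<beta> by (intro mult_right_mono) auto
      finally have "\<beta> * ((1 - \<beta>) * advantage i)
          \<le> \<beta> * (real m / 16 + 336 + 336 * ((1 - \<beta>) * expected_length i))"
        using \<beta> by (simp add: mult_left_mono)
      hence "\<beta> * ((1 - \<beta>) * advantage i) / real m
          \<le> \<beta> * (real m / 16 + 336 + 336 * ((1 - \<beta>) * expected_length i)) / real m"
        by (rule divide_right_mono) simp
      also have "\<dots> = \<beta> / 16 + 336 * \<beta> / real m * ((1 - \<beta>) * expected_length i + 1)"
        using pos by (simp add: field_simps)
      finally show ?thesis by (simp add: mult.assoc)
    qed
    have "(\<Sum>i<K. \<beta> * (1 - \<beta>) * advantage i / real m)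
        \<le> (\<Sum>i<K. \<beta> / 16 + 336 * \<beta> / real m * ((1 - \<beta>) * expected_length i + 1))"
      using * by (intro sum_mono) auto
    also have "\<dots> = real K * \<beta> / 16 + 336 * \<beta> / real m * ((1 - \<beta>) * (\<Sum>i<K. expected_length i) + real K)"
      by (simp only: sum.distrib sum_distrib_left[symmetric]) simp
    also have "\<dots> \<le> real K * \<beta> / 16 + 336 * \<beta> / real m * (real b + real K)"
      using sum_expected_length_le[OF len] \<beta> pos by (intro add_left_mono mult_left_mono) auto
    also have "336 * \<beta> / real m * (real b + real K) = 7 * real b / real K + 7"
      using pos by (simp add: \<beta>_def field_simps)
    finally have adv: "(\<Sum>i<K. \<beta> * (1 - \<beta>) * advantage i / real m) \<le> real m / 768 + 7 * real b / real K + 7"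
      using pos by (simp add: \<beta>_def)
    \<comment> \<open>\<open>10752 = 7 * 1536\<close>: the hypothesis on \<open>b\<close> and the
      lower bound on \<open>m\<close> each limit one part of the loss to half a unit, and
      \<open>7 = 336 / 48\<close>.\<close>
    have "7 * real b / real K \<le> real m / 1536"
      using b pos by (simp add: field_simps)
    moreover have "7 \<le> real m / 1536"
      using m by simp
    moreover have "3 / 2 * \<beta>\<^sup>2 * (real K + (real K)\<^sup>2 / real m) \<le> real m / 768"
    proof -
      have "3 / 2 * \<beta>\<^sup>2 * (real K + (real K)\<^sup>2 / real m) = (real m * (real m / real K) + real m) / 1536"
        using pos by (simp add: \<beta>_def power2_eq_square field_simps)
      also have "\<dots> \<le> (real m * 1 + real m) / 1536"
        using m pos by (intro divide_right_mono add_right_mono mult_left_mono) auto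
      finally show ?thesis by simp
    qed
    moreover have "(\<Sum>i<K. \<beta> / 4) = real m / 192"
      using pos by (simp add: \<beta>_def)
    ultimately have "real m / 768 \<le> (\<Sum>i<K. \<beta> / 4 - \<beta> * (1 - \<beta>) * advantage i / real m)
        - 3 / 2 * \<beta>\<^sup>2 * (real K + (real K)\<^sup>2 / real m)"
      using adv unfolding sum_subtractf by linarith
    then show ?thesis
      using expected_variance_ge unfolding EV_def by linarith
  qed
  hence "1 / 12288 \<le> EV / (16 * real m)"
    using pos by (simp add: field_simps)
  hence "1 / 12288 - \<epsilon>\<^sup>2 * real m / 4 \<le> hard_expectation K m \<beta> (\<lambda>A. \<Sum>h\<in>H. (\<Prod>i<Suc K. ind i (h i) (A i)) *
        of_bool (\<not> is_approx \<epsilon> (real (F0 (Suc K) A)) (v h)))"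
    using error_ge[OF \<epsilon>, of v] unfolding EV_def by linarith
  also have "\<dots> \<le> hard_expectation K m \<beta> (\<lambda>A. of_bool (\<not> is_approx \<epsilon> (real (F0 (Suc K) A)) (protocol_output \<pi> A)))"
    using \<beta> by (intro hard_expectation_mono) (simp_all only: error_eq)
  finally show ?thesis
    by (simp only: \<beta>_def)
qed

text \<open>Yao's averaging argument: every deterministic protocol in the support errs with
  probability at least \<open>1 / 24576\<close> on the hard distribution, so by exchanging the
  averages some input has at least this error over the coins. The window term is at most
  \<open>1 / 24576\<close>, half of \<open>1 / 12288\<close>.\<close>

lemma randomized_protocol_bits:
  assumes P: "randomized_protocol (Suc K) P" and approx: "approximates_F0 (Suc K) m \<epsilon> \<delta> P"
    and bits: "\<And>\<pi> A. \<pi> \<in> set_pmf P \<Longrightarrow> A \<in> inputs (Suc K) m \<Longrightarrow> bits_exchanged \<pi> A \<le> b"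
    and m: "10752 \<le> m" "m \<le> K" and \<epsilon>: "0 \<le> \<epsilon>" "\<epsilon>\<^sup>2 * real m \<le> 1 / 6144" and \<delta>: "\<delta> < 1 / 24576"
  shows "real K * real m < 10752 * real b"
proof (rule ccontr)
  assume "\<not> ?thesis"
  hence b: "10752 * real b \<le> real K * real m" by simp
  define \<beta> where "\<beta> = real m / (48 * real K)"
  define err :: "protocol \<Rightarrow> (nat \<Rightarrow> nat set) \<Rightarrow> real"
    where "err \<pi> A = of_bool (\<not> is_approx \<epsilon> (real (F0 (Suc K) A)) (protocol_output \<pi> A))" for \<pi> A
  have \<beta>: "0 \<le> \<beta>" "\<beta> \<le> 1"
    using m by (auto simp: \<beta>_def field_simps)
  have err: "\<bar>err \<pi> A\<bar> \<le> 1" for \<pi> A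
    by (simp add: err_def)
  have ge: "1 / 24576 \<le> hard_expectation K m \<beta> (err \<pi>)" if \<pi>: "\<pi> \<in> set_pmf P" for \<pi>
  proof -
    have "1 / 12288 - \<epsilon>\<^sup>2 * real m / 4 \<le> hard_expectation K m \<beta> (err \<pi>)"
      unfolding \<beta>_def err_def using P \<pi> bits[OF \<pi>] m b \<epsilon>(1)
      by (intro protocol_error_ge) (auto simp: randomized_protocol_def)
    then show ?thesis using \<epsilon>(2) by simp
  qed
  have "1 / 24576 = measure_pmf.expectation P (\<lambda>_. 1 / 24576 :: real)"
    by simp
  also have "\<dots> \<le> measure_pmf.expectation P (\<lambda>\<pi>. hard_expectation K m \<beta> (err \<pi>))"
  proof (rule integral_mono_AE)
    show "integrable (measure_pmf P) (\<lambda>\<pi>. hard_expectation K m \<beta> (err \<pi>))"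
      using \<beta> m err by (intro measure_pmf.integrable_const_bound[of _ 1])
        (auto intro!: AE_pmfI abs_hard_expectation_le_1)
    show "AE \<pi> in measure_pmf P. 1 / 24576 \<le> hard_expectation K m \<beta> (err \<pi>)"
      using ge by (rule AE_pmfI)
  qed simp
  also have "\<dots> = hard_expectation K m \<beta> (\<lambda>A. measure_pmf.expectation P (\<lambda>\<pi>. err \<pi> A))"
    by (rule expectation_hard_expectation[OF err])
  also have "\<dots> \<le> hard_expectation K m \<beta> (\<lambda>_. \<delta>)"
  proof (rule hard_expectation_mono[OF \<beta>])
    fix A assume A: "A \<in> inputs (Suc K) m"
    have "err \<pi> A = indicator {\<pi>. \<not> is_approx \<epsilon> (real (F0 (Suc K) A)) (protocol_output \<pi> A)} \<pi>" for \<pi>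
      by (simp add: err_def indicator_def)
    then show "measure_pmf.expectation P (\<lambda>\<pi>. err \<pi> A) \<le> \<delta>"
      using approx A by (simp add: approximates_F0_def)
  qed
  also have "\<dots> = \<delta>"
    using m by (intro hard_expectation_const) auto
  finally show False
    using \<delta> by simp
qed

lemma inputs_mono: "m \<le> N \<Longrightarrow> inputs k m \<subseteq> inputs k N"
  unfolding inputs_def by (intro PiE_mono Pow_mono) auto

text \<open>The constant \<open>10 ^ 8\<close> for \<open>c\<^sub>\<beta>\<close> makes
  \<open>m\<close> at least 10752 after division by 6144 and rounding, and makes \<open>k\<close>
  large enough for \<open>m \<le> K\<close>. The error \<open>1 / 50000\<close> lies below
  \<open>1 / 24576\<close>; \<open>C = 1\<close> suffices because
  \<open>m \<le> 1 / \<epsilon>\<^sup>2\<close>; and \<open>c = 1 / 10 ^ 9\<close> absorbs the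
  product \<open>2 * 12288 * 10752\<close> of all losses.\<close>

theorem theorem3:
  "\<exists>c\<^sub>\<beta> \<delta> C c :: real. 1 < c\<^sub>\<beta> \<and> 0 < \<delta> \<and> 0 < C \<and> 0 < c \<and>
    (\<forall>(k::nat) (\<epsilon>::real) (N::nat) (P::protocol pmf).
      0 < \<epsilon> \<longrightarrow> \<epsilon> < 1 \<longrightarrow> c\<^sub>\<beta> \<le> 1 / \<epsilon>\<^sup>2 \<longrightarrow> 1 / \<epsilon>\<^sup>2 \<le> real k / c\<^sub>\<beta> \<longrightarrow>
      C / \<epsilon>\<^sup>2 \<le> real N \<longrightarrow>
      randomized_protocol k P \<longrightarrow> approximates_F0 k N \<epsilon> \<delta> P \<longrightarrow>
      ereal (c * (real k / (\<epsilon>\<^sup>2 * log 2 (\<epsilon>\<^sup>2 * real k))))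
        \<le> ereal_of_enat (communication_complexity k N P))"
proof (intro exI conjI allI impI)
  fix k N :: nat and \<epsilon> :: real and P :: "protocol pmf"
  assume \<epsilon>: "0 < \<epsilon>" "\<epsilon> < 1" and n: "10 ^ 8 \<le> 1 / \<epsilon>\<^sup>2" "1 / \<epsilon>\<^sup>2 \<le> real k / 10 ^ 8"
    and N: "1 / \<epsilon>\<^sup>2 \<le> real N"
    and P: "randomized_protocol k P" and approx: "approximates_F0 k N \<epsilon> (1 / 50000) P"
  define n where "n = 1 / \<epsilon>\<^sup>2"
  \<comment> \<open>The divisor 6144 limits the window term
    \<open>\<epsilon>\<^sup>2 * m / 4\<close> to \<open>1 / 24576\<close>.\<close>
  define m where "m = nat \<lfloor>n / 6144\<rfloor>"
  define K where "K = k - 1"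
  have n_pos: "10 ^ 8 \<le> n" "n * 10 ^ 8 \<le> real k"
    using n by (simp_all add: n_def field_simps)
  have m: "real m \<le> n / 6144" "n / 6144 - 1 \<le> real m"
    using n_pos by (auto simp: m_def) linarith+
  have m_half: "n / 12288 \<le> real m" and "10752 \<le> real m"
    using m n_pos by simp_all
  hence m_large: "10752 \<le> m"
    by simp
  have k: "k = Suc K" "real k / 2 \<le> real K" "m \<le> K"
    using m n_pos by (auto simp: K_def of_nat_diff)
  \<comment> \<open>Inputs over \<open>{1..m}\<close> are also inputs over \<open>{1..N}\<close>, so
    correctness and the bound on the bits pass to the smaller universe.\<close>
  have mN: "m \<le> N"
    using m N n_pos by (simp add: n_def)
  show "ereal (1 / 10 ^ 9 * (real k / (\<epsilon>\<^sup>2 * log 2 (\<epsilon>\<^sup>2 * real k))))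
      \<le> ereal_of_enat (communication_complexity k N P)"
  proof (cases "communication_complexity k N P")
    case (enat b)
    have bits: "bits_exchanged \<pi> A \<le> b" if "\<pi> \<in> set_pmf P" "A \<in> inputs k m" for \<pi> A
    proof -
      have "enat (bits_exchanged \<pi> A) \<le> communication_complexity k N P"
        unfolding communication_complexity_def using that inputs_mono[OF mN]
        by (intro SUP_upper2[of \<pi>] SUP_upper2[of A]) auto
      then show ?thesis by (simp add: enat)
    qed
    have "real K * real m < 10752 * real b"
    proof (rule randomized_protocol_bits)
      show "randomized_protocol (Suc K) P" "approximates_F0 (Suc K) m \<epsilon> (1 / 50000) P"
        using P approx inputs_mono[OF mN, of k] by (auto simp: k(1) approximates_F0_def)
      show "\<epsilon>\<^sup>2 * real m \<le> 1 / 6144"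
        using m(1) \<epsilon> by (simp add: n_def field_simps)
    qed (use bits m_large k \<epsilon> in auto)
    moreover have "real k / 2 * (n / 12288) \<le> real K * real m"
      using k m_half n_pos by (intro mult_mono) auto
    ultimately have "1 / 10 ^ 9 * (real k * n) \<le> real b"
    proof -
      have "0 \<le> real k * n" using n_pos by simp
      then show ?thesis
        using \<open>real K * real m < 10752 * real b\<close> \<open>real k / 2 * (n / 12288) \<le> real K * real m\<close> by simp
    qed
    \<comment> \<open>The logarithm is at least 1 because
      \<open>\<epsilon>\<^sup>2 * k \<ge> 2\<close>, so dividing by it only weakens the bound of
      order \<open>k / \<epsilon>\<^sup>2\<close> just obtained.\<close>
    moreover have "real k / (\<epsilon>\<^sup>2 * log 2 (\<epsilon>\<^sup>2 * real k)) \<le> real k * n"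
    proof -
      have "2 \<le> \<epsilon>\<^sup>2 * real k"
        using n_pos(2) \<epsilon> by (simp add: n_def field_simps)
      hence "1 \<le> log 2 (\<epsilon>\<^sup>2 * real k)"
        by (subst le_log_iff) auto
      hence "real k * n / log 2 (\<epsilon>\<^sup>2 * real k) \<le> real k * n / 1"
        using n_pos by (intro divide_left_mono) auto
      then show ?thesis by (simp add: n_def)
    qed
    ultimately have "1 / 10 ^ 9 * (real k / (\<epsilon>\<^sup>2 * log 2 (\<epsilon>\<^sup>2 * real k))) \<le> real b"
      by (meson divide_nonneg_nonneg mult_left_mono order_trans zero_le_one zero_le_numeral zero_le_power)
    then show ?thesis
      by (simp add: enat)
  qed simp
qed auto

end
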